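(* Let $U\subset T\times C$ be an enumerative problem of degree $d$ with Galois group $G$, and let $\phi:\tilde T\to T$ be a Galois covering with group of deck transformations $D$. Let $\tilde G$ be the Galois group of the $\phi$-wreath enumerative problem $\tilde U\to C$, so that $\tilde G\subset W:=D\wr G$. Assume that $\phi$ is strongly inductive. Then the inclusion $\tilde G\subset W$ is an equality if and only if, for some ranking $\delta$ (or, equivalently, for every ranking $\delta$), we have $$H_1(T)^d=H_\delta+\phi_*\big(H_1(\tilde T)^d\big).$$
   Context: All homology is singular with integer coefficients. Enumerative problem: a pair of smooth complex algebraic varieties $T$ and $C$, with $C$ connected, and an algebraic set $U\subset T\times C$ such that the projection $c:U\to C$ is generically finite. Shrinking $C$ to a Zariski open subset, one always assumes that $c:U\to C$ is a (finite) covering. Its degree $d$ is the number of points of a fiber $c^{-1}(f)$ (the "solutions"), and its Galois group $G$ is the monodromy group of the covering $c$, a subgroup of $\mathfrak{S}(S)$, where $S:=c^{-1}(f)$ for a base point $f\in C$. The projection of $U$ to $T$ is denoted by $t$. $\phi$-wreath problem: for a (finite) covering $\phi:\tilde T\to T$, the set $\tilde U\subset\tilde T\times C$ is the preimage of $U$ under $(\phi,\mathrm{id}):\tilde T\times C\to T\times C$, with its projection $\tilde U\to C$. When $\phi$ is Galois with deck group $D$, $D$ acts on the fiber $\tilde S$ of $\tilde U\to C$ over $f$ with orbits the fibers of $\tilde S\to S$. Choosing a point over each $s\in S$ identifies $\tilde S$ with $D\times S$. The wreath product $W=D\wr G$ is the semidirect product of $D^S$ and $G$ ($G\subset\mathfrak{S}(S)$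 permuting factors); it is identified with the group of permutations of $\tilde S$ that commute with $D$ and induce on $S$ an element of $G$. The monodromy group $\tilde G$ is contained in $W$. Inductive covering: a covering of path-connected spaces $\pi:X\to Y$ such that the natural embedding of commutator subgroups $\pi_1'(X)\to\pi_1'(Y)$ is an isomorphism; then $\pi_*:H_1(X)\to H_1(Y)$ is injective. It is strongly inductive if moreover the embedding of torsion subgroups $H_1^T(X)\to H_1^T(Y)$ is an isomorphism. Solution lattice: a ranking is a bijection $\delta:S\to\{1,\ldots,d\}$. For a loop $\gamma$ in $C$ based at $f$ whose induced permutation of $S$ is the identity, each solution $s\in S$ travels along a loop in $T$ (the image under $t$ of the lift of $\gamma$ starting at $s$), with homology class $\gamma_s\in H_1(T)$. Ordering the elements $\gamma_s$ according to $\delta$ gives a vector $\gamma_\delta\in H_1(T)^d$. The solution lattice $H_\delta\subset H_1(T)^d$ is the set (a subgroup) of all vectors $\gamma_\delta$ obtained in this way. *)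

theory Defs
  imports
    "HOL-Homology.Homology"
    "HOL-Analysis.Analysis"
    "HOL-Algebra.Generated_Groups"
    "HOL-Library.Function_Algebras"
begin

section \<open>Complex algebraic varieties\<close>

subsection \<open>Affine algebraic sets\<close>

text \<open>
  Affine \<open>n\<close>-space is realised as the set of sequences vanishing from index \<open>n\<close> on, so that
  the dimension can be an ordinary natural number. Its Euclidean topology is induced from the
  product topology on \<^typ>\<open>nat \<Rightarrow> complex\<close>.
\<close>

definition affine_space :: "nat \<Rightarrow> (nat \<Rightarrow> complex) set" where
  "affine_space n = {x. \<forall>i\<ge>n. x i = 0}"

inductive_set polynomial_functions :: "nat \<Rightarrow> ((nat \<Rightarrow> complex) \<Rightarrow> complex) set" for n :: nat where
  const: "(\<lambda>x. a) \<in> polynomial_functions n"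
| coord: "i < n \<Longrightarrow> (\<lambda>x. x i) \<in> polynomial_functions n"
| add: "p \<in> polynomial_functions n \<Longrightarrow> q \<in> polynomial_functions n
          \<Longrightarrow> (\<lambda>x. p x + q x) \<in> polynomial_functions n"
| mult: "p \<in> polynomial_functions n \<Longrightarrow> q \<in> polynomial_functions n
          \<Longrightarrow> (\<lambda>x. p x * q x) \<in> polynomial_functions n"

definition affine_algebraic :: "nat \<Rightarrow> (nat \<Rightarrow> complex) set \<Rightarrow> bool" where
  "affine_algebraic n A \<longleftrightarrow>
     (\<exists>P \<subseteq> polynomial_functions n. A = {x \<in> affine_space n. \<forall>p\<in>P. p x = 0})"

definition vanishing_ideal :: "nat \<Rightarrow> (nat \<Rightarrow> complex) set \<Rightarrow> ((nat \<Rightarrow> complex) \<Rightarrow> complex) set" where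
  "vanishing_ideal n A = {p \<in> polynomial_functions n. \<forall>x\<in>A. p x = 0}"

text \<open>
  A function on a Zariski open subset \<open>Q\<close> of an affine algebraic set is regular if it is locally
  a quotient of polynomials. The sets \<open>{y \<in> Q. q y \<noteq> 0}\<close> are a base of the Zariski topology,
  so the neighbourhood can be taken to be the nonvanishing locus of the denominator.
\<close>

definition regular_on :: "nat \<Rightarrow> (nat \<Rightarrow> complex) set \<Rightarrow> ((nat \<Rightarrow> complex) \<Rightarrow> complex) \<Rightarrow> bool" where
  "regular_on n Q g \<longleftrightarrow>
     (\<forall>x\<in>Q. \<exists>p\<in>polynomial_functions n. \<exists>q\<in>polynomial_functions n.
        q x \<noteq> 0 \<and> (\<forall>y\<in>Q. q y \<noteq> 0 \<longrightarrow> g y = p y / q y))"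

definition irreducible_affine :: "nat \<Rightarrow> (nat \<Rightarrow> complex) set \<Rightarrow> bool" where
  "irreducible_affine n Z \<longleftrightarrow> affine_algebraic n Z \<and> Z \<noteq> {} \<and>
     (\<forall>A B. affine_algebraic n A \<longrightarrow> affine_algebraic n B \<longrightarrow> Z = A \<union> B \<longrightarrow> Z = A \<or> Z = B)"

text \<open>
  Dimension of \<open>A\<close> at \<open>x\<close>: the Krull dimension of the local ring, i.e. the maximal length of a
  chain of irreducible closed subsets of \<open>A\<close> through \<open>x\<close> (bounded by \<open>n\<close>, so that the supremum
  is a maximum).
\<close>

definition local_dimension :: "nat \<Rightarrow> (nat \<Rightarrow> complex) set \<Rightarrow> (nat \<Rightarrow> complex) \<Rightarrow> nat" where
  "local_dimension n A x =
     Sup {m. \<exists>Z :: nat \<Rightarrow> (nat \<Rightarrow> complex) set.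
            (\<forall>i\<le>m. irreducible_affine n (Z i)) \<and> x \<in> Z 0 \<and>
            (\<forall>i<m. Z i \<subset> Z (Suc i)) \<and> Z m \<subseteq> A}"

definition tangent_space ::
    "nat \<Rightarrow> (nat \<Rightarrow> complex) set \<Rightarrow> (nat \<Rightarrow> complex) \<Rightarrow> (nat \<Rightarrow> complex) set" where
  "tangent_space n A x =
     {v \<in> affine_space n. \<forall>p\<in>vanishing_ideal n A.
        (\<Sum>i<n. deriv (\<lambda>z. p (x(i := z))) (x i) * v i) = 0}"

abbreviation cscale :: "complex \<Rightarrow> (nat \<Rightarrow> complex) \<Rightarrow> nat \<Rightarrow> complex" where
  "cscale \<equiv> \<lambda>c v i. c * v i"

lemma vector_space_cscale: "vector_space cscale"
  by unfold_locales (auto simp: fun_eq_iff algebra_simps)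

definition smooth_at :: "nat \<Rightarrow> (nat \<Rightarrow> complex) set \<Rightarrow> (nat \<Rightarrow> complex) \<Rightarrow> bool" where
  "smooth_at n A x \<longleftrightarrow> vector_space.dim cscale (tangent_space n A x) = local_dimension n A x"


subsection \<open>Abstract varieties\<close>

text \<open>
  Varieties in the sense of Serre's FAC (reduced, separated, of finite type, not necessarily
  irreducible or quasi-projective), given by a finite atlas of affine charts.
\<close>

record 'a chart =
  chart_dim :: nat
  chart_dom :: "'a set"
  chart_map :: "'a \<Rightarrow> nat \<Rightarrow> complex"

definition chart_image :: "'a chart \<Rightarrow> (nat \<Rightarrow> complex) set" where
  "chart_image c = chart_map c ` chart_dom c"

text \<open>The identification of \<open>\<complex>\<^sup>n \<times> \<complex>\<^sup>m\<close> with \<open>\<complex>\<^sup>n\<^sup>+\<^sup>m\<close>.\<close>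

definition append_coords :: "nat \<Rightarrow> (nat \<Rightarrow> complex) \<Rightarrow> (nat \<Rightarrow> complex) \<Rightarrow> nat \<Rightarrow> complex" where
  "append_coords n v w = (\<lambda>i. if i < n then v i else w (i - n))"

definition product_coords :: "'a chart \<Rightarrow> 'b chart \<Rightarrow> 'a \<times> 'b \<Rightarrow> nat \<Rightarrow> complex" where
  "product_coords c c' = (\<lambda>(x, y). append_coords (chart_dim c) (chart_map c x) (chart_map c' y))"

text \<open>
  The five clauses: finitely many charts; each is a bijection onto an affine algebraic set;
  overlaps are Zariski open; coordinate changes are regular; and the diagonal is Zariski closed
  in the product (Serre's separation axiom).
\<close>

definition algebraic_variety :: "'a chart set \<Rightarrow> bool" where
  "algebraic_variety V \<longleftrightarrow>
     finite V \<and>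
     (\<forall>c\<in>V. inj_on (chart_map c) (chart_dom c) \<and> affine_algebraic (chart_dim c) (chart_image c)) \<and>
     (\<forall>c\<in>V. \<forall>c'\<in>V. \<exists>Z. affine_algebraic (chart_dim c) Z \<and>
        chart_map c ` (chart_dom c \<inter> chart_dom c') = chart_image c - Z) \<and>
     (\<forall>c\<in>V. \<forall>c'\<in>V. \<forall>i<chart_dim c'.
        regular_on (chart_dim c) (chart_map c ` (chart_dom c \<inter> chart_dom c'))
          (\<lambda>v. chart_map c' (inv_into (chart_dom c) (chart_map c) v) i)) \<and>
     (\<forall>c\<in>V. \<forall>c'\<in>V. affine_algebraic (chart_dim c + chart_dim c')
        (product_coords c c' ` {(x, x) | x. x \<in> chart_dom c \<inter> chart_dom c'}))"

definition smooth_variety :: "'a chart set \<Rightarrow> bool" where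
  "smooth_variety V \<longleftrightarrow> algebraic_variety V \<and>
     (\<forall>c\<in>V. \<forall>x\<in>chart_image c. smooth_at (chart_dim c) (chart_image c) x)"

definition variety_points :: "'a chart set \<Rightarrow> 'a set" where
  "variety_points V = (\<Union>c\<in>V. chart_dom c)"

definition algebraic_subset_of_product :: "'a chart set \<Rightarrow> 'b chart set \<Rightarrow> ('a \<times> 'b) set \<Rightarrow> bool" where
  "algebraic_subset_of_product V W U \<longleftrightarrow>
     U \<subseteq> variety_points V \<times> variety_points W \<and>
     (\<forall>c\<in>V. \<forall>c'\<in>W. affine_algebraic (chart_dim c + chart_dim c')
        (product_coords c c' ` (U \<inter> chart_dom c \<times> chart_dom c')))"

text \<open>The classical (complex) topology of a variety.\<close>

definition analytic_topology :: "'a chart set \<Rightarrow> 'a topology" where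
  "analytic_topology V =
     topology_generated_by {{x \<in> chart_dom c. chart_map c x \<in> O'} | c O'. c \<in> V \<and> open O'}"

lemma topspace_analytic_topology: "topspace (analytic_topology V) = variety_points V"
  unfolding analytic_topology_def variety_points_def topology_generated_by_topspace
  by (auto intro: exI[of _ UNIV])


section \<open>Coverings\<close>

text \<open>Same definition as \<^const>\<open>covering_space\<close>, for abstract topologies.\<close>

definition covering_map :: "'a topology \<Rightarrow> 'b topology \<Rightarrow> ('a \<Rightarrow> 'b) \<Rightarrow> bool" where
  "covering_map X Y p \<longleftrightarrow>
     continuous_map X Y p \<and> p ` topspace X = topspace Y \<and>
     (\<forall>y\<in>topspace Y. \<exists>N. openin Y N \<and> y \<in> N \<and>
        (\<exists>\<V>. \<Union>\<V> = {x \<in> topspace X. p x \<in> N} \<and> pairwise disjnt \<V> \<and>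
           (\<forall>V\<in>\<V>. openin X V \<and> homeomorphic_map (subtopology X V) (subtopology Y N) p)))"

definition fiber :: "'a topology \<Rightarrow> ('a \<Rightarrow> 'b) \<Rightarrow> 'b \<Rightarrow> 'a set" where
  "fiber X p y = {x \<in> topspace X. p x = y}"

definition finite_covering :: "'a topology \<Rightarrow> 'b topology \<Rightarrow> ('a \<Rightarrow> 'b) \<Rightarrow> bool" where
  "finite_covering X Y p \<longleftrightarrow> covering_map X Y p \<and> (\<forall>y\<in>topspace Y. finite (fiber X p y))"

definition deck_transformations :: "'a topology \<Rightarrow> ('a \<Rightarrow> 'b) \<Rightarrow> ('a \<Rightarrow> 'a) set" where
  "deck_transformations X p =
     {h \<in> extensional (topspace X). homeomorphic_map X X h \<and> (\<forall>x\<in>topspace X. p (h x) = p x)}"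

definition galois_covering :: "'a topology \<Rightarrow> 'b topology \<Rightarrow> ('a \<Rightarrow> 'b) \<Rightarrow> bool" where
  "galois_covering X Y p \<longleftrightarrow> finite_covering X Y p \<and> connected_space X \<and>
     (\<forall>x\<in>topspace X. \<forall>x'\<in>topspace X. p x = p x' \<longrightarrow>
        (\<exists>h\<in>deck_transformations X p. h x = x'))"

definition loops :: "'a topology \<Rightarrow> 'a \<Rightarrow> (real \<Rightarrow> 'a) set" where
  "loops X x = {\<gamma>. pathin X \<gamma> \<and> \<gamma> 0 = x \<and> \<gamma> 1 = x}"

definition is_lift :: "'a topology \<Rightarrow> ('a \<Rightarrow> 'b) \<Rightarrow> (real \<Rightarrow> 'b) \<Rightarrow> (real \<Rightarrow> 'a) \<Rightarrow> bool" where
  "is_lift X p \<gamma> \<gamma>' \<longleftrightarrow> pathin X \<gamma>' \<and> (\<forall>u\<in>{0..1}. p (\<gamma>' u) = \<gamma> u)"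

definition monodromy_group :: "'a topology \<Rightarrow> 'b topology \<Rightarrow> ('a \<Rightarrow> 'b) \<Rightarrow> 'b \<Rightarrow> ('a \<Rightarrow> 'a) set" where
  "monodromy_group X Y p f =
     {g. g permutes fiber X p f \<and>
         (\<exists>\<gamma>\<in>loops Y f. \<forall>s\<in>fiber X p f. \<exists>\<gamma>'. is_lift X p \<gamma> \<gamma>' \<and> \<gamma>' 0 = s \<and> \<gamma>' 1 = g s)}"


section \<open>Inductive coverings\<close>

definition loop_homotopic :: "'a topology \<Rightarrow> 'a \<Rightarrow> (real \<Rightarrow> 'a) \<Rightarrow> (real \<Rightarrow> 'a) \<Rightarrow> bool" where
  "loop_homotopic X x =
     homotopic_with (\<lambda>r. r 0 = x \<and> r 1 = x) (subtopology euclideanreal {0..1}) X"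

definition loop_class :: "'a topology \<Rightarrow> 'a \<Rightarrow> (real \<Rightarrow> 'a) \<Rightarrow> (real \<Rightarrow> 'a) set" where
  "loop_class X x \<gamma> = {\<gamma>'. loop_homotopic X x \<gamma> \<gamma>'}"

text \<open>Same as \<^const>\<open>joinpaths\<close>, without its type class constraint.\<close>

definition concat_loops :: "(real \<Rightarrow> 'a) \<Rightarrow> (real \<Rightarrow> 'a) \<Rightarrow> real \<Rightarrow> 'a" where
  "concat_loops \<alpha> \<beta> = (\<lambda>u. if u \<le> 1/2 then \<alpha> (2 * u) else \<beta> (2 * u - 1))"

definition fundamental_group :: "'a topology \<Rightarrow> 'a \<Rightarrow> (real \<Rightarrow> 'a) set monoid" where
  "fundamental_group X x =
     \<lparr>carrier = loop_class X x ` loops X x,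
      monoid.mult = (\<lambda>A B. \<Union>\<alpha>\<in>A. \<Union>\<beta>\<in>B. loop_class X x (concat_loops \<alpha> \<beta>)),
      one = loop_class X x (\<lambda>_. x)\<rparr>"

definition fundamental_group_map ::
    "'b topology \<Rightarrow> ('a \<Rightarrow> 'b) \<Rightarrow> 'a \<Rightarrow> (real \<Rightarrow> 'a) set \<Rightarrow> (real \<Rightarrow> 'b) set" where
  "fundamental_group_map Y p x A = (\<Union>\<alpha>\<in>A. loop_class Y (p x) (p \<circ> \<alpha>))"

definition commutator_subgroup :: "('a, 'b) monoid_scheme \<Rightarrow> ('a, 'b) monoid_scheme" where
  "commutator_subgroup G = G\<lparr>carrier := derived G (carrier G)\<rparr>"

definition torsion_subgroup :: "('a, 'b) monoid_scheme \<Rightarrow> ('a, 'b) monoid_scheme" where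
  "torsion_subgroup G = G\<lparr>carrier := {a \<in> carrier G. \<exists>n::nat. n > 0 \<and> a [^]\<^bsub>G\<^esub> n = \<one>\<^bsub>G\<^esub>}\<rparr>"

abbreviation H1 :: "'a topology \<Rightarrow> 'a chain set monoid" where
  "H1 X \<equiv> homology_group 1 X"

abbreviation H1_map :: "'a topology \<Rightarrow> 'b topology \<Rightarrow> ('a \<Rightarrow> 'b) \<Rightarrow> 'a chain set \<Rightarrow> 'b chain set" where
  "H1_map X Y p \<equiv> hom_induced 1 X {} Y {} p"

definition inductive_covering :: "'a topology \<Rightarrow> 'b topology \<Rightarrow> ('a \<Rightarrow> 'b) \<Rightarrow> bool" where
  "inductive_covering X Y p \<longleftrightarrow>
     covering_map X Y p \<and> path_connected_space X \<and> path_connected_space Y \<and>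
     (\<forall>x\<in>topspace X. fundamental_group_map Y p x \<in>
        iso (commutator_subgroup (fundamental_group X x))
            (commutator_subgroup (fundamental_group Y (p x))))"

definition strongly_inductive_covering :: "'a topology \<Rightarrow> 'b topology \<Rightarrow> ('a \<Rightarrow> 'b) \<Rightarrow> bool" where
  "strongly_inductive_covering X Y p \<longleftrightarrow>
     inductive_covering X Y p \<and>
     H1_map X Y p \<in> iso (torsion_subgroup (H1 X)) (torsion_subgroup (H1 Y))"


section \<open>Enumerative problems\<close>

definition incidence_topology :: "'a topology \<Rightarrow> 'b topology \<Rightarrow> ('a \<times> 'b) set \<Rightarrow> ('a \<times> 'b) topology" where
  "incidence_topology X Y U = subtopology (prod_topology X Y) U"

text \<open>
  The parameter space is understood to be already shrunk to a Zariski open subset over which the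
  generically finite projection is a finite covering.
\<close>

definition enumerative_problem :: "'a chart set \<Rightarrow> 'b chart set \<Rightarrow> ('a \<times> 'b) set \<Rightarrow> bool" where
  "enumerative_problem T C U \<longleftrightarrow>
     smooth_variety T \<and> smooth_variety C \<and> connected_space (analytic_topology C) \<and>
     algebraic_subset_of_product T C U \<and>
     finite_covering (incidence_topology (analytic_topology T) (analytic_topology C) U)
       (analytic_topology C) snd"

definition solutions :: "'a topology \<Rightarrow> 'b topology \<Rightarrow> ('a \<times> 'b) set \<Rightarrow> 'b \<Rightarrow> ('a \<times> 'b) set" where
  "solutions X Y U f = fiber (incidence_topology X Y U) snd f"

definition galois_group ::
    "'a topology \<Rightarrow> 'b topology \<Rightarrow> ('a \<times> 'b) set \<Rightarrow> 'b \<Rightarrow> ('a \<times> 'b \<Rightarrow> 'a \<times> 'b) set" where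
  "galois_group X Y U f = monodromy_group (incidence_topology X Y U) Y snd f"

definition wreath_incidence :: "'c topology \<Rightarrow> ('c \<Rightarrow> 'a) \<Rightarrow> ('a \<times> 'b) set \<Rightarrow> ('c \<times> 'b) set" where
  "wreath_incidence X' \<phi> U = {(x, y). x \<in> topspace X' \<and> (\<phi> x, y) \<in> U}"


subsection \<open>The wreath product\<close>

text \<open>
  For a set \<open>D\<close> acting on \<open>S'\<close> and a group \<open>G\<close> of permutations of the quotient \<open>\<pi> ` S'\<close>: the
  permutations of \<open>S'\<close> that commute with \<open>D\<close> and induce an element of \<open>G\<close> on the quotient.
\<close>

definition wreath_permutations ::
    "'d set \<Rightarrow> ('d \<Rightarrow> 'x \<Rightarrow> 'x) \<Rightarrow> 'x set \<Rightarrow> ('x \<Rightarrow> 's) \<Rightarrow> ('s \<Rightarrow> 's) set \<Rightarrow> ('x \<Rightarrow> 'x) set" where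
  "wreath_permutations D act S' \<pi> G =
     {w. w permutes S' \<and> (\<forall>h\<in>D. \<forall>z\<in>S'. w (act h z) = act h (w z)) \<and>
         (\<exists>g\<in>G. \<forall>z\<in>S'. \<pi> (w z) = g (\<pi> z))}"

text \<open>
  The abstract wreath product, i.e. the semidirect product of \<open>D\<^sup>S\<close> and \<open>G\<close>, and its action on
  \<open>S'\<close> after choosing a point \<open>\<sigma> s\<close> over each \<open>s \<in> S\<close>. The inverse appears because the
  permutations of a torsor commuting with left translations are the right translations.
\<close>

definition wreath_product :: "('d, 'e) monoid_scheme \<Rightarrow> 's set \<Rightarrow> ('s \<Rightarrow> 's) set
    \<Rightarrow> (('s \<Rightarrow> 'd) \<times> ('s \<Rightarrow> 's)) monoid" where
  "wreath_product D S G =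
     \<lparr>carrier = (S \<rightarrow>\<^sub>E carrier D) \<times> G,
      monoid.mult = (\<lambda>(a, g) (b, k). (\<lambda>s\<in>S. a s \<otimes>\<^bsub>D\<^esub> b (inv_into UNIV g s), g \<circ> k)),
      one = (\<lambda>s\<in>S. \<one>\<^bsub>D\<^esub>, id)\<rparr>"

definition wreath_action :: "('d, 'e) monoid_scheme \<Rightarrow> ('d \<Rightarrow> 'x \<Rightarrow> 'x) \<Rightarrow> 'x set \<Rightarrow> ('x \<Rightarrow> 's)
    \<Rightarrow> ('s \<Rightarrow> 'x) \<Rightarrow> ('s \<Rightarrow> 'd) \<times> ('s \<Rightarrow> 's) \<Rightarrow> 'x \<Rightarrow> 'x" where
  "wreath_action D act S' \<pi> \<sigma> = (\<lambda>(a, g) z.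
     if z \<in> S' then
       act ((THE h. h \<in> carrier D \<and> z = act h (\<sigma> (\<pi> z))) \<otimes>\<^bsub>D\<^esub> inv\<^bsub>D\<^esub> a (g (\<pi> z))) (\<sigma> (g (\<pi> z)))
     else z)"

text \<open>
  When \<open>D\<close> acts freely with orbits the fibers of \<open>\<pi>\<close>, as a deck group does, the choice of \<open>\<sigma>\<close>
  identifies the abstract wreath product with \<^const>\<open>wreath_permutations\<close>.
\<close>

lemma wreath_product_as_permutations:
  fixes D (structure) and act :: "'d \<Rightarrow> 'x \<Rightarrow> 'x" and \<pi> :: "'x \<Rightarrow> 's"
  assumes D: "group D"
    and act_closed: "\<And>h z. h \<in> carrier D \<Longrightarrow> z \<in> S' \<Longrightarrow> act h z \<in> S'"
    and act_mult: "\<And>h k z. h \<in> carrier D \<Longrightarrow> k \<in> carrier D \<Longrightarrow> z \<in> S' \<Longrightarrow>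
          act (h \<otimes> k) z = act h (act k z)"
    and act_one: "\<And>z. z \<in> S' \<Longrightarrow> act \<one> z = z"
    and free: "\<And>h k z. h \<in> carrier D \<Longrightarrow> k \<in> carrier D \<Longrightarrow> z \<in> S' \<Longrightarrow>
          act h z = act k z \<Longrightarrow> h = k"
    and orbits: "\<And>z z'. z \<in> S' \<Longrightarrow> z' \<in> S' \<Longrightarrow>
          \<pi> z = \<pi> z' \<longleftrightarrow> (\<exists>h\<in>carrier D. z' = act h z)"
    and S: "S = \<pi> ` S'"
    and G: "\<And>g. g \<in> G \<Longrightarrow> g permutes S"
    and base: "\<And>s. s \<in> S \<Longrightarrow> \<sigma> s \<in> S' \<and> \<pi> (\<sigma> s) = s"
  shows "bij_betw (wreath_action D act S' \<pi> \<sigma>) (carrier (wreath_product D S G))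
           (wreath_permutations (carrier D) act S' \<pi> G)"
    and "\<And>v w. v \<in> carrier (wreath_product D S G) \<Longrightarrow> w \<in> carrier (wreath_product D S G) \<Longrightarrow>
           wreath_action D act S' \<pi> \<sigma> (v \<otimes>\<^bsub>wreath_product D S G\<^esub> w) =
           wreath_action D act S' \<pi> \<sigma> v \<circ> wreath_action D act S' \<pi> \<sigma> w"
proof -
  interpret D: group D by fact
  let ?A = "wreath_action D act S' \<pi> \<sigma>"
  let ?W = "carrier (wreath_product D S G)"
  have \<sigma>: "\<sigma> s \<in> S'" "\<pi> (\<sigma> s) = s" if "s \<in> S" for s using base that by auto
  have \<pi>: "\<pi> z \<in> S" if "z \<in> S'" for z using S that by auto
  have \<pi>_act: "\<pi> (act h z) = \<pi> z" if "h \<in> carrier D" "z \<in> S'" for h z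
    using orbits[OF that(2) act_closed[OF that]] that(1) by metis
  have coord: "\<exists>h\<in>carrier D. \<exists>s\<in>S. z = act h (\<sigma> s) \<and> \<pi> z = s" if "z \<in> S'" for z
    using orbits[of "\<sigma> (\<pi> z)" z] \<sigma> \<pi> that by metis
  have gS: "g s \<in> S" if "g \<in> G" "s \<in> S" for g s
    using G[OF that(1)] that(2) by (simp add: permutes_in_image)
  have A_eval: "?A (a, g) (act h (\<sigma> s)) = act (h \<otimes> inv a (g s)) (\<sigma> (g s))"
    if "h \<in> carrier D" "s \<in> S" for a g h s
  proof -
    have 1: "(THE k. k \<in> carrier D \<and> act h (\<sigma> s) = act k (\<sigma> s)) = h"
    proof (rule the_equality)
      fix k assume "k \<in> carrier D \<and> act h (\<sigma> s) = act k (\<sigma> s)"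
      then show "k = h" using free[of k h "\<sigma> s"] \<sigma>[OF that(2)] that by metis
    qed (use that in simp)
    have 2: "\<pi> (act h (\<sigma> s)) = s" using \<pi>_act[of h "\<sigma> s"] \<sigma>[OF that(2)] that by simp
    have 3: "act h (\<sigma> s) \<in> S'" using act_closed[of h "\<sigma> s"] \<sigma>[OF that(2)] that by simp
    show ?thesis unfolding wreath_action_def by (simp only: prod.case 2 3 if_True 1)
  qed
  have A_out: "?A v z = z" if "z \<notin> S'" for v z
    using that by (cases v) (simp add: wreath_action_def)
  have W: "v \<in> ?W \<longleftrightarrow> (\<exists>a g. v = (a, g) \<and> a \<in> S \<rightarrow>\<^sub>E carrier D \<and> g \<in> G)" for v
    by (auto simp: wreath_product_def)
  have aD: "a s \<in> carrier D" if "a \<in> S \<rightarrow>\<^sub>E carrier D" "s \<in> S" for a s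
    using that by auto
  show mult: "?A (v \<otimes>\<^bsub>wreath_product D S G\<^esub> w) = ?A v \<circ> ?A w" if v: "v \<in> ?W" and w: "w \<in> ?W" for v w
  proof
    fix z
    obtain a g b k where v': "v = (a, g)" "a \<in> S \<rightarrow>\<^sub>E carrier D" "g \<in> G"
      and w': "w = (b, k)" "b \<in> S \<rightarrow>\<^sub>E carrier D" "k \<in> G" using v w unfolding W by blast
    show "?A (v \<otimes>\<^bsub>wreath_product D S G\<^esub> w) z = (?A v \<circ> ?A w) z"
    proof (cases "z \<in> S'")
      case True
      then obtain h s where h: "h \<in> carrier D" and s: "s \<in> S" and z: "z = act h (\<sigma> s)"
        using coord by meson
      have ks: "k s \<in> S" "g (k s) \<in> S" using gS s v' w' by auto
      have gk: "inv_into UNIV g (g (k s)) = k s"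
        using G[OF v'(3)] by (simp add: permutes_inj)
      have "?A (v \<otimes>\<^bsub>wreath_product D S G\<^esub> w) z
          = act (h \<otimes> inv (a (g (k s)) \<otimes> b (k s))) (\<sigma> (g (k s)))"
        unfolding z using A_eval[OF h s] ks gk by (simp add: wreath_product_def v' w')
      also have "\<dots> = act ((h \<otimes> inv b (k s)) \<otimes> inv a (g (k s))) (\<sigma> (g (k s)))"
        using aD[OF v'(2) ks(2)] aD[OF w'(2) ks(1)] h(1)
        by (simp add: D.inv_mult_group D.m_assoc)
      also have "\<dots> = ?A v (?A w z)"
        unfolding z w' v' A_eval[OF h s]
        using aD[OF w'(2) ks(1)] h by (subst A_eval) (use ks in auto)
      finally show ?thesis by simp
    next
      case False then show ?thesis using A_out by simp
    qed
  qed
  have A_closed: "?A v z \<in> S'" and \<pi>_A: "\<pi> (?A v z) = snd v (\<pi> z)" if v: "v \<in> ?W" and z: "z \<in> S'" for v z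
  proof -
    obtain a g where v': "v = (a, g)" "a \<in> S \<rightarrow>\<^sub>E carrier D" "g \<in> G" using v unfolding W by blast
    obtain h s where h: "h \<in> carrier D" and s: "s \<in> S" and z': "z = act h (\<sigma> s)" and s': "\<pi> z = s"
      using coord[OF z] by blast
    have gs: "g s \<in> S" using gS v' s by auto
    have *: "?A v z = act (h \<otimes> inv a (g s)) (\<sigma> (g s))"
      unfolding z' v' A_eval[OF h s] ..
    have hh: "h \<otimes> inv a (g s) \<in> carrier D" using h aD[OF v'(2) gs] by simp
    show "?A v z \<in> S'" unfolding * using act_closed[OF hh \<sigma>(1)[OF gs]] .
    show "\<pi> (?A v z) = snd v (\<pi> z)"
      unfolding * s' using \<pi>_act[OF hh \<sigma>(1)[OF gs]] \<sigma>(2)[OF gs] v' by simp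
  qed
  have comm: "?A v (act k z) = act k (?A v z)" if v: "v \<in> ?W" and z: "z \<in> S'" and k: "k \<in> carrier D" for v z k
  proof -
    obtain a g where v': "v = (a, g)" "a \<in> S \<rightarrow>\<^sub>E carrier D" "g \<in> G" using v unfolding W by blast
    obtain h s where h: "h \<in> carrier D" and s: "s \<in> S" and z': "z = act h (\<sigma> s)"
      using coord[OF z] by blast
    have gs: "g s \<in> S" using gS v' s by auto
    have ad: "a (g s) \<in> carrier D" using aD[OF v'(2) gs] .
    have "act k z = act (k \<otimes> h) (\<sigma> s)" using act_mult k h \<sigma>[OF s] z' by simp
    then have "?A v (act k z) = act ((k \<otimes> h) \<otimes> inv a (g s)) (\<sigma> (g s))"
      using A_eval[of "k \<otimes> h" s a g] k h s v' by simp
    also have "\<dots> = act k (act (h \<otimes> inv a (g s)) (\<sigma> (g s)))"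
      using act_mult[of k "h \<otimes> inv a (g s)" "\<sigma> (g s)"] k h ad \<sigma>[OF gs] by (simp add: D.m_assoc)
    also have "\<dots> = act k (?A v z)" unfolding z' v' A_eval[OF h s] ..
    finally show ?thesis .
  qed
  show "bij_betw ?A ?W (wreath_permutations (carrier D) act S' \<pi> G)"
    unfolding bij_betw_def
  proof (intro conjI equalityI subsetI)
    show "inj_on ?A ?W"
    proof (rule inj_onI)
      fix v w assume v: "v \<in> ?W" and w: "w \<in> ?W" and eq: "?A v = ?A w"
      obtain a g b k where v': "v = (a, g)" "a \<in> S \<rightarrow>\<^sub>E carrier D" "g \<in> G"
        and w': "w = (b, k)" "b \<in> S \<rightarrow>\<^sub>E carrier D" "k \<in> G" using v w unfolding W by blast
      have gk: "g s = k s" for s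
      proof (cases "s \<in> S")
        case True
        then show ?thesis using \<pi>_A[OF v, of "\<sigma> s"] \<pi>_A[OF w, of "\<sigma> s"] \<sigma> eq v' w' by auto
      next
        case False
        then show ?thesis using G[OF v'(3)] G[OF w'(3)] by (simp add: permutes_not_in)
      qed
      then have "g = k" by auto
      have "a s = b s" for s
      proof (cases "s \<in> S")
        case True
        then obtain r where r: "r \<in> S" "s = g r" using G[OF v'(3)] by (metis permutes_image imageE)
        have "act (\<one> \<otimes> inv a s) (\<sigma> s) = act (\<one> \<otimes> inv b s) (\<sigma> s)"
          using A_eval[OF D.one_closed r(1), of a g] A_eval[OF D.one_closed r(1), of b g] eq r v' w' \<open>g = k\<close>
          by simp
        then have "inv a s = inv b s"
          using free[of "inv a s" "inv b s" "\<sigma> s"] \<sigma>[OF True] aD[OF v'(2) True] aD[OF w'(2) True] by simp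
        then show ?thesis using aD[OF v'(2) True] aD[OF w'(2) True] by (metis D.inv_inv)
      next
        case False
        then show ?thesis using v'(2) w'(2) by (metis PiE_arb)
      qed
      then show "v = w" using \<open>g = k\<close> v' w' by auto
    qed
  next
    fix w assume "w \<in> ?A ` ?W"
    then obtain v where v: "v \<in> ?W" "w = ?A v" by auto
    obtain a g where v': "v = (a, g)" "a \<in> S \<rightarrow>\<^sub>E carrier D" "g \<in> G" using v(1) unfolding W by blast
    have "inj_on w S'"
    proof (rule inj_onI)
      fix y z assume y: "y \<in> S'" and z: "z \<in> S'" and eq: "w y = w z"
      have "g (\<pi> y) = g (\<pi> z)" using \<pi>_A[OF v(1) y] \<pi>_A[OF v(1) z] eq v v' by simp
      then have "\<pi> y = \<pi> z" using G[OF v'(3)] by (metis permutes_inverses(2))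
      then obtain h where h: "h \<in> carrier D" "z = act h y" using orbits[OF y z] by blast
      then have "act h (w y) = w y" using comm[OF v(1) y h(1)] eq v by simp
      then have "h = \<one>" using free[of h "\<one>" "w y"] h A_closed[OF v(1) y] act_one v by simp
      then show "y = z" using h act_one y by simp
    qed
    moreover have "w ` S' = S'"
    proof (intro equalityI subsetI)
      fix z assume z: "z \<in> S'"
      then obtain r where r: "r \<in> S" "\<pi> z = g r" using G[OF v'(3)] \<pi> by (metis permutes_image imageE)
      then have "\<pi> (w (\<sigma> r)) = \<pi> z" using \<pi>_A[OF v(1), of "\<sigma> r"] \<sigma> v v' by simp
      then obtain h where h: "h \<in> carrier D" "z = act h (w (\<sigma> r))"
        using orbits[of "w (\<sigma> r)" z] A_closed[OF v(1), of "\<sigma> r"] \<sigma> r z v(2) by auto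
      then have "z = w (act h (\<sigma> r))" using comm[OF v(1)] \<sigma> r v by simp
      then show "z \<in> w ` S'" using act_closed h \<sigma> r by blast
    qed (use A_closed[OF v(1)] v in auto)
    ultimately have "w permutes S'"
      by (intro bij_imp_permutes) (use A_out v in \<open>auto simp: bij_betw_def\<close>)
    then show "w \<in> wreath_permutations (carrier D) act S' \<pi> G"
      unfolding wreath_permutations_def using comm[OF v(1)] \<pi>_A[OF v(1)] v v' by auto
  next
    fix w assume "w \<in> wreath_permutations (carrier D) act S' \<pi> G"
    then obtain g where perm: "w permutes S'" and g: "g \<in> G" "\<And>z. z \<in> S' \<Longrightarrow> \<pi> (w z) = g (\<pi> z)"
      and wcomm: "\<And>h z. h \<in> carrier D \<Longrightarrow> z \<in> S' \<Longrightarrow> w (act h z) = act h (w z)"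
      unfolding wreath_permutations_def by blast
    have wS: "w z \<in> S'" if "z \<in> S'" for z using perm that by (simp add: permutes_in_image)
    have "\<exists>b\<in>carrier D. w (\<sigma> s) = act b (\<sigma> (g s))" if "s \<in> S" for s
      using orbits[of "\<sigma> (g s)" "w (\<sigma> s)"] g that \<sigma> gS wS by auto
    then obtain b where b: "\<And>s. s \<in> S \<Longrightarrow> b s \<in> carrier D \<and> w (\<sigma> s) = act (b s) (\<sigma> (g s))"
      by metis
    define a where "a = (\<lambda>s\<in>S. inv b (inv_into UNIV g s))"
    have gi: "inv_into UNIV g s \<in> S" if "s \<in> S" for s
      using permutes_inv[OF G[OF g(1)]] that by (simp add: permutes_in_image)
    have ga: "a (g s) = inv b s" if "s \<in> S" for s
      using that gS[OF g(1)] G[OF g(1)] by (simp add: a_def permutes_inj)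
    have v: "(a, g) \<in> ?W" unfolding W using b gi g by (auto simp: a_def)
    have "?A (a, g) z = w z" for z
    proof (cases "z \<in> S'")
      case True
      then obtain h s where h: "h \<in> carrier D" and s: "s \<in> S" and z: "z = act h (\<sigma> s)"
        using coord by meson
      have "w z = act h (act (b s) (\<sigma> (g s)))" unfolding z using wcomm h \<sigma>[OF s] b[OF s] by simp
      also have "\<dots> = act (h \<otimes> b s) (\<sigma> (g s))"
        using act_mult h b[OF s] \<sigma> gS[OF g(1) s] by simp
      also have "\<dots> = ?A (a, g) z" unfolding z A_eval[OF h s] using ga[OF s] b[OF s] by simp
      finally show ?thesis by simp
    next
      case False
      then show ?thesis using A_out perm by (simp add: permutes_not_in)
    qed
    then show "w \<in> ?A ` ?W" using v by (intro image_eqI[of _ _ "(a, g)"]) auto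
  qed
qed

text \<open>A deck transformation \<open>h\<close> acts on the solutions of the wreath problem by \<open>h \<times> id\<close>.\<close>

definition wreath_group :: "'c topology \<Rightarrow> 'a topology \<Rightarrow> 'b topology \<Rightarrow> ('c \<Rightarrow> 'a)
    \<Rightarrow> ('a \<times> 'b) set \<Rightarrow> 'b \<Rightarrow> ('c \<times> 'b \<Rightarrow> 'c \<times> 'b) set" where
  "wreath_group X' X Y \<phi> U f =
     wreath_permutations (deck_transformations X' \<phi>) (\<lambda>h. map_prod h id)
       (solutions X' Y (wreath_incidence X' \<phi> U) f) (map_prod \<phi> id) (galois_group X Y U f)"


subsection \<open>The solution lattice\<close>

text \<open>
  The singular 1-simplex of a path is parametrised by the second barycentric coordinate, so that
  it runs from \<open>\<gamma> 0\<close> to \<open>\<gamma> 1\<close>.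
\<close>

definition homology_class_of_loop :: "'a topology \<Rightarrow> (real \<Rightarrow> 'a) \<Rightarrow> 'a chain set" where
  "homology_class_of_loop X \<gamma> =
     homologous_rel_set 1 X {} (frag_of (restrict (\<lambda>v. \<gamma> (v 1)) (standard_simplex 1)))"

definition ranking :: "'s set \<Rightarrow> ('s \<Rightarrow> nat) \<Rightarrow> bool" where
  "ranking S \<delta> \<longleftrightarrow> bij_betw \<delta> S {1..card S}"

abbreviation H1_power :: "'a topology \<Rightarrow> nat \<Rightarrow> (nat \<Rightarrow> 'a chain set) monoid" where
  "H1_power X d \<equiv> product_group {1..d} (\<lambda>_. H1 X)"

text \<open>
  If every solution \<open>s\<close> is the start and end point of a lift of \<open>\<gamma>\<close>, then \<open>\<gamma>\<close> induces the identity
  permutation; the condition on \<open>v\<close> then says \<open>v = \<gamma>\<^sub>\<delta>\<close>.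
\<close>

definition solution_lattice :: "'a topology \<Rightarrow> 'b topology \<Rightarrow> ('a \<times> 'b) set \<Rightarrow> 'b
    \<Rightarrow> ('a \<times> 'b \<Rightarrow> nat) \<Rightarrow> (nat \<Rightarrow> 'a chain set) set" where
  "solution_lattice X Y U f \<delta> =
     {v \<in> extensional {1..card (solutions X Y U f)}.
        \<exists>\<gamma>\<in>loops Y f. \<forall>s\<in>solutions X Y U f. \<exists>\<gamma>'.
          is_lift (incidence_topology X Y U) snd \<gamma> \<gamma>' \<and> \<gamma>' 0 = s \<and> \<gamma>' 1 = s \<and>
          v (\<delta> s) = homology_class_of_loop X (fst \<circ> \<gamma>')}"

definition H1_power_image ::
    "'c topology \<Rightarrow> 'a topology \<Rightarrow> ('c \<Rightarrow> 'a) \<Rightarrow> nat \<Rightarrow> (nat \<Rightarrow> 'a chain set) set" where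
  "H1_power_image X' X \<phi> d =
     (\<lambda>v. \<lambda>i\<in>{1..d}. H1_map X' X \<phi> (v i)) ` carrier (H1_power X' d)"

end

theory Submission
  imports Defs
begin

text \<open>
  Why the theorem holds. Both \<open>G'\<close> and \<open>W\<close> act on the solutions of the wreath problem, and both
  map onto the Galois group \<open>G\<close> of the original problem. So they agree as soon as the kernels agree,
  and the kernel of \<open>W \<rightarrow> G\<close> is \<open>D\<^sup>S\<close>: one deck transformation for each solution, chosen
  independently. The kernel of \<open>G' \<rightarrow> G\<close> comes from the loops \<open>\<gamma>\<close> at \<open>f\<close> that fix every solution;
  such a loop makes each solution \<open>s\<close> run along a loop \<open>\<gamma>\<^sub>s\<close> at \<open>t(s)\<close> in \<open>T\<close>, and acts on the fibre
  of \<open>\<phi>\<close> over \<open>t(s)\<close> by the monodromy of \<open>\<gamma>\<^sub>s\<close>.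

  The bridge to homology is the fact that, for an inductive Galois covering, the monodromy of a
  loop in \<open>T\<close> is decided by the class of the loop in \<open>H\<^sub>1(T) / \<phi>\<^sub>*H\<^sub>1(T')\<close>, and is
  trivial exactly for the zero class. Under this identification of \<open>D\<close> with \<open>H\<^sub>1(T) / \<phi>\<^sub>*H\<^sub>1(T')\<close>
  the kernel of \<open>G' \<rightarrow> G\<close> is the image of the solution lattice in \<open>(H\<^sub>1(T) / \<phi>\<^sub>*H\<^sub>1(T'))\<^sup>d\<close>, and
  that it is everything is the equation of the theorem. The two halves of the bridge are
  \<open>same_transport_homologous\<close> and \<open>homologous_loops_same_transport\<close>.

  The first half is direct: two loops with a common effect on a point of \<open>T'\<close> have lifts with the
  same endpoints, and the difference of these lifts is a cycle in \<open>T'\<close>. For the second half, inductivity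
  enters through one consequence: a commutator of loops in \<open>T\<close> is homotopic to the projection of a loop in
  \<open>T'\<close>, hence has trivial monodromy, and so \<open>D\<close> is abelian (\<open>deck_commute\<close>). Once \<open>D\<close> is abelian,
  monodromy can be read off on the level of chains. A section of \<open>\<phi>\<close> gives every point of \<open>T'\<close> a
  position in \<open>D\<close>, and every singular 1-simplex of \<open>T\<close> a displacement in \<open>D\<close>, the change of
  position along its lifts. The displacement extends to a homomorphism from 1-chains to \<open>D\<close>. It
  vanishes on boundaries because triangles lift to \<open>T'\<close>, and on projections of cycles because the
  change of position around a cycle in \<open>T'\<close> telescopes. So it is defined on
  \<open>H\<^sub>1(T) / \<phi>\<^sub>*H\<^sub>1(T')\<close>. This replaces the Hurewicz isomorphism, of which only the easy part
  remains: in a path-connected space every class in \<open>H\<^sub>1\<close> is the class of a loop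
  (\<open>H1_class_of_loop\<close>).
\<close>

section \<open>Paths and their transport in a covering\<close>

lemma pathin_compose_reparam:
  assumes "pathin X g" "continuous_on {0..1} r" "r ` {0..1} \<subseteq> {0..1::real}"
  shows "pathin X (g \<circ> r)"
  unfolding pathin_def
  by (rule continuous_map_compose[where X' = "subtopology euclideanreal {0..1}"])
    (use assms in \<open>auto simp: pathin_def continuous_map_in_subtopology\<close>)

lemma pathin_topspace: "pathin X g \<Longrightarrow> u \<in> {0..1} \<Longrightarrow> g u \<in> topspace X"
  unfolding pathin_def continuous_map by auto

lemma pathin_reverse:
  assumes "pathin X g" shows "pathin X (\<lambda>u. g (1 - u))"
proof -
  have "pathin X (g \<circ> (\<lambda>u. 1 - u))"
    by (intro pathin_compose_reparam[OF assms] continuous_intros) auto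
  then show ?thesis by (simp add: o_def)
qed

lemma pathin_concat:
  assumes "pathin X \<alpha>" "pathin X \<beta>" "\<alpha> 1 = \<beta> 0"
  shows "pathin X (concat_loops \<alpha> \<beta>)"
  unfolding pathin_def concat_loops_def
proof (rule continuous_map_cases_le)
  have *: "continuous_map (subtopology euclideanreal A) X (g \<circ> r)"
    if "pathin X g" "continuous_on A r" "r ` A \<subseteq> {0..1::real}" for g A r
    by (rule continuous_map_compose[where X' = "subtopology euclideanreal {0..1}"])
      (use that in \<open>auto simp: pathin_def continuous_map_in_subtopology\<close>)
  show "continuous_map (subtopology (top_of_set {0..1}) {u \<in> topspace (top_of_set {0..1}). u \<le> 1/2})
     X (\<lambda>u. \<alpha> (2 * u))"
    unfolding subtopology_subtopology
    by (rule *[OF assms(1), of _ "\<lambda>u. 2*u", unfolded o_def]) (auto intro!: continuous_intros)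
  show "continuous_map (subtopology (top_of_set {0..1}) {u \<in> topspace (top_of_set {0..1}). 1/2 \<le> u})
     X (\<lambda>u. \<beta> (2 * u - 1))"
    unfolding subtopology_subtopology
    by (rule *[OF assms(2), of _ "\<lambda>u. 2*u - 1", unfolded o_def]) (auto intro!: continuous_intros)
qed (use assms in \<open>auto simp: mult.commute\<close>)

text \<open>
  A relation instead of a function, because lifts enter \<^const>\<open>monodromy_group\<close> in this form. For a
  covering it is the graph of a bijection between the fibres over the end points of the path.
\<close>
definition transport :: "'e topology \<Rightarrow> ('e \<Rightarrow> 'b) \<Rightarrow> (real \<Rightarrow> 'b) \<Rightarrow> 'e \<Rightarrow> 'e \<Rightarrow> bool" where
  "transport E p \<gamma> e e' \<longleftrightarrow> (\<exists>\<gamma>'. is_lift E p \<gamma> \<gamma>' \<and> \<gamma>' 0 = e \<and> \<gamma>' 1 = e')"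

lemma transport_ends:
  assumes "transport E p \<gamma> e e'"
  shows "e \<in> topspace E" "e' \<in> topspace E" "p e = \<gamma> 0" "p e' = \<gamma> 1"
  using assms unfolding transport_def is_lift_def
  by (auto dest: pathin_topspace[of _ _ 0] pathin_topspace[of _ _ 1])

lemma transport_cong:
  assumes "transport E p \<gamma> e e'" "\<And>u. u \<in> {0..1} \<Longrightarrow> \<gamma> u = \<beta> u"
  shows "transport E p \<beta> e e'"
  using assms unfolding transport_def is_lift_def by auto

lemma transport_of_path:
  assumes "pathin E \<gamma>" shows "transport E p (p \<circ> \<gamma>) (\<gamma> 0) (\<gamma> 1)"
  using assms unfolding transport_def is_lift_def by auto

lemma transport_const:
  assumes "e \<in> topspace E" shows "transport E p (\<lambda>_. p e) e e"
  using transport_of_path[of E "\<lambda>_. e" p] assms by (simp add: pathin_const o_def)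

lemma transport_reverse:
  assumes "transport E p \<gamma> e e'"
  shows "transport E p (\<lambda>u. \<gamma> (1 - u)) e' e"
proof -
  obtain a where "is_lift E p \<gamma> a" "a 0 = e" "a 1 = e'" using assms unfolding transport_def by blast
  then show ?thesis using pathin_reverse[of E a] unfolding transport_def is_lift_def
    by (intro exI[of _ "\<lambda>u. a (1 - u)"]) auto
qed

lemma transport_concat:
  assumes "transport E p \<alpha> e e'" "transport E p \<beta> e' e''"
  shows "transport E p (concat_loops \<alpha> \<beta>) e e''"
proof -
  obtain a b where "is_lift E p \<alpha> a" "a 0 = e" "a 1 = e'" "is_lift E p \<beta> b" "b 0 = e'" "b 1 = e''"
    using assms unfolding transport_def by blast
  then show ?thesis unfolding transport_def
    by (intro exI[of _ "concat_loops a b"]) (auto simp: is_lift_def pathin_concat, auto simp: concat_loops_def)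
qed

lemma transport_compose:
  assumes "transport E p \<gamma> e e'" "continuous_map E E' h" "\<And>x. x \<in> topspace E \<Longrightarrow> p' (h x) = q (p x)"
  shows "transport E' p' (q \<circ> \<gamma>) (h e) (h e')"
proof -
  obtain a where a: "is_lift E p \<gamma> a" "a 0 = e" "a 1 = e'" using assms(1) unfolding transport_def by blast
  then have "pathin E a" by (simp add: is_lift_def)
  then have "pathin E' (h \<circ> a)" using assms(2) pathin_compose by blast
  moreover have "p' (h (a u)) = q (\<gamma> u)" if "u \<in> {0..1}" for u
    using assms(3) pathin_topspace[OF \<open>pathin E a\<close> that] a that unfolding is_lift_def by auto
  ultimately show ?thesis using a unfolding transport_def is_lift_def by (intro exI[of _ "h \<circ> a"]) auto
qed

definition evenly_covered :: "'e topology \<Rightarrow> 'b topology \<Rightarrow> ('e \<Rightarrow> 'b) \<Rightarrow> 'b set \<Rightarrow> bool" where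
  "evenly_covered E B p N \<longleftrightarrow> openin B N \<and>
        (\<exists>\<V>. \<Union>\<V> = {x \<in> topspace E. p x \<in> N} \<and> pairwise disjnt \<V> \<and>
           (\<forall>V\<in>\<V>. openin E V \<and> homeomorphic_map (subtopology E V) (subtopology B N) p))"

lemma covering_map_evenly_covered:
  assumes "covering_map E B p" "y \<in> topspace B"
  obtains N where "evenly_covered E B p N" "y \<in> N"
  using assms unfolding covering_map_def evenly_covered_def by meson

lemma evenly_coveredE:
  assumes "evenly_covered E B p N"
  obtains \<V> where "openin B N" "\<Union>\<V> = {x \<in> topspace E. p x \<in> N}" "pairwise disjnt \<V>"
    "\<And>V. V \<in> \<V> \<Longrightarrow> openin E V"
    "\<And>V. V \<in> \<V> \<Longrightarrow> homeomorphic_map (subtopology E V) (subtopology B N) p"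
  using assms unfolding evenly_covered_def by metis

lemma inj_on_sheet:
  assumes "openin E V" "openin B N" "homeomorphic_map (subtopology E V) (subtopology B N) p"
  shows "inj_on p V"
proof -
  have "topspace E \<inter> V = V" "topspace B \<inter> N = N" using openin_subset[OF assms(1)] openin_subset[OF assms(2)] by auto
  then show ?thesis using assms(3) unfolding homeomorphic_eq_everything_map by auto
qed

text \<open>
  The set where two lifts agree is open, because a sheet is mapped injectively, and so is its
  complement, because distinct sheets are disjoint.
\<close>
lemma lift_unique_connected:
  assumes cov: "covering_map E B p"
    and K: "connected_space K" and f: "continuous_map K E f" and g: "continuous_map K E g"
    and eq: "\<And>k. k \<in> topspace K \<Longrightarrow> p (f k) = p (g k)"
    and k0: "k0 \<in> topspace K" "f k0 = g k0" and k: "k \<in> topspace K"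
  shows "f k = g k"
proof -
  have loc: "\<exists>Q. openin K Q \<and> x \<in> Q \<and> ((\<forall>y\<in>Q. f y = g y) \<or> (\<forall>y\<in>Q. f y \<noteq> g y))" if x: "x \<in> topspace K" for x
  proof -
    have fx: "f x \<in> topspace E" "g x \<in> topspace E" using f g x by (auto simp: continuous_map)
    have "p (f x) \<in> topspace B" using cov fx unfolding covering_map_def by (auto simp: continuous_map)
    then obtain N where "evenly_covered E B p N" and N: "p (f x) \<in> N"
      using covering_map_evenly_covered[OF cov] by blast
    then obtain \<V> where NB: "openin B N" and V: "\<Union>\<V> = {x \<in> topspace E. p x \<in> N}" "pairwise disjnt \<V>"
      "\<And>V. V \<in> \<V> \<Longrightarrow> openin E V"
      "\<And>V. V \<in> \<V> \<Longrightarrow> homeomorphic_map (subtopology E V) (subtopology B N) p"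
      by (elim evenly_coveredE) blast
    obtain V1 V2 where V12: "V1 \<in> \<V>" "V2 \<in> \<V>" "f x \<in> V1" "g x \<in> V2"
      using V(1) fx N eq[OF x] by (metis (mono_tags, lifting) UnionE mem_Collect_eq)
    define Q where "Q = {y \<in> topspace K. f y \<in> V1} \<inter> {y \<in> topspace K. g y \<in> V2}"
    have "openin K Q" unfolding Q_def
      using openin_continuous_map_preimage[OF f] openin_continuous_map_preimage[OF g] V V12 by blast
    moreover have "x \<in> Q" using x V12 by (auto simp: Q_def)
    moreover have "(\<forall>y\<in>Q. f y = g y) \<or> (\<forall>y\<in>Q. f y \<noteq> g y)"
    proof (cases "V1 = V2")
      case True
      have "inj_on p V1" using inj_on_sheet[of E V1 B N p] V V12 NB by blast
      then have "\<forall>y\<in>Q. f y = g y" using eq True unfolding Q_def inj_on_def by blast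
      then show ?thesis ..
    next
      case False
      then have "disjnt V1 V2" using V(2) V12 by (auto simp: pairwise_def)
      then have "\<forall>y\<in>Q. f y \<noteq> g y" unfolding Q_def disjnt_def by auto
      then show ?thesis ..
    qed
    ultimately show ?thesis by blast
  qed
  define A where "A = {x \<in> topspace K. f x = g x}"
  have "\<exists>Q. openin K Q \<and> x \<in> Q \<and> Q \<subseteq> A" if x: "x \<in> A" for x
  proof -
    obtain Q where Q: "openin K Q" "x \<in> Q" "(\<forall>y\<in>Q. f y = g y) \<or> (\<forall>y\<in>Q. f y \<noteq> g y)"
      using loc[of x] x unfolding A_def by blast
    then have "Q \<subseteq> A" using x openin_subset[OF Q(1)] unfolding A_def by blast
    then show ?thesis using Q by blast
  qed
  then have "openin K A" using openin_subopen[of K A] by simp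
  moreover have "\<exists>Q. openin K Q \<and> x \<in> Q \<and> Q \<subseteq> topspace K - A" if x: "x \<in> topspace K - A" for x
  proof -
    obtain Q where Q: "openin K Q" "x \<in> Q" "(\<forall>y\<in>Q. f y = g y) \<or> (\<forall>y\<in>Q. f y \<noteq> g y)"
      using loc[of x] x by blast
    then have "Q \<subseteq> topspace K - A" using x openin_subset[OF Q(1)] unfolding A_def by blast
    then show ?thesis using Q by blast
  qed
  then have "openin K (topspace K - A)" using openin_subopen[of K "topspace K - A"] by simp
  ultimately have "closedin K A" "openin K A"
    by (auto simp: closedin_def A_def)
  then have "A = {} \<or> A = topspace K" using K unfolding connected_space_clopen_in by blast
  then show ?thesis using k0 k unfolding A_def by auto
qed

lemma connected_unit_interval: "connected_space (top_of_set {0..1::real})"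
  by (simp add: connected_space_subtopology connectedin_iff_connected)

lemma transport_unique:
  assumes "covering_map E B p" "transport E p \<gamma> e e1" "transport E p \<gamma> e e2"
  shows "e1 = e2"
proof -
  obtain a b where ab: "is_lift E p \<gamma> a" "a 0 = e" "a 1 = e1" "is_lift E p \<gamma> b" "b 0 = e" "b 1 = e2"
    using assms(2,3) unfolding transport_def by blast
  have "a 1 = b 1"
    by (rule lift_unique_connected[OF assms(1) connected_unit_interval, of a b 0 1])
      (use ab in \<open>auto simp: is_lift_def pathin_def\<close>)
  then show ?thesis using ab by simp
qed

lemma transport_unique_start:
  assumes "covering_map E B p" "transport E p \<gamma> e1 e" "transport E p \<gamma> e2 e"
  shows "e1 = e2"
  using transport_unique[OF assms(1) assms(2)[THEN transport_reverse] assms(3)[THEN transport_reverse]] .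

text \<open>
  The sheet through \<open>e\<close> has a local inverse of \<open>p\<close>, which lifts all paths in \<open>N\<close> without leaving the sheet.
\<close>
lemma transport_evenly_covered:
  assumes ev: "evenly_covered E B p N" and e: "e \<in> topspace E" "p e \<in> N"
  obtains V where "e \<in> V" "inj_on p V"
    "\<And>\<gamma>. pathin B \<gamma> \<Longrightarrow> (\<And>u. u \<in> {0..1} \<Longrightarrow> \<gamma> u \<in> N) \<Longrightarrow> \<exists>x\<in>V. \<exists>y\<in>V. transport E p \<gamma> x y"
proof -
  obtain \<V> where NB: "openin B N" and V: "\<Union>\<V> = {x \<in> topspace E. p x \<in> N}"
      "\<And>V. V \<in> \<V> \<Longrightarrow> openin E V"
      "\<And>V. V \<in> \<V> \<Longrightarrow> homeomorphic_map (subtopology E V) (subtopology B N) p"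
      using ev by (elim evenly_coveredE) blast
  obtain V where VV: "V \<in> \<V>" "e \<in> V" using V(1) e by (metis (mono_tags, lifting) UnionE mem_Collect_eq)
  have inj: "inj_on p V" using inj_on_sheet[of E V B N p] V VV NB by blast
  have sub: "V \<subseteq> topspace E" "N \<subseteq> topspace B" using V VV NB openin_subset by metis+
  obtain q where q: "homeomorphic_maps (subtopology E V) (subtopology B N) p q"
    using V(3)[OF VV(1)] homeomorphic_map_maps by blast
  show ?thesis
  proof (rule that[OF VV(2) inj])
    fix \<gamma> assume \<gamma>: "pathin B \<gamma>" "\<And>u. u \<in> {0..1} \<Longrightarrow> \<gamma> u \<in> N"
    have "pathin (subtopology B N) \<gamma>" using \<gamma> by (auto simp: pathin_subtopology)
    then have "pathin (subtopology E V) (q \<circ> \<gamma>)"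
      using pathin_compose q unfolding homeomorphic_maps_def by blast
    then have *: "pathin E (q \<circ> \<gamma>)" "\<And>u. u \<in> {0..1} \<Longrightarrow> q (\<gamma> u) \<in> V" by (auto simp: pathin_subtopology)
    have "p (q (\<gamma> u)) = \<gamma> u" if "u \<in> {0..1}" for u
      using q \<gamma>(2)[OF that] sub unfolding homeomorphic_maps_def by auto
    then have "transport E p \<gamma> (q (\<gamma> 0)) (q (\<gamma> 1))"
      using * unfolding transport_def is_lift_def by (intro exI[of _ "q \<circ> \<gamma>"]) auto
    then show "\<exists>x\<in>V. \<exists>y\<in>V. transport E p \<gamma> x y" using *(2)[of 0] *(2)[of 1] by auto
  qed
qed

section \<open>Path lifting and lifting of triangles\<close>

text \<open>
  A Lebesgue number for the cover of \<open>K\<close> by preimages of evenly covered sets; it starts the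
  bisection arguments below.
\<close>
lemma evenly_covered_radius:
  fixes K :: "'k::euclidean_space set"
  assumes cov: "covering_map E B p" and K: "compact K" and F: "continuous_map (top_of_set K) B F"
  obtains \<epsilon> where "\<epsilon> > 0" "\<And>x. x \<in> K \<Longrightarrow> \<exists>N. evenly_covered E B p N \<and> F ` (K \<inter> ball x \<epsilon>) \<subseteq> N"
proof -
  define \<G> where "\<G> = {Q. open Q \<and> (\<exists>N. evenly_covered E B p N \<and> F ` (K \<inter> Q) \<subseteq> N)}"
  have "K \<subseteq> \<Union>\<G>"
  proof
    fix x assume x: "x \<in> K"
    then have "F x \<in> topspace B" using F by (auto simp: continuous_map)
    then obtain N where N: "evenly_covered E B p N" "F x \<in> N" using covering_map_evenly_covered[OF cov] by blast
    have "openin B N" using N(1) by (simp add: evenly_covered_def)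
    then have "openin (top_of_set K) {y \<in> K. F y \<in> N}"
      using openin_continuous_map_preimage[OF F] by simp
    then obtain Q where "open Q" "{y \<in> K. F y \<in> N} = K \<inter> Q" unfolding openin_open by blast
    then have "Q \<in> \<G>" "x \<in> Q" using N x unfolding \<G>_def by auto
    then show "x \<in> \<Union>\<G>" by blast
  qed
  then obtain \<epsilon> where e: "\<epsilon> > 0" "\<And>x. x \<in> K \<Longrightarrow> \<exists>G\<in>\<G>. ball x \<epsilon> \<subseteq> G"
    using Heine_Borel_lemma[OF K] unfolding \<G>_def by blast
  have "\<exists>N. evenly_covered E B p N \<and> F ` (K \<inter> ball x \<epsilon>) \<subseteq> N" if "x \<in> K" for x
    using e(2)[OF that] unfolding \<G>_def by blast
  then show ?thesis using that e(1) by blast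
qed

lemma linepath_in_convex:
  assumes "convex K" "a \<in> K" "b \<in> K" "u \<in> {0..1}"
  shows "linepath a b u \<in> K"
  using assms unfolding linepath_def by (auto intro: convexD)

lemma midpoint_in_convex:
  fixes K :: "'k::real_normed_vector set"
  assumes "convex K" "a \<in> K" "b \<in> K"
  shows "midpoint a b \<in> K"
  using linepath_in_convex[of K a b "1/2"] assms by (simp add: linepath_def midpoint_def scaleR_right_distrib)

lemma pathin_compose_linepath:
  fixes K :: "'k::real_normed_vector set"
  assumes "convex K" "continuous_map (top_of_set K) B F" "a \<in> K" "b \<in> K"
  shows "pathin B (F \<circ> linepath a b)"
  unfolding pathin_def
  by (rule continuous_map_compose[OF _ assms(2)])
    (use assms linepath_in_convex[of K a b] in \<open>auto simp: continuous_map_in_subtopology linepath_def intro!: continuous_intros\<close>)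

text \<open>
  Cutting a segment at its midpoint is a concatenation on the nose, without any reparametrisation,
  so transport along the halves composes to transport along the whole.
\<close>
lemma concat_linepath:
  fixes a b :: "'k::real_normed_vector"
  shows "concat_loops (F \<circ> linepath a (midpoint a b)) (F \<circ> linepath (midpoint a b) b) = F \<circ> linepath a b"
proof
  fix u :: real
  have 1: "linepath a (midpoint a b) (2*u) = linepath a b u"
    by (simp add: linepath_def midpoint_def algebra_simps flip: scaleR_left_distrib)
  have "(1 - (2*u - 1)) *\<^sub>R midpoint a b = (1 - u) *\<^sub>R (a + b)"
    by (simp add: midpoint_def)
  moreover have "(2*u - 1) *\<^sub>R b = u *\<^sub>R b - (1 - u) *\<^sub>R b"
    by (simp flip: scaleR_left_diff_distrib)
  ultimately have 2: "linepath (midpoint a b) b (2*u - 1) = linepath a b u"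
    by (simp add: linepath_def scaleR_right_distrib)
  show "concat_loops (F \<circ> linepath a (midpoint a b)) (F \<circ> linepath (midpoint a b) b) u = (F \<circ> linepath a b) u"
    using 1 2 by (simp add: concat_loops_def)
qed

context
  fixes E :: "'e topology" and B :: "'b topology" and p :: "'e \<Rightarrow> 'b"
    and K :: "'k::euclidean_space set" and F :: "'k \<Rightarrow> 'b"
  assumes cov: "covering_map E B p"
    and K: "compact K" "convex K"
    and F: "continuous_map (top_of_set K) B F"
begin

text \<open>
  Bisection: segments shorter than the Lebesgue number \<open>\<epsilon>\<close> lift because their image is evenly
  covered, and a segment shorter than \<open>2\<^sup>n\<epsilon>\<close> is the concatenation of two shorter than \<open>2\<^sup>n\<^sup>-\<^sup>1\<epsilon>\<close>.
\<close>
lemma transport_linepath_exists: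
  assumes ab: "a \<in> K" "b \<in> K" and e: "e \<in> topspace E" "p e = F a"
  shows "\<exists>e'. transport E p (F \<circ> linepath a b) e e'"
proof -
  obtain \<epsilon> where \<epsilon>: "\<epsilon> > 0" "\<And>x. x \<in> K \<Longrightarrow> \<exists>N. evenly_covered E B p N \<and> F ` (K \<inter> ball x \<epsilon>) \<subseteq> N"
    using evenly_covered_radius[OF cov K(1) F] by blast
  have *: "\<exists>e'. transport E p (F \<circ> linepath a b) e e'"
    if "a \<in> K" "b \<in> K" "dist a b < 2^n * \<epsilon>" "e \<in> topspace E" "p e = F a" for n a b e
    using that
  proof (induction n arbitrary: a b e)
    case 0
    obtain N where N: "evenly_covered E B p N" "F ` (K \<inter> ball a \<epsilon>) \<subseteq> N" using \<epsilon>(2) 0(1) by blast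
    have inN: "(F \<circ> linepath a b) u \<in> N" if "u \<in> {0..1}" for u
      using N(2) linepath_in_convex[OF K(2) 0(1,2) that] linepath_in_convex[OF convex_ball, of a a \<epsilon> b u] 0 \<epsilon>(1) that by auto
    have pe: "p e = (F \<circ> linepath a b) 0" using 0 by (simp add: linepath_0')
    then have "p e \<in> N" using inN[of 0] by simp
    then obtain V where V: "e \<in> V" "inj_on p V"
      "\<And>\<gamma>. pathin B \<gamma> \<Longrightarrow> (\<And>u. u \<in> {0..1} \<Longrightarrow> \<gamma> u \<in> N) \<Longrightarrow> \<exists>x\<in>V. \<exists>y\<in>V. transport E p \<gamma> x y"
      using transport_evenly_covered[OF N(1) 0(4)] by metis
    obtain x y where xy: "x \<in> V" "transport E p (F \<circ> linepath a b) x y"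
      using V(3)[OF pathin_compose_linepath[OF K(2) F 0(1,2)] inN] by blast
    then have "p x = p e" using pe transport_ends by metis
    then have "x = e" using V xy by (auto dest: inj_onD)
    then show ?case using xy by blast
  next
    case (Suc n)
    let ?m = "midpoint a b"
    have m: "?m \<in> K" using Suc.prems midpoint_in_convex[OF K(2)] by blast
    have d: "dist a ?m < 2^n * \<epsilon>" "dist ?m b < 2^n * \<epsilon>" using Suc.prems(3) by (auto simp: dist_midpoint)
    obtain x where x: "transport E p (F \<circ> linepath a ?m) e x" using Suc.IH[OF Suc.prems(1) m d(1)] Suc.prems by blast
    then have "x \<in> topspace E" "p x = F ?m" using transport_ends[OF x] by (auto simp: linepath_1')
    then obtain y where "transport E p (F \<circ> linepath ?m b) x y" using Suc.IH[OF m Suc.prems(2) d(2)] by blast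
    then show ?case using transport_concat[OF x] concat_linepath[of F a b] by metis
  qed
  obtain n where "dist a b / \<epsilon> < 2^n" using real_arch_pow[of 2 "dist a b / \<epsilon>"] by auto
  then have "dist a b < 2^n * \<epsilon>" using \<epsilon> by (simp add: field_simps)
  then show ?thesis using * ab e by blast
qed

text \<open>
  The form of homotopy lifting that is used throughout: transport around a triangle is trivial. The
  proof is Goursat's bisection: the midpoints of the sides cut the triangle into four, and transport
  around the whole is trivial if it is so around each of them. A triangle smaller than the
  Lebesgue number lies over one evenly covered set, so transport stays in one sheet, where a point is
  determined by its image.
\<close>
lemma transport_triangle:
  assumes abc: "a \<in> K" "b \<in> K" "c \<in> K"
    and t: "transport E p (F \<circ> linepath a b) e e1" "transport E p (F \<circ> linepath b c) e1 e2"
  shows "transport E p (F \<circ> linepath a c) e e2"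
proof -
  obtain \<epsilon> where \<epsilon>: "\<epsilon> > 0" "\<And>x. x \<in> K \<Longrightarrow> \<exists>N. evenly_covered E B p N \<and> F ` (K \<inter> ball x \<epsilon>) \<subseteq> N"
    using evenly_covered_radius[OF cov K(1) F] by blast
  let ?Q = "\<lambda>a b. transport E p (F \<circ> linepath a b)"
  have ex: "\<exists>y. ?Q b c x y" if "?Q a b w x" "b \<in> K" "c \<in> K" for a b c w x
    using transport_linepath_exists[OF that(2,3)] transport_ends[OF that(1)] by (simp add: linepath_1')
  have ex0: "\<exists>y. ?Q a c w y" if "?Q a b w x" "a \<in> K" "c \<in> K" for a b c w x
    using transport_linepath_exists[OF that(2,3)] transport_ends[OF that(1)] by (simp add: linepath_0')
  have rev: "?Q b a y x" if "?Q a b x y" for a b x y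
    by (rule transport_cong[OF transport_reverse[OF that]]) (simp add: linepath_def algebra_simps)
  have split: "\<exists>z. ?Q a (midpoint a b) x z \<and> ?Q (midpoint a b) b z y" if q: "?Q a b x y" and aK: "a \<in> K" and bK: "b \<in> K" for a b x y
  proof -
    have m: "midpoint a b \<in> K" using aK bK midpoint_in_convex[OF K(2)] by blast
    obtain z where z: "?Q a (midpoint a b) x z" using ex0[OF q aK m] by blast
    obtain y' where y': "?Q (midpoint a b) b z y'" using ex[OF z m bK] by blast
    have "?Q a b x y'" using transport_concat[OF z y'] concat_linepath[of F a b] by metis
    then have "y' = y" using transport_unique[OF cov _ q] by blast
    then show ?thesis using z y' by blast
  qed
  have *: "?Q a c e e2"
    if "a \<in> K" "b \<in> K" "c \<in> K" "dist a b < 2^n * \<epsilon>" "dist b c < 2^n * \<epsilon>" "dist a c < 2^n * \<epsilon>"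
      "?Q a b e e1" "?Q b c e1 e2" for n a b c e e1 e2
    using that
  proof (induction n arbitrary: a b c e e1 e2)
    case 0
    obtain N where N: "evenly_covered E B p N" "F ` (K \<inter> ball a \<epsilon>) \<subseteq> N" using \<epsilon>(2) 0(1) by blast
    have inN: "(F \<circ> linepath x y) u \<in> N" if "u \<in> {0..1}" "x \<in> {a,b,c}" "y \<in> {a,b,c}" for u x y
    proof -
      have "x \<in> K" "y \<in> K" "x \<in> ball a \<epsilon>" "y \<in> ball a \<epsilon>" using that 0 \<epsilon> by auto
      then have "linepath x y u \<in> K \<inter> ball a \<epsilon>"
        using linepath_in_convex[OF K(2) _ _ that(1)] linepath_in_convex[OF convex_ball _ _ that(1)] by blast
      then show ?thesis using N(2) by auto
    qed
    have e: "e \<in> topspace E" "p e = F a" using transport_ends[OF 0(7)] by (auto simp: linepath_0')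
    then have "p e \<in> N" using inN[of 0 a b] by (simp add: linepath_0')
    then obtain V where V: "e \<in> V" "inj_on p V"
      "\<And>\<gamma>. pathin B \<gamma> \<Longrightarrow> (\<And>u. u \<in> {0..1} \<Longrightarrow> \<gamma> u \<in> N) \<Longrightarrow> \<exists>x\<in>V. \<exists>y\<in>V. transport E p \<gamma> x y"
      using transport_evenly_covered[OF N(1) e(1)] by metis
    have stay: "w \<in> V" if xy: "x \<in> {a,b,c}" "y \<in> {a,b,c}" and v: "v \<in> V" "?Q x y v w" for x y v w
    proof -
      have "x \<in> K" "y \<in> K" using xy 0 by auto
      then obtain v' w' where vw: "v' \<in> V" "w' \<in> V" "?Q x y v' w'"
        using V(3)[OF pathin_compose_linepath[OF K(2) F] inN[OF _ xy]] by blast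
      have "p v' = p v" using transport_ends[OF vw(3)] transport_ends[OF v(2)] by simp
      then have "v' = v" using V vw v by (auto dest: inj_onD)
      then show ?thesis using transport_unique[OF cov vw(3)] v vw(2) by blast
    qed
    obtain e3 where e3: "?Q a c e e3" using ex0[OF 0(7,1,3)] by blast
    have "e1 \<in> V" using stay[OF _ _ V(1) 0(7)] by simp
    then have "e2 \<in> V" using stay[OF _ _ _ 0(8)] by simp
    moreover have "e3 \<in> V" using stay[OF _ _ V(1) e3] by simp
    moreover have "p e2 = p e3" using transport_ends[OF 0(8)] transport_ends[OF e3] by (simp add: linepath_1')
    ultimately have "e2 = e3" using V(2) by (auto dest: inj_onD)
    then show ?case using e3 by blast
  next
    case (Suc n)
    let ?m = "midpoint a b" and ?n = "midpoint b c" and ?l = "midpoint a c"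
    have mK: "midpoint x y \<in> K" if "x \<in> K" "y \<in> K" for x y
      using that midpoint_in_convex[OF K(2)] by blast
    have K': "?m \<in> K" "?n \<in> K" "?l \<in> K" using mK Suc.prems by auto
    have half: "dist (midpoint x y) (midpoint x z) = dist y z / 2" for x y z :: 'k
    proof -
      have "midpoint x y - midpoint x z = (1/2) *\<^sub>R (y - z)" by (simp add: midpoint_def algebra_simps)
      then show ?thesis by (simp add: dist_norm)
    qed
    have d: "dist ?m ?n < 2^n*\<epsilon>" "dist ?n ?l < 2^n*\<epsilon>" "dist ?m ?l < 2^n*\<epsilon>" "dist ?l ?n < 2^n*\<epsilon>" "dist ?l ?m < 2^n*\<epsilon>"
      using half[of b a c] half[of c b a] half[of a b c] Suc.prems(4-6)
      by (auto simp: midpoint_sym dist_commute)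
    have d2: "dist a ?m < 2^n*\<epsilon>" "dist ?m b < 2^n*\<epsilon>" "dist b ?n < 2^n*\<epsilon>" "dist ?n c < 2^n*\<epsilon>"
      "dist a ?l < 2^n*\<epsilon>" "dist ?l c < 2^n*\<epsilon>"
      using Suc.prems(4-6) by (auto simp: dist_midpoint)
    \<comment> \<open>Walk around the triangle with corners \<open>a, b, c\<close> and midpoints \<open>?m, ?n, ?l\<close>, replacing the detour
      over \<open>b\<close> by the segment from \<open>?m\<close> to \<open>?n\<close>, then that by the detour over \<open>?l\<close>.\<close>
    obtain x where x: "?Q a ?m e x" "?Q ?m b x e1" using split[OF Suc.prems(7,1,2)] by blast
    obtain y where y: "?Q b ?n e1 y" "?Q ?n c y e2" using split[OF Suc.prems(8,2,3)] by blast
    have 1: "?Q ?m ?n x y" using Suc.IH[OF K'(1) Suc.prems(2) K'(2) d2(2,3) d(1) x(2) y(1)] .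
    obtain z where z: "?Q ?m ?l x z" using ex[OF x(1) K'(1,3)] by blast
    have 2: "?Q a ?l e z" using Suc.IH[OF Suc.prems(1) K'(1,3) d2(1) d(3) d2(5) x(1) z] .
    have 3: "?Q ?l ?n z y" using Suc.IH[OF K'(3,1,2) d(5,1,4) rev[OF z] 1] .
    have 4: "?Q ?l c z e2" using Suc.IH[OF K'(3,2) Suc.prems(3) d(4) d2(4,6) 3 y(2)] .
    show ?case using transport_concat[OF 2 4] concat_linepath[of F a c] by metis
  qed
  define M where "M = dist a b + dist b c + dist a c"
  obtain n where "M / \<epsilon> < 2^n" using real_arch_pow[of 2 "M / \<epsilon>"] by auto
  then have "M < 2^n * \<epsilon>" using \<epsilon> by (simp add: field_simps)
  then have "dist a b < 2^n * \<epsilon>" "dist b c < 2^n * \<epsilon>" "dist a c < 2^n * \<epsilon>"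
    unfolding M_def using zero_le_dist[of a b] zero_le_dist[of b c] zero_le_dist[of a c] by linarith+
  then show ?thesis using * abc t by blast
qed

end

lemma transport_exists:
  assumes cov: "covering_map E B p" and g: "pathin B \<gamma>" and e: "e \<in> topspace E" "p e = \<gamma> 0"
  obtains e' where "transport E p \<gamma> e e'"
proof -
  have "\<exists>e'. transport E p (\<gamma> \<circ> linepath 0 1) e e'"
    by (rule transport_linepath_exists[OF cov, of "{0..1}"]) (use g e in \<open>auto simp: pathin_def\<close>)
  moreover have "\<gamma> \<circ> linepath 0 1 = \<gamma>" by (simp add: fun_eq_iff linepath_def)
  ultimately show ?thesis using that by metis
qed

text \<open>
  The square on which a homotopy is defined consists of two triangles, and the sides along which the
  base point stays fixed transport trivially.
\<close>
lemma transport_loop_homotopic: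
  fixes B :: "'b topology"
  assumes cov: "covering_map E B p" and h: "loop_homotopic B y \<alpha> \<beta>"
    and t: "transport E p \<alpha> e e'"
  shows "transport E p \<beta> e e'"
proof -
  obtain H :: "real \<times> real \<Rightarrow> 'b" where H: "continuous_map (prod_topology (top_of_set {0..1}) (top_of_set {0..1})) B H"
    "\<And>u. H (0, u) = \<alpha> u" "\<And>u. H (1, u) = \<beta> u" "\<And>t. t \<in> {0..1} \<Longrightarrow> H (t, 0) = y \<and> H (t, 1) = y"
    using h unfolding loop_homotopic_def homotopic_with_def by blast
  let ?K = "{0..1::real} \<times> {0..1::real}"
  have F: "continuous_map (top_of_set ?K) B H" using H(1) by simp
  have K: "compact ?K" "convex ?K" by (auto intro: compact_Times convex_Times)
  have corner: "(0,0) \<in> ?K" "(0,1) \<in> ?K" "(1,0) \<in> ?K" "(1,1) \<in> ?K" by auto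
  have ee: "e \<in> topspace E" "e' \<in> topspace E" "p e = y" "p e' = y"
    using transport_ends[OF t] H(2)[of 0] H(2)[of 1] H(4)[of 0] by auto
  have e1: "transport E p (H \<circ> linepath (0,0) (0,1)) e e'"
    by (rule transport_cong[OF t]) (simp add: linepath_def H(2)[symmetric])
  have e2: "transport E p (H \<circ> linepath (0,1) (1,1)) e' e'"
    using transport_const[OF ee(2), of p] by (rule transport_cong) (use ee H(4) in \<open>auto simp: linepath_def\<close>)
  have e3: "transport E p (H \<circ> linepath (1,0) (0,0)) e e"
    using transport_const[OF ee(1), of p] by (rule transport_cong) (use ee H(4) in \<open>auto simp: linepath_def\<close>)
  have "transport E p (H \<circ> linepath (0,0) (1,1)) e e'"
    using transport_triangle[OF cov K F corner(1,2,4) e1 e2] .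
  then have "transport E p (H \<circ> linepath (1,0) (1,1)) e e'"
    using transport_triangle[OF cov K F corner(3,1,4) e3] by blast
  then show ?thesis by (rule transport_cong) (simp add: linepath_def H(3)[symmetric])
qed

section \<open>First homology and loops\<close>

text \<open>
  The singular 1-simplex of a path, parametrised as in \<^const>\<open>homology_class_of_loop\<close>, and the
  path of a singular 1-simplex. They are inverse to each other up to values outside the unit interval.
\<close>
definition path_simplex :: "(real \<Rightarrow> 'a) \<Rightarrow> (nat \<Rightarrow> real) \<Rightarrow> 'a" where
  "path_simplex g = restrict (\<lambda>v. g (v 1)) (standard_simplex 1)"

definition simplex_path :: "((nat \<Rightarrow> real) \<Rightarrow> 'a) \<Rightarrow> real \<Rightarrow> 'a" where
  "simplex_path a u = a (\<lambda>i. if i = 0 then 1 - u else if i = 1 then u else 0)"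

lemma standard_simplex_1: "v \<in> standard_simplex 1 \<longleftrightarrow>
    (\<exists>u\<in>{0..1}. v = (\<lambda>i. if i = 0 then 1 - u else if i = 1 then u else 0))"
proof
  assume "v \<in> standard_simplex 1"
  then have "v 0 + v 1 = 1" "\<And>i. i > 1 \<Longrightarrow> v i = 0" "0 \<le> v 1" "v 1 \<le> 1"
    by (auto simp: standard_simplex_def)
  then show "\<exists>u\<in>{0..1}. v = (\<lambda>i. if i = 0 then 1 - u else if i = 1 then u else 0)"
    by (intro bexI[of _ "v 1"]) (auto simp: fun_eq_iff)
qed (auto simp: standard_simplex_def)

lemma path_simplex_simplex_path:
  assumes "singular_simplex 1 X a" shows "path_simplex (simplex_path a) = a"
proof
  fix v show "path_simplex (simplex_path a) v = a v"
  proof (cases "v \<in> standard_simplex 1")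
    case True
    then obtain u where "u \<in> {0..1}" "v = (\<lambda>i. if i = 0 then 1 - u else if i = 1 then u else 0)"
      using standard_simplex_1[of v] by blast
    then show ?thesis using True unfolding path_simplex_def simplex_path_def by simp
  next
    case False
    then show ?thesis using assms by (auto simp: path_simplex_def singular_simplex_def extensional_def)
  qed
qed

lemma simplex_path_path_simplex:
  assumes "u \<in> {0..1}" shows "simplex_path (path_simplex g) u = g u"
  using assms unfolding simplex_path_def path_simplex_def
  by (subst restrict_apply', subst standard_simplex_1) auto

lemma path_simplex_cong:
  assumes "\<And>u. u \<in> {0..1} \<Longrightarrow> g u = h u" shows "path_simplex g = path_simplex h"
  using assms unfolding path_simplex_def
  by (intro restrict_ext) (auto simp: standard_simplex_def)

lemma singular_simplex_path_simplex:
  assumes "pathin X g" shows "singular_simplex 1 X (path_simplex g)"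
  unfolding singular_simplex_def path_simplex_def
proof
  let ?S = "subtopology (powertop_real UNIV) (standard_simplex 1)"
  have "continuous_map ?S (top_of_set {0..1}) (\<lambda>v. v 1)"
    by (auto simp: continuous_map_in_subtopology standard_simplex_def
        intro!: continuous_map_from_subtopology continuous_map_product_projection)
  then have "continuous_map ?S X (g \<circ> (\<lambda>v. v 1))"
    using assms continuous_map_compose unfolding pathin_def by blast
  then show "continuous_map ?S X (restrict (\<lambda>v. g (v 1)) (standard_simplex 1))"
    by (rule continuous_map_eq) auto
qed auto

lemma pathin_simplex_path:
  assumes "singular_simplex 1 X a" shows "pathin X (simplex_path a)"
proof -
  have "continuous_map (top_of_set {0..1}) (subtopology (powertop_real UNIV) (standard_simplex 1))
     (\<lambda>u i. if i = 0 then 1 - u else if i = 1 then u else (0::real))"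
    unfolding continuous_map_in_subtopology continuous_map_componentwise_UNIV
  proof (intro conjI allI)
    fix i :: nat
    show "continuous_map (top_of_set {0..1::real}) euclidean (\<lambda>u. if i = 0 then 1 - u else if i = 1 then u else (0::real))"
      by (cases "i = 0"; cases "i = 1") (auto intro!: continuous_intros)
  qed (auto simp: standard_simplex_def)
  from continuous_map_compose[OF this] assms show ?thesis
    unfolding pathin_def singular_simplex_def simplex_path_def by (auto simp: o_def)
qed

lemma homology_class_path_simplex:
  "homology_class_of_loop X g = homologous_rel_set 1 X {} (frag_of (path_simplex g))"
  by (simp add: homology_class_of_loop_def path_simplex_def)

lemma chain_boundary_1:
  "chain_boundary 1 (frag_of a) = frag_of (singular_face 1 0 a) - frag_of (singular_face 1 1 a)"
  by (simp add: chain_boundary_of)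

lemma chain_boundary_2:
  "chain_boundary 2 (frag_of a) =
     frag_of (singular_face 2 0 a) - frag_of (singular_face 2 1 a) + frag_of (singular_face 2 2 a)"
  by (simp add: chain_boundary_of numeral_2_eq_2)

text \<open>
  The singular 0-simplex at a point. Chains restrict simplices to their domain, so the standard
  simplex has to appear here.
\<close>
definition point_simplex :: "'a \<Rightarrow> (nat \<Rightarrow> real) \<Rightarrow> 'a" where
  "point_simplex x = restrict (\<lambda>_. x) (standard_simplex 0)"

lemma singular_simplex_0:
  assumes "singular_simplex 0 X a" obtains x where "x \<in> topspace X" "a = point_simplex x"
proof (rule that)
  let ?e = "(\<lambda>j. if j = 0 then 1 else 0) :: nat \<Rightarrow> real"
  show "a ?e \<in> topspace X" using assms by (auto simp: singular_simplex_def standard_simplex_0 continuous_map)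
  have "a \<in> extensional {?e}" using assms by (simp add: singular_simplex_def standard_simplex_0)
  then have "a v = point_simplex (a ?e) v" for v
    by (cases "v = ?e") (auto simp: standard_simplex_0 point_simplex_def extensional_def simp del: fun_eq_iff)
  then show "a = point_simplex (a ?e)" ..
qed

lemma singular_face_1:
  "singular_face 1 0 a = point_simplex (simplex_path a 1)"
  "singular_face 1 1 a = point_simplex (simplex_path a 0)"
  unfolding singular_face_def point_simplex_def simplex_path_def
  by (auto intro!: restrict_ext arg_cong[of _ _ a] simp: standard_simplex_0 simplical_face_def fun_eq_iff)

lemma chain_boundary_1_path:
  "chain_boundary 1 (frag_of a) = frag_of (point_simplex (simplex_path a 1)) - frag_of (point_simplex (simplex_path a 0))"
  by (simp only: chain_boundary_1 singular_face_1)

lemma chain_boundary_path_simplex: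
  "chain_boundary 1 (frag_of (path_simplex g)) = frag_of (point_simplex (g 1)) - frag_of (point_simplex (g 0))"
  by (simp only: chain_boundary_1_path simplex_path_path_simplex atLeastAtMost_iff order_refl zero_le_one simp_thms)

text \<open>
  The boundary of the 2-simplex \<open>v \<mapsto> g (a\<^sub>1v\<^sub>1 + a\<^sub>2v\<^sub>2)\<close>. The choices \<open>(0, 0)\<close>, \<open>(1, 0)\<close> and
  \<open>(1/2, 1)\<close> of \<open>(a\<^sub>1, a\<^sub>2)\<close> yield the homology relations for constant, reversed and concatenated paths.
\<close>
lemma affine_triangle_boundary:
  assumes g: "pathin X g" and a: "a1 \<in> {0..1}" "a2 \<in> {0..1}"
  shows "singular_relboundary 1 X {}
    (frag_of (path_simplex (\<lambda>u. g (a1 * (1 - u) + a2 * u))) - frag_of (path_simplex (\<lambda>u. g (a2 * u)))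
      + frag_of (path_simplex (\<lambda>u. g (a1 * u))))"
proof -
  let ?S = "subtopology (powertop_real UNIV) (standard_simplex 2)"
  define b where "b = restrict (\<lambda>v. g (a1 * v 1 + a2 * v 2)) (standard_simplex 2)"
  have in01: "a1 * v 1 + a2 * v 2 \<in> {0..1}" if "v \<in> standard_simplex 2" for v
  proof -
    have v: "0 \<le> v 0" "0 \<le> v 1" "0 \<le> v 2" "v 0 + v 1 + v 2 = 1"
      using that by (auto simp: standard_simplex_def numeral_2_eq_2)
    have "a1 * v 1 \<le> 1 * v 1" "a2 * v 2 \<le> 1 * v 2" by (rule mult_right_mono; use a v in auto)+
    moreover have "0 \<le> a1 * v 1" "0 \<le> a2 * v 2" using a v by auto
    ultimately show ?thesis using v by auto
  qed
  have "continuous_map ?S euclideanreal (\<lambda>v. v i)" for i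
    by (intro continuous_map_from_subtopology continuous_map_product_projection) auto
  then have "continuous_map ?S (top_of_set {0..1}) (\<lambda>v. a1 * v 1 + a2 * v 2)"
    unfolding continuous_map_in_subtopology using in01 by (auto intro!: continuous_intros)
  then have "continuous_map ?S X (g \<circ> (\<lambda>v. a1 * v 1 + a2 * v 2))"
    using g continuous_map_compose unfolding pathin_def by blast
  then have "continuous_map ?S X b" by (rule continuous_map_eq) (auto simp: b_def)
  then have b: "singular_simplex 2 X b" by (auto simp: singular_simplex_def b_def)
  have face: "singular_face 2 k b = path_simplex (\<lambda>u. g (r u))"
    if "\<And>u. a1 * simplical_face k (\<lambda>i. if i = 0 then 1 - u else if i = 1 then u else 0) 1
         + a2 * simplical_face k (\<lambda>i. if i = 0 then 1 - u else if i = 1 then u else 0) 2 = r u" "k \<le> 2" for k r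
    unfolding singular_face_def path_simplex_def
  proof
    fix v :: "nat \<Rightarrow> real"
    show "restrict (b \<circ> simplical_face k) (standard_simplex (2 - Suc 0)) v
      = restrict (\<lambda>v. g (r (v 1))) (standard_simplex 1) v"
    proof (cases "v \<in> standard_simplex (Suc 0)")
    case v: True
    then obtain u where u: "v = (\<lambda>i. if i = 0 then 1 - u else if i = 1 then u else 0)"
      using standard_simplex_1[of v] by auto
    have "simplical_face k v \<in> standard_simplex 2"
      using simplical_face_in_standard_simplex[of 2 k v] v that by simp
    then show ?thesis using that(1)[of u] v unfolding b_def u by simp
    qed simp
  qed
  have "singular_face 2 0 b = path_simplex (\<lambda>u. g (a1 * (1 - u) + a2 * u))"
    by (rule face) (auto simp: simplical_face_def)
  moreover have "singular_face 2 1 b = path_simplex (\<lambda>u. g (a2 * u))"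
    by (rule face) (auto simp: simplical_face_def)
  moreover have "singular_face 2 2 b = path_simplex (\<lambda>u. g (a1 * u))"
    by (rule face) (auto simp: simplical_face_def)
  moreover have "singular_chain 2 X (frag_of b)" using b by (simp add: singular_chain_of)
  ultimately show ?thesis using chain_boundary_2[of b] unfolding singular_boundary
    by (metis Suc_1)
qed

lemma homologous_const:
  assumes "x \<in> topspace X" shows "homologous_rel 1 X {} (frag_of (path_simplex (\<lambda>_. x))) 0"
  using affine_triangle_boundary[of X "\<lambda>_. x" 0 0] assms by (simp add: homologous_rel_def pathin_const)

lemma homologous_concat:
  assumes "pathin X \<alpha>" "pathin X \<beta>" "\<alpha> 1 = \<beta> 0"
  shows "homologous_rel 1 X {} (frag_of (path_simplex (concat_loops \<alpha> \<beta>)))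
           (frag_of (path_simplex \<alpha>) + frag_of (path_simplex \<beta>))"
proof -
  let ?g = "concat_loops \<alpha> \<beta>"
  have "path_simplex (\<lambda>u. ?g (1/2 * (1 - u) + 1 * u)) = path_simplex \<beta>"
    "path_simplex (\<lambda>u. ?g (1/2 * u)) = path_simplex \<alpha>" "path_simplex (\<lambda>u. ?g (1 * u)) = path_simplex ?g"
    using assms(3) by (auto intro!: path_simplex_cong simp: concat_loops_def field_simps)
  then have "singular_relboundary 1 X {} (frag_of (path_simplex \<beta>) - frag_of (path_simplex ?g) + frag_of (path_simplex \<alpha>))"
    using affine_triangle_boundary[OF pathin_concat[OF assms], of "1/2" 1] by simp
  then have "singular_relboundary 1 X {} (- (frag_of (path_simplex \<beta>) - frag_of (path_simplex ?g) + frag_of (path_simplex \<alpha>)))"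
    by (rule singular_relboundary_minus[THEN iffD2, rotated -1])
  then show ?thesis by (simp add: homologous_rel_def algebra_simps)
qed

lemma homologous_reverse:
  assumes "pathin X \<alpha>"
  shows "homologous_rel 1 X {} (frag_of (path_simplex (\<lambda>u. \<alpha> (1 - u)))) (- frag_of (path_simplex \<alpha>))"
proof -
  have "\<alpha> 0 \<in> topspace X" using pathin_topspace[OF assms, of 0] by simp
  then have "singular_relboundary 1 X {} (frag_of (path_simplex (\<lambda>_. \<alpha> 0)))"
    using homologous_const by (simp add: homologous_rel_def)
  moreover have "singular_relboundary 1 X {}
    (frag_of (path_simplex (\<lambda>u. \<alpha> (1 - u))) - frag_of (path_simplex (\<lambda>_. \<alpha> 0)) + frag_of (path_simplex \<alpha>))"
    using affine_triangle_boundary[OF assms, of 1 0] by simp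
  ultimately have "singular_relboundary 1 X {} (frag_of (path_simplex (\<lambda>u. \<alpha> (1 - u))) - frag_of (path_simplex (\<lambda>_. \<alpha> 0)) + frag_of (path_simplex \<alpha>) + frag_of (path_simplex (\<lambda>_. \<alpha> 0)))"
    by (rule singular_relboundary_add[rotated])
  then show ?thesis by (simp add: homologous_rel_def algebra_simps)
qed

text \<open>
  Paths \<open>P y\<close> from the base point to all points \<open>y\<close> close up a simplex \<open>a\<close> to a loop, which runs along
  \<open>P (a 0)\<close>, then \<open>a\<close>, then \<open>P (a 1)\<close> backwards. The added paths depend on the boundary only, so they
  cancel for a cycle; stating the correction term explicitly allows an induction over all chains. Each
  0-simplex is evaluated at the single vertex of its domain.
\<close>
lemma chain_homologous_to_loop:
  assumes X: "path_connected_space X" and x: "x \<in> topspace X"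
    and P: "\<And>y. y \<in> topspace X \<Longrightarrow> pathin X (P y) \<and> P y 0 = x \<and> P y 1 = y"
    and c: "singular_chain 1 X c"
  shows "\<exists>\<gamma>\<in>loops X x. homologous_rel 1 X {} c (frag_of (path_simplex \<gamma>)
      + frag_extend (\<lambda>a. frag_of (path_simplex (P (a (\<lambda>j. if j = 0 then 1 else 0))))) (chain_boundary 1 c))"
proof -
  let ?p = "\<lambda>y. frag_of (path_simplex (P y))"
  let ?E = "frag_extend (\<lambda>a. ?p (a (\<lambda>j. if j = 0 then 1 else 0)))"
  have E: "?E (frag_of (point_simplex y)) = ?p y" for y
    by (simp add: point_simplex_def standard_simplex_0)
  have hom: "homologous_rel 1 X {} (frag_of (path_simplex (concat_loops \<alpha> \<beta>)))
       (frag_of (path_simplex \<alpha>) + frag_of (path_simplex \<beta>))"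
    if "pathin X \<alpha>" "pathin X \<beta>" "\<alpha> 1 = \<beta> 0" for \<alpha> \<beta> using homologous_concat[OF that] .
  from c show ?thesis unfolding singular_chain_def
  proof (induction c rule: frag_induction)
    case zero
    have "(\<lambda>_. x) \<in> loops X x" using x by (simp add: loops_def pathin_const)
    moreover have "homologous_rel 1 X {} 0 (frag_of (path_simplex (\<lambda>_. x)) + ?E (chain_boundary 1 0))"
      using homologous_const[OF x] by (simp add: homologous_rel_sym[of _ _ _ 0])
    ultimately show ?case by blast
  next
    case (one a)
    then have a: "singular_simplex 1 X a" by simp
    define g where "g = simplex_path a"
    have g: "pathin X g" using pathin_simplex_path[OF a] by (simp add: g_def)
    have a_eq: "a = path_simplex g" using path_simplex_simplex_path[OF a] by (simp add: g_def)
    have ends: "g 0 \<in> topspace X" "g 1 \<in> topspace X" using pathin_topspace[OF g] by auto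
    let ?r = "\<lambda>u. P (g 1) (1 - u)"
    have r: "pathin X ?r" "?r 0 = g 1" "?r 1 = x" using P[OF ends(2)] pathin_reverse[of X "P (g 1)"] by auto
    have q: "pathin X (concat_loops (P (g 0)) g)" "concat_loops (P (g 0)) g 1 = g 1" "concat_loops (P (g 0)) g 0 = x"
      using pathin_concat[OF _ g] P[OF ends(1)] by (auto simp: concat_loops_def)
    let ?\<gamma> = "concat_loops (concat_loops (P (g 0)) g) ?r"
    have loop: "?\<gamma> \<in> loops X x" using pathin_concat[OF q(1) r(1)] q r by (auto simp: loops_def concat_loops_def)
    have "homologous_rel 1 X {} (frag_of (path_simplex ?\<gamma>))
        (frag_of (path_simplex (concat_loops (P (g 0)) g)) + frag_of (path_simplex ?r))"
      using hom[OF q(1) r(1)] q r by simp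
    moreover have "homologous_rel 1 X {} (frag_of (path_simplex (concat_loops (P (g 0)) g)) + frag_of (path_simplex ?r))
       ((?p (g 0) + frag_of a) + (- ?p (g 1)))"
      using hom[of "P (g 0)" g] homologous_reverse[of X "P (g 1)"] P ends g a_eq
      by (intro homologous_rel_add) auto
    ultimately have "homologous_rel 1 X {} (frag_of (path_simplex ?\<gamma>)) ((?p (g 0) + frag_of a) + (- ?p (g 1)))"
      using homologous_rel_trans by blast
    then have "homologous_rel 1 X {} (frag_of (path_simplex ?\<gamma>) + (?p (g 1) - ?p (g 0)))
      (((?p (g 0) + frag_of a) + (- ?p (g 1))) + (?p (g 1) - ?p (g 0)))"
      by (intro homologous_rel_add) auto
    then have "homologous_rel 1 X {} (frag_of a) (frag_of (path_simplex ?\<gamma>) + (?p (g 1) - ?p (g 0)))"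
      by (simp add: homologous_rel_sym)
    moreover have "?E (chain_boundary 1 (frag_of a)) = ?p (g 1) - ?p (g 0)"
      unfolding chain_boundary_1_path frag_extend_diff E g_def ..
    ultimately show ?case using loop by auto
  next
    case (diff a b)
    then obtain \<alpha> \<beta> where \<alpha>: "\<alpha> \<in> loops X x" "homologous_rel 1 X {} a (frag_of (path_simplex \<alpha>) + ?E (chain_boundary 1 a))"
      and \<beta>: "\<beta> \<in> loops X x" "homologous_rel 1 X {} b (frag_of (path_simplex \<beta>) + ?E (chain_boundary 1 b))" by blast
    let ?r = "\<lambda>u. \<beta> (1 - u)"
    have ab: "pathin X \<alpha>" "\<alpha> 0 = x" "\<alpha> 1 = x" "pathin X \<beta>" "\<beta> 0 = x" "\<beta> 1 = x" using \<alpha> \<beta> by (auto simp: loops_def)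
    have r: "pathin X ?r" "?r 0 = x" "?r 1 = x" using pathin_reverse[OF ab(4)] ab by auto
    have loop: "concat_loops \<alpha> ?r \<in> loops X x"
      using pathin_concat[OF ab(1) r(1)] ab r by (auto simp: loops_def concat_loops_def)
    have "homologous_rel 1 X {} (frag_of (path_simplex (concat_loops \<alpha> ?r)))
        (frag_of (path_simplex \<alpha>) + frag_of (path_simplex ?r))"
      using hom[OF ab(1) r(1)] ab r by simp
    moreover have "homologous_rel 1 X {} (frag_of (path_simplex \<alpha>) + frag_of (path_simplex ?r))
        (frag_of (path_simplex \<alpha>) + (- frag_of (path_simplex \<beta>)))"
      using homologous_reverse[OF ab(4)] by (intro homologous_rel_add) auto
    ultimately have *: "homologous_rel 1 X {} (frag_of (path_simplex (concat_loops \<alpha> ?r)))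
        (frag_of (path_simplex \<alpha>) + (- frag_of (path_simplex \<beta>)))"
      using homologous_rel_trans by blast
    have "homologous_rel 1 X {} (a - b) ((frag_of (path_simplex \<alpha>) + ?E (chain_boundary 1 a)) - (frag_of (path_simplex \<beta>) + ?E (chain_boundary 1 b)))"
      using \<alpha> \<beta> by (intro homologous_rel_diff)
    also have "(frag_of (path_simplex \<alpha>) + ?E (chain_boundary 1 a)) - (frag_of (path_simplex \<beta>) + ?E (chain_boundary 1 b))
      = (frag_of (path_simplex \<alpha>) + (- frag_of (path_simplex \<beta>))) + ?E (chain_boundary 1 (a - b))"
      unfolding chain_boundary_diff frag_extend_diff by simp
    finally have "homologous_rel 1 X {} (a - b) ((frag_of (path_simplex \<alpha>) + (- frag_of (path_simplex \<beta>))) + ?E (chain_boundary 1 (a - b)))" .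
    moreover have "homologous_rel 1 X {} ((frag_of (path_simplex \<alpha>) + (- frag_of (path_simplex \<beta>))) + ?E (chain_boundary 1 (a - b)))
       (frag_of (path_simplex (concat_loops \<alpha> ?r)) + ?E (chain_boundary 1 (a - b)))"
      using * by (intro homologous_rel_add) (auto simp: homologous_rel_sym)
    ultimately show ?case using loop homologous_rel_trans by blast
  qed
qed

lemma carrier_H1: "carrier (H1 X) = homologous_rel_set 1 X {} ` singular_relcycle_set 1 X {}"
  using carrier_relative_homology_group[of 1 X "{}"] by simp

text \<open>
  The multiplication of the quotient group is the elementwise sum of cosets; the coset of \<open>a + b\<close> is
  reached by adding \<open>a\<close> itself to a suitable representative of the coset of \<open>b\<close>.
\<close>
lemma mult_H1:
  "homologous_rel_set 1 X {} a \<otimes>\<^bsub>H1 X\<^esub> homologous_rel_set 1 X {} b = homologous_rel_set 1 X {} (a + b)"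
proof -
  have "\<exists>r s. homologous_rel 1 X {} a r \<and> homologous_rel 1 X {} b s \<and> c = r + s"
    if "homologous_rel 1 X {} (a + b) c" for c
    using that by (intro exI[of _ a] exI[of _ "c - a"]) (simp add: homologous_rel_def algebra_simps)
  then show ?thesis
    using mult_relative_homology_group[of 1 X "{}"] by (auto intro: homologous_rel_add)
qed

lemma singular_cycle_loop:
  assumes "\<gamma> \<in> loops X x" shows "singular_relcycle 1 X {} (frag_of (path_simplex \<gamma>))"
proof -
  have "pathin X \<gamma>" "\<gamma> 0 = \<gamma> 1" using assms by (auto simp: loops_def)
  then show ?thesis unfolding singular_cycle singular_chain_of
    using singular_simplex_path_simplex[of X \<gamma>] chain_boundary_path_simplex[of \<gamma>] by auto
qed

lemma homology_class_of_loop_in_H1: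
  assumes "\<gamma> \<in> loops X x" shows "homology_class_of_loop X \<gamma> \<in> carrier (H1 X)"
  using singular_cycle_loop[OF assms] unfolding carrier_H1 homology_class_path_simplex by blast

text \<open>
  The surjectivity part of the Hurewicz theorem in degree one.
\<close>
lemma H1_class_of_loop:
  assumes X: "path_connected_space X" and x: "x \<in> topspace X" and v: "v \<in> carrier (H1 X)"
  obtains \<gamma> where "\<gamma> \<in> loops X x" "homology_class_of_loop X \<gamma> = v"
proof -
  obtain c where c: "singular_chain 1 X c" "chain_boundary 1 c = 0" "v = homologous_rel_set 1 X {} c"
    using v unfolding carrier_H1 singular_cycle by blast
  have "\<exists>P. \<forall>y\<in>topspace X. pathin X (P y) \<and> P y 0 = x \<and> P y 1 = y"
    using X x unfolding path_connected_space_def by (intro bchoice) auto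
  then obtain P where "\<And>y. y \<in> topspace X \<Longrightarrow> pathin X (P y) \<and> P y 0 = x \<and> P y 1 = y" by blast
  from chain_homologous_to_loop[OF X x this c(1)] obtain \<gamma> where
    "\<gamma> \<in> loops X x" "homologous_rel 1 X {} c (frag_of (path_simplex \<gamma>))" unfolding c(2) frag_extend_0 by auto
  then show ?thesis using that c(3) unfolding homology_class_path_simplex by (metis homologous_rel_set_eq)
qed

section \<open>The fundamental group and inductive coverings\<close>

lemma loop_homotopic_iff:
  "loop_homotopic X x \<alpha> \<beta> \<longleftrightarrow>
    (\<exists>H. continuous_map (top_of_set ({0..1::real} \<times> {0..1::real})) X H \<and>
      (\<forall>u\<in>{0..1}. H (0, u) = \<alpha> u) \<and> (\<forall>u\<in>{0..1}. H (1, u) = \<beta> u) \<and>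
      (\<forall>t\<in>{0..1}. H (t, 0) = x \<and> H (t, 1) = x))"
  unfolding loop_homotopic_def
  by (subst homotopic_with) auto

lemma loop_homotopic_refl: "\<alpha> \<in> loops X x \<Longrightarrow> loop_homotopic X x \<alpha> \<alpha>"
  by (simp add: loop_homotopic_def loops_def pathin_def)

lemma loop_homotopic_sym: "loop_homotopic X x \<alpha> \<beta> \<Longrightarrow> loop_homotopic X x \<beta> \<alpha>"
  by (simp add: loop_homotopic_def homotopic_with_sym)

lemma loop_homotopic_trans: "loop_homotopic X x \<alpha> \<beta> \<Longrightarrow> loop_homotopic X x \<beta> \<gamma> \<Longrightarrow> loop_homotopic X x \<alpha> \<gamma>"
  unfolding loop_homotopic_def by (rule homotopic_with_trans)

lemma mem_loop_class [simp]: "\<beta> \<in> loop_class X x \<alpha> \<longleftrightarrow> loop_homotopic X x \<alpha> \<beta>"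
  by (simp add: loop_class_def)

lemma loop_class_eq:
  assumes "loop_homotopic X x \<alpha> \<beta>" shows "loop_class X x \<alpha> = loop_class X x \<beta>"
proof (intro equalityI subsetI)
  fix \<gamma>
  show "\<gamma> \<in> loop_class X x \<alpha> \<Longrightarrow> \<gamma> \<in> loop_class X x \<beta>"
    using loop_homotopic_trans[OF loop_homotopic_sym[OF assms]] by simp
  show "\<gamma> \<in> loop_class X x \<beta> \<Longrightarrow> \<gamma> \<in> loop_class X x \<alpha>"
    using loop_homotopic_trans[OF assms] by simp
qed

text \<open>
  Homotopies by moving the parameter linearly. The laws of the fundamental group are all instances of
  this: the two sides of each law are reparametrisations of a single path.
\<close>
lemma loop_homotopic_reparam:
  assumes g: "pathin X g" "g (r 0) = x" "g (r 1) = x"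
    and r: "continuous_on {0..1} r" "r ` {0..1} \<subseteq> {0..1::real}"
    and q: "continuous_on {0..1} q" "q ` {0..1} \<subseteq> {0..1}" "q 0 = r 0" "q 1 = r 1"
    and \<alpha>: "\<And>u. u \<in> {0..1} \<Longrightarrow> \<alpha> u = g (r u)" and \<beta>: "\<And>u. u \<in> {0..1} \<Longrightarrow> \<beta> u = g (q u)"
  shows "loop_homotopic X x \<alpha> \<beta>"
  unfolding loop_homotopic_iff
proof (intro exI[of _ "g \<circ> (\<lambda>(t,u). (1 - t) * r u + t * q u)"] conjI ballI)
  let ?K = "{0..1::real} \<times> {0..1::real}"
  have "continuous_on ?K (\<lambda>z. (1 - fst z) * r (snd z) + fst z * q (snd z))"
    using r(1) q(1) by (intro continuous_intros continuous_on_compose2[of "{0..1}" _ ?K snd]) auto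
  moreover have "(1 - t) * r u + t * q u \<in> {0..1}" if "t \<in> {0..1}" "u \<in> {0..1}" for t u
  proof -
    have "r u \<in> {0..1}" "q u \<in> {0..1}" using r(2) q(2) that by blast+
    then show ?thesis using convexD[of "{0..1::real}" "r u" "q u" "1 - t" t] that by auto
  qed
  ultimately have "continuous_map (top_of_set ?K) (top_of_set {0..1}) (\<lambda>(t,u). (1 - t) * r u + t * q u)"
    by (auto simp: continuous_map_in_subtopology case_prod_unfold)
  then show "continuous_map (top_of_set ?K) X (g \<circ> (\<lambda>(t,u). (1 - t) * r u + t * q u))"
    using g(1) unfolding pathin_def by (rule continuous_map_compose)
next
  fix t :: real
  have "(1 - t) * r 0 + t * r 0 = r 0" "(1 - t) * r 1 + t * r 1 = r 1" by (simp_all add: algebra_simps)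
  then show "(g \<circ> (\<lambda>(t,u). (1 - t) * r u + t * q u)) (t, 0) = x"
    and "(g \<circ> (\<lambda>(t,u). (1 - t) * r u + t * q u)) (t, 1) = x"
    using g(2,3) q(3,4) by simp_all
qed (simp_all add: \<alpha> \<beta>)

lemma concat_loops_in_loops: "\<alpha> \<in> loops X x \<Longrightarrow> \<beta> \<in> loops X x \<Longrightarrow> concat_loops \<alpha> \<beta> \<in> loops X x"
  using pathin_concat[of X \<alpha> \<beta>] by (auto simp: loops_def concat_loops_def)

lemma const_loop: "x \<in> topspace X \<Longrightarrow> (\<lambda>_. x) \<in> loops X x"
  by (simp add: loops_def pathin_const)

lemma reverse_in_loops: "\<alpha> \<in> loops X x \<Longrightarrow> (\<lambda>u. \<alpha> (1 - u)) \<in> loops X x"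
  using pathin_reverse[of X \<alpha>] by (auto simp: loops_def)

lemma loop_homotopic_concat:
  assumes "loop_homotopic X x \<alpha> \<alpha>'" "loop_homotopic X x \<beta> \<beta>'"
  shows "loop_homotopic X x (concat_loops \<alpha> \<beta>) (concat_loops \<alpha>' \<beta>')"
proof -
  let ?K = "{0..1::real} \<times> {0..1::real}"
  obtain H where H: "continuous_map (top_of_set ?K) X H"
      "\<forall>u\<in>{0..1}. H (0, u) = \<alpha> u" "\<forall>u\<in>{0..1}. H (1, u) = \<alpha>' u" "\<forall>t\<in>{0..1}. H (t, 0) = x \<and> H (t, 1) = x"
    using assms(1) unfolding loop_homotopic_iff by blast
  obtain L where L: "continuous_map (top_of_set ?K) X L"
      "\<forall>u\<in>{0..1}. L (0, u) = \<beta> u" "\<forall>u\<in>{0..1}. L (1, u) = \<beta>' u" "\<forall>t\<in>{0..1}. L (t, 0) = x \<and> L (t, 1) = x"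
    using assms(2) unfolding loop_homotopic_iff by blast
  let ?M = "\<lambda>z. if snd z \<le> 1/2 then H (fst z, 2 * snd z) else L (fst z, 2 * snd z - 1)"
  have *: "continuous_map (top_of_set A) X (\<lambda>z. J (r z))"
    if "continuous_map (top_of_set ?K) X J" "continuous_on A r" "r ` A \<subseteq> ?K" for A r and J :: "real \<times> real \<Rightarrow> 'a"
    using continuous_map_compose[of "top_of_set A" "top_of_set ?K" r X J] that
    by (auto simp: continuous_map_in_subtopology o_def)
  have "continuous_map (top_of_set ?K) X ?M"
  proof (rule continuous_map_cases_le)
    show "continuous_map (subtopology (top_of_set ?K) {z \<in> topspace (top_of_set ?K). snd z \<le> 1 / 2}) X (\<lambda>z. H (fst z, 2 * snd z))"
      unfolding subtopology_subtopology by (rule *[OF H(1)]) (auto intro!: continuous_intros)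
    show "continuous_map (subtopology (top_of_set ?K) {z \<in> topspace (top_of_set ?K). 1 / 2 \<le> snd z}) X (\<lambda>z. L (fst z, 2 * snd z - 1))"
      unfolding subtopology_subtopology by (rule *[OF L(1)]) (auto intro!: continuous_intros)
  next
    fix z assume z: "z \<in> topspace (top_of_set ?K)" "snd z = 1/2"
    then have "2 * snd z = 1" "2 * snd z - 1 = 0" "fst z \<in> {0..1}" by auto
    then show "H (fst z, 2 * snd z) = L (fst z, 2 * snd z - 1)" using H(4) L(4) by metis
  qed (auto intro!: continuous_intros)
  then show ?thesis unfolding loop_homotopic_iff
    using H(2-4) L(2-4) by (intro exI[of _ ?M]) (auto simp: concat_loops_def)
qed

lemma loop_homotopic_reverse:
  assumes "\<alpha> \<in> loops X x"
  shows "loop_homotopic X x (concat_loops (\<lambda>u. \<alpha> (1 - u)) \<alpha>) (\<lambda>_. x)"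
proof (rule loop_homotopic_reparam[of X \<alpha> "\<lambda>u. \<bar>1 - 2 * u\<bar>" x "\<lambda>_. 1"])
  show "concat_loops (\<lambda>u. \<alpha> (1 - u)) \<alpha> u = \<alpha> \<bar>1 - 2 * u\<bar>" for u :: real
    by (simp add: concat_loops_def abs_if)
  show "continuous_on {0..1} (\<lambda>u::real. \<bar>1 - 2 * u\<bar>)" "continuous_on {0..1} (\<lambda>u::real. 1::real)"
    by (intro continuous_intros)+
  show "(\<lambda>u::real. \<bar>1 - 2 * u\<bar>) ` {0..1} \<subseteq> {0..1}" by auto
qed (use assms in \<open>simp_all add: loops_def image_subset_iff\<close>)

lemma loop_homotopic_unit:
  assumes "\<alpha> \<in> loops X x"
  shows "loop_homotopic X x (concat_loops (\<lambda>_. x) \<alpha>) \<alpha>"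
proof (rule loop_homotopic_reparam[of X \<alpha> "\<lambda>u. max 0 (2 * u - 1)" x "\<lambda>u. u"])
  show "concat_loops (\<lambda>_. x) \<alpha> u = \<alpha> (max 0 (2 * u - 1))" for u :: real
  proof (cases "u \<le> 1/2")
    case True
    then have "max 0 (2 * u - 1) = 0" by simp
    then show ?thesis using assms True by (simp add: concat_loops_def loops_def)
  qed (simp add: concat_loops_def)
  show "continuous_on {0..1} (\<lambda>u::real. max 0 (2 * u - 1))" "continuous_on {0..1} (\<lambda>u::real. u)"
    by (intro continuous_intros)+
qed (use assms in \<open>simp_all add: loops_def image_subset_iff\<close>)

lemma loop_homotopic_assoc:
  assumes "\<alpha> \<in> loops X x" "\<beta> \<in> loops X x" "\<gamma> \<in> loops X x"
  shows "loop_homotopic X x (concat_loops (concat_loops \<alpha> \<beta>) \<gamma>) (concat_loops \<alpha> (concat_loops \<beta> \<gamma>))"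
proof (rule loop_homotopic_reparam[of X "concat_loops (concat_loops \<alpha> \<beta>) \<gamma>" "\<lambda>u. u" x "\<lambda>u. max (max (u/2) (u - 1/4)) (2 * u - 1)"])
  have loop: "concat_loops (concat_loops \<alpha> \<beta>) \<gamma> \<in> loops X x" by (intro concat_loops_in_loops assms)
  then show "pathin X (concat_loops (concat_loops \<alpha> \<beta>) \<gamma>)" "concat_loops (concat_loops \<alpha> \<beta>) \<gamma> 0 = x" "concat_loops (concat_loops \<alpha> \<beta>) \<gamma> 1 = x"
    by (auto simp: loops_def)
  fix u :: real assume u: "u \<in> {0..1}"
  \<comment> \<open>The piecewise linear reparametrisation has slopes 1/2, 1, 2, so it is a maximum of affine maps.\<close>
  let ?q = "max (max (u/2) (u - 1/4)) (2 * u - 1)"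
  consider "u \<le> 1/2" | "1/2 < u" "u \<le> 3/4" | "3/4 < u" by linarith
  then show "concat_loops \<alpha> (concat_loops \<beta> \<gamma>) u = concat_loops (concat_loops \<alpha> \<beta>) \<gamma> ?q"
  proof cases
    case 1
    then have "?q = u / 2" using u by auto
    then show ?thesis using 1 by (simp add: concat_loops_def)
  next
    case 2
    then have "?q = u - 1/4" using u by auto
    then show ?thesis using 2 by (simp add: concat_loops_def)
  next
    case 3
    then have "?q = 2 * u - 1" using u by auto
    then show ?thesis using 3 by (simp add: concat_loops_def)
  qed
next
  show "continuous_on {0..1} (\<lambda>u::real. max (max (u/2) (u - 1/4)) (2 * u - 1))" "continuous_on {0..1} (\<lambda>u::real. u)"
    by (auto intro!: continuous_intros)
qed (auto simp: image_subset_iff max_def)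

lemma fundamental_group_simps:
  "carrier (fundamental_group X x) = loop_class X x ` loops X x"
  "\<one>\<^bsub>fundamental_group X x\<^esub> = loop_class X x (\<lambda>_. x)"
  by (simp_all add: fundamental_group_def)

lemma mult_loop_class:
  assumes "\<alpha> \<in> loops X x" "\<beta> \<in> loops X x"
  shows "loop_class X x \<alpha> \<otimes>\<^bsub>fundamental_group X x\<^esub> loop_class X x \<beta> = loop_class X x (concat_loops \<alpha> \<beta>)"
proof -
  have *: "loop_class X x (concat_loops \<alpha>' \<beta>') = loop_class X x (concat_loops \<alpha> \<beta>)"
    if "\<alpha>' \<in> loop_class X x \<alpha>" "\<beta>' \<in> loop_class X x \<beta>" for \<alpha>' \<beta>'
    using loop_class_eq[OF loop_homotopic_concat[of X x \<alpha> \<alpha>' \<beta> \<beta>'], symmetric] that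
    unfolding mem_loop_class by blast
  have "\<alpha> \<in> loop_class X x \<alpha>" "\<beta> \<in> loop_class X x \<beta>"
    using loop_homotopic_refl[OF assms(1)] loop_homotopic_refl[OF assms(2)] by simp_all
  then have "(\<Union>\<alpha>'\<in>loop_class X x \<alpha>. \<Union>\<beta>'\<in>loop_class X x \<beta>. loop_class X x (concat_loops \<alpha>' \<beta>'))
      = (\<Union>\<alpha>'\<in>loop_class X x \<alpha>. \<Union>\<beta>'\<in>loop_class X x \<beta>. loop_class X x (concat_loops \<alpha> \<beta>))"
    using * by (intro SUP_cong refl)
  also have "\<dots> = loop_class X x (concat_loops \<alpha> \<beta>)"
    using \<open>\<alpha> \<in> loop_class X x \<alpha>\<close> \<open>\<beta> \<in> loop_class X x \<beta>\<close> by blast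
  finally show ?thesis by (simp only: fundamental_group_def monoid.simps)
qed

lemma group_fundamental_group:
  assumes "x \<in> topspace X" shows "group (fundamental_group X x)"
proof (rule groupI)
  show "\<one>\<^bsub>fundamental_group X x\<^esub> \<in> carrier (fundamental_group X x)"
    unfolding fundamental_group_simps by (rule imageI[OF const_loop[OF assms]])
next
  fix a b assume "a \<in> carrier (fundamental_group X x)" "b \<in> carrier (fundamental_group X x)"
  then show "a \<otimes>\<^bsub>fundamental_group X x\<^esub> b \<in> carrier (fundamental_group X x)"
    unfolding fundamental_group_simps by (auto simp: mult_loop_class concat_loops_in_loops)
next
  fix a b c assume "a \<in> carrier (fundamental_group X x)" "b \<in> carrier (fundamental_group X x)" "c \<in> carrier (fundamental_group X x)"
  then obtain \<alpha> \<beta> \<gamma> where *: "\<alpha> \<in> loops X x" "\<beta> \<in> loops X x" "\<gamma> \<in> loops X x"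
    "a = loop_class X x \<alpha>" "b = loop_class X x \<beta>" "c = loop_class X x \<gamma>"
    unfolding fundamental_group_simps by blast
  then show "a \<otimes>\<^bsub>fundamental_group X x\<^esub> b \<otimes>\<^bsub>fundamental_group X x\<^esub> c = a \<otimes>\<^bsub>fundamental_group X x\<^esub> (b \<otimes>\<^bsub>fundamental_group X x\<^esub> c)"
    using loop_class_eq[OF loop_homotopic_assoc[OF *(1-3)]] by (simp add: mult_loop_class concat_loops_in_loops)
next
  fix a assume "a \<in> carrier (fundamental_group X x)"
  then obtain \<alpha> where *: "\<alpha> \<in> loops X x" "a = loop_class X x \<alpha>"
    unfolding fundamental_group_simps by blast
  show "\<one>\<^bsub>fundamental_group X x\<^esub> \<otimes>\<^bsub>fundamental_group X x\<^esub> a = a"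
    using loop_class_eq[OF loop_homotopic_unit[OF *(1)]] * const_loop[OF assms]
    by (simp add: mult_loop_class fundamental_group_simps)
  have "loop_class X x (\<lambda>u. \<alpha> (1 - u)) \<otimes>\<^bsub>fundamental_group X x\<^esub> a = \<one>\<^bsub>fundamental_group X x\<^esub>"
    unfolding *(2) mult_loop_class[OF reverse_in_loops[OF *(1)] *(1)] fundamental_group_simps
    by (rule loop_class_eq[OF loop_homotopic_reverse[OF *(1)]])
  moreover have "loop_class X x (\<lambda>u. \<alpha> (1 - u)) \<in> carrier (fundamental_group X x)"
    unfolding fundamental_group_simps by (rule imageI[OF reverse_in_loops[OF *(1)]])
  ultimately show "\<exists>b\<in>carrier (fundamental_group X x). b \<otimes>\<^bsub>fundamental_group X x\<^esub> a = \<one>\<^bsub>fundamental_group X x\<^esub>" ..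
qed

lemma inv_loop_class:
  assumes "\<alpha> \<in> loops X x"
  shows "inv\<^bsub>fundamental_group X x\<^esub> (loop_class X x \<alpha>) = loop_class X x (\<lambda>u. \<alpha> (1 - u))"
proof -
  have "pathin X \<alpha>" "\<alpha> 0 = x" using assms by (simp_all add: loops_def)
  then have x: "x \<in> topspace X" using pathin_topspace[of X \<alpha> 0] by simp
  interpret group "fundamental_group X x" by (rule group_fundamental_group[OF x])
  show ?thesis
  proof (rule inv_equality)
    show "loop_class X x (\<lambda>u. \<alpha> (1 - u)) \<otimes>\<^bsub>fundamental_group X x\<^esub> loop_class X x \<alpha> = \<one>\<^bsub>fundamental_group X x\<^esub>"
      unfolding mult_loop_class[OF reverse_in_loops[OF assms] assms] fundamental_group_simps
      by (rule loop_class_eq[OF loop_homotopic_reverse[OF assms]])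
    show "loop_class X x \<alpha> \<in> carrier (fundamental_group X x)"
      unfolding fundamental_group_simps by (rule imageI[OF assms])
    show "loop_class X x (\<lambda>u. \<alpha> (1 - u)) \<in> carrier (fundamental_group X x)"
      unfolding fundamental_group_simps by (rule imageI[OF reverse_in_loops[OF assms]])
  qed
qed

text \<open>
  The commutator of \<open>\<alpha>\<close> and \<open>\<beta>\<close> represents an element of the commutator subgroup of the fundamental
  group of \<open>X\<close>. An inductive covering is onto these subgroups, so the commutator is homotopic to the
  projection of a loop at \<open>e\<close>, and transport along it fixes \<open>e\<close>.
\<close>
lemma inductive_transport_commute:
  assumes ind: "inductive_covering X' X p" and e: "e \<in> topspace X'"
    and \<alpha>: "\<alpha> \<in> loops X (p e)" and \<beta>: "\<beta> \<in> loops X (p e)"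
    and t: "transport X' p \<alpha> e a" "transport X' p \<beta> a ab" "transport X' p \<beta> e b" "transport X' p \<alpha> b ba"
  shows "ab = ba"
proof -
  have cov: "covering_map X' X p" using ind unfolding inductive_covering_def by (elim conjE)
  let ?x = "p e" and ?r = "\<lambda>\<gamma> u. \<gamma> (1 - u)"
  let ?G = "fundamental_group X ?x" and ?G' = "fundamental_group X' e"
  let ?cl = "loop_class X ?x"
  have x: "?x \<in> topspace X" using cov e unfolding covering_map_def by (auto simp: continuous_map)
  interpret G: group ?G by (rule group_fundamental_group[OF x])
  interpret G': group ?G' by (rule group_fundamental_group[OF e])
  let ?\<kappa> = "concat_loops (concat_loops (concat_loops \<alpha> \<beta>) (?r \<alpha>)) (?r \<beta>)"
  have l: "concat_loops \<alpha> \<beta> \<in> loops X ?x" "?r \<alpha> \<in> loops X ?x" "?r \<beta> \<in> loops X ?x"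
    "concat_loops (concat_loops \<alpha> \<beta>) (?r \<alpha>) \<in> loops X ?x" "?\<kappa> \<in> loops X ?x"
    using concat_loops_in_loops[OF \<alpha> \<beta>] reverse_in_loops[OF \<alpha>] reverse_in_loops[OF \<beta>]
    by (simp_all add: concat_loops_in_loops)
  have "?cl ?\<kappa> = ?cl \<alpha> \<otimes>\<^bsub>?G\<^esub> ?cl \<beta> \<otimes>\<^bsub>?G\<^esub> inv\<^bsub>?G\<^esub> (?cl \<alpha>) \<otimes>\<^bsub>?G\<^esub> inv\<^bsub>?G\<^esub> (?cl \<beta>)"
    by (simp add: mult_loop_class inv_loop_class l \<alpha> \<beta>)
  moreover have "?cl \<alpha> \<in> carrier ?G" "?cl \<beta> \<in> carrier ?G" unfolding fundamental_group_simps by (rule imageI[OF \<alpha>], rule imageI[OF \<beta>])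
  ultimately have "?cl ?\<kappa> \<in> derived ?G (carrier ?G)"
    unfolding derived_def by (intro generate.incl) blast
  moreover have "bij_betw (fundamental_group_map X p e) (derived ?G' (carrier ?G')) (derived ?G (carrier ?G))"
  proof -
    have "fundamental_group_map X p e \<in> iso (commutator_subgroup ?G') (commutator_subgroup ?G)"
      using ind e unfolding inductive_covering_def by (elim conjE) (rule bspec)
    then show ?thesis by (simp add: iso_def commutator_subgroup_def)
  qed
  ultimately have "?cl ?\<kappa> \<in> fundamental_group_map X p e ` derived ?G' (carrier ?G')"
    by (simp only: bij_betw_imp_surj_on)
  then obtain A where A: "fundamental_group_map X p e A = ?cl ?\<kappa>" "A \<in> derived ?G' (carrier ?G')"
    by (elim imageE) (rule that[OF sym])
  then have "A \<in> carrier ?G'" using G'.derived_in_carrier[OF subset_refl] by (elim subsetD[rotated])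
  then obtain l' where l': "l' \<in> loops X' e" "A = loop_class X' e l'" by (auto simp: fundamental_group_simps)
  have "p \<circ> l' \<in> loops X ?x"
    using l'(1) pathin_compose[of X' l' X p] cov by (auto simp: loops_def covering_map_def)
  then have "p \<circ> l' \<in> fundamental_group_map X p e A"
    unfolding fundamental_group_map_def l'(2)
    by (intro UN_I[of l']) (simp_all add: loop_homotopic_refl l'(1))
  then have "loop_homotopic X ?x (p \<circ> l') ?\<kappa>" unfolding A using loop_homotopic_sym by simp
  moreover have "transport X' p (p \<circ> l') e e" using transport_of_path[of X' l' p] l'(1) by (auto simp: loops_def)
  ultimately have \<kappa>: "transport X' p ?\<kappa> e e" by (rule transport_loop_homotopic[OF cov])
  have ends: "ab \<in> topspace X'" "p ab = ?r \<alpha> 0"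
    using transport_ends[OF t(2)] \<alpha> \<beta> by (auto simp: loops_def)
  have r\<alpha>: "pathin X (?r \<alpha>)" using l by (simp add: loops_def)
  obtain c where c: "transport X' p (?r \<alpha>) ab c" by (rule transport_exists[OF cov r\<alpha> ends])
  then have ends2: "c \<in> topspace X'" "p c = ?r \<beta> 0" using transport_ends[OF c] \<alpha> \<beta> by (auto simp: loops_def)
  have r\<beta>: "pathin X (?r \<beta>)" using l by (simp add: loops_def)
  obtain d where d: "transport X' p (?r \<beta>) c d" by (rule transport_exists[OF cov r\<beta> ends2])
  have "transport X' p ?\<kappa> e d" using transport_concat[OF transport_concat[OF transport_concat[OF t(1,2)] c] d] .
  then have "d = e" using transport_unique[OF cov _ \<kappa>] by blast
  then have "transport X' p \<beta> e c" using transport_reverse[OF d] by simp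
  then have "c = b" using transport_unique[OF cov _ t(3)] by blast
  then have "transport X' p \<alpha> b ab" using transport_reverse[OF c] by simp
  then show ?thesis using transport_unique[OF cov _ t(4)] by blast
qed

section \<open>The deck group of an inductive Galois covering\<close>

text \<open>
  The standard 2-simplex as the image of a compact convex set in the plane, to which
  \<open>transport_triangle\<close> applies.
\<close>
definition simplex2 :: "real \<times> real \<Rightarrow> nat \<Rightarrow> real" where
  "simplex2 z = (\<lambda>i. if i = 0 then 1 - fst z - snd z else if i = 1 then fst z else if i = 2 then snd z else 0)"

definition triangle :: "(real \<times> real) set" where
  "triangle = ({0..1} \<times> {0..1}) \<inter> {z. fst z + snd z \<le> 1}"

lemma compact_triangle: "compact triangle" and convex_triangle: "convex triangle"
proof -
  have "closed {z::real\<times>real. fst z + snd z \<le> 1}" by (intro closed_Collect_le continuous_intros)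
  then show "compact triangle" unfolding triangle_def by (intro compact_Int_closed compact_Times compact_Icc)
  have "{z::real\<times>real. fst z + snd z \<le> 1} = {z. (1,1) \<bullet> z \<le> 1}" by (auto simp: inner_prod_def)
  then have "convex {z::real\<times>real. fst z + snd z \<le> 1}" using convex_halfspace_le by metis
  then show "convex triangle" unfolding triangle_def by (intro convex_Int convex_Times) auto
qed

lemma continuous_map_simplex2:
  assumes "singular_simplex 2 X b"
  shows "continuous_map (top_of_set triangle) X (b \<circ> simplex2)"
proof (rule continuous_map_compose)
  show "continuous_map (top_of_set triangle) (subtopology (powertop_real UNIV) (standard_simplex 2)) simplex2"
    unfolding continuous_map_in_subtopology continuous_map_componentwise_UNIV
  proof (intro conjI allI)
    fix i :: nat
    show "continuous_map (top_of_set triangle) euclidean (\<lambda>z. simplex2 z i)"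
      by (cases "i = 0"; cases "i = 1"; cases "i = 2") (auto simp: simplex2_def intro!: continuous_intros)
    show "simplex2 \<in> topspace (top_of_set triangle) \<rightarrow> standard_simplex 2"
      by (auto simp: simplex2_def standard_simplex_def triangle_def numeral_2_eq_2)
  qed
  show "continuous_map (subtopology (powertop_real UNIV) (standard_simplex 2)) X b"
    using assms by (simp add: singular_simplex_def)
qed

lemma simplex_path_face_2:
  assumes "u \<in> {0..1}"
  shows "simplex_path (singular_face 2 2 b) u = (b \<circ> simplex2 \<circ> linepath (0,0) (1,0)) u"
    "simplex_path (singular_face 2 0 b) u = (b \<circ> simplex2 \<circ> linepath (1,0) (0,1)) u"
    "simplex_path (singular_face 2 1 b) u = (b \<circ> simplex2 \<circ> linepath (0,0) (0,1)) u"
proof -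
  have "(\<lambda>i. if i = 0 then 1 - u else if i = 1 then u else 0) \<in> standard_simplex 1"
    using assms standard_simplex_1 by blast
  then have *: "simplex_path (singular_face 2 k b) u
      = b (simplical_face k (\<lambda>i. if i = 0 then 1 - u else if i = 1 then u else 0))" for k
    by (simp add: simplex_path_def singular_face_def)
  show "simplex_path (singular_face 2 2 b) u = (b \<circ> simplex2 \<circ> linepath (0,0) (1,0)) u"
    "simplex_path (singular_face 2 0 b) u = (b \<circ> simplex2 \<circ> linepath (1,0) (0,1)) u"
    "simplex_path (singular_face 2 1 b) u = (b \<circ> simplex2 \<circ> linepath (0,0) (0,1)) u"
    unfolding * by (auto intro!: arg_cong[of _ _ b] simp: simplex2_def simplical_face_def linepath_def fun_eq_iff)
qed

lemma transport_2_simplex: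
  assumes cov: "covering_map E B p" and b: "singular_simplex 2 B b"
    and t: "transport E p (simplex_path (singular_face 2 2 b)) e0 e1"
      "transport E p (simplex_path (singular_face 2 0 b)) e1 e2"
  shows "transport E p (simplex_path (singular_face 2 1 b)) e0 e2"
proof -
  note faces = simplex_path_face_2[of _ b]
  have c: "(0,0) \<in> triangle" "(1,0) \<in> triangle" "(0,1) \<in> triangle" by (auto simp: triangle_def)
  have "transport E p (b \<circ> simplex2 \<circ> linepath (0,0) (0,1)) e0 e2"
    using transport_triangle[OF cov compact_triangle convex_triangle continuous_map_simplex2[OF b] c
        transport_cong[OF t(1) faces(1)] transport_cong[OF t(2) faces(2)]] .
  then show ?thesis by (rule transport_cong) (rule faces(3)[symmetric])
qed

lemma covering_continuous: "covering_map E B p \<Longrightarrow> continuous_map E B p"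
  by (simp add: covering_map_def)

definition deck_group :: "'e topology \<Rightarrow> ('e \<Rightarrow> 'b) \<Rightarrow> ('e \<Rightarrow> 'e) monoid" where
  "deck_group E p = \<lparr>carrier = deck_transformations E p, monoid.mult = compose (topspace E), one = restrict id (topspace E)\<rparr>"

lemma deck_group_simps [simp]:
  "carrier (deck_group E p) = deck_transformations E p"
  "h \<otimes>\<^bsub>deck_group E p\<^esub> k = compose (topspace E) h k"
  "\<one>\<^bsub>deck_group E p\<^esub> = restrict id (topspace E)"
  by (simp_all add: deck_group_def)

lemma deck_facts:
  assumes "h \<in> deck_transformations E p"
  shows "continuous_map E E h" "\<And>x. x \<in> topspace E \<Longrightarrow> h x \<in> topspace E"
    "\<And>x. x \<in> topspace E \<Longrightarrow> p (h x) = p x"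
proof -
  show "continuous_map E E h" "\<And>x. x \<in> topspace E \<Longrightarrow> p (h x) = p x"
    using assms by (auto simp: deck_transformations_def homeomorphic_imp_continuous_map)
  then show "\<And>x. x \<in> topspace E \<Longrightarrow> h x \<in> topspace E" by (auto simp: continuous_map)
qed

lemma deck_transport:
  assumes "h \<in> deck_transformations E p" "transport E p \<gamma> e e'"
  shows "transport E p \<gamma> (h e) (h e')"
  using transport_compose[OF assms(2) deck_facts(1)[OF assms(1)], of p id] deck_facts(3)[OF assms(1)] by simp

locale inductive_galois =
  fixes E :: "'e topology" and B :: "'b topology" and p :: "'e \<Rightarrow> 'b"
  assumes galois: "galois_covering E B p" and ind: "inductive_covering E B p"
begin

abbreviation "Deck \<equiv> deck_group E p"

lemma cov: "covering_map E B p"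
  using galois by (simp add: galois_covering_def finite_covering_def)

lemma path_connected_E: "path_connected_space E" and path_connected_B: "path_connected_space B"
  using ind by (auto simp: inductive_covering_def)

lemma p_in: "e \<in> topspace E \<Longrightarrow> p e \<in> topspace B"
  using cov unfolding covering_map_def by blast

lemma surj: "x \<in> topspace B \<Longrightarrow> \<exists>e\<in>topspace E. p e = x"
  using cov unfolding covering_map_def by (metis imageE)

text \<open>
  Deck transformations are lifts of the projection, so one value determines them.
\<close>
lemma deck_unique:
  assumes "h \<in> carrier Deck" "k \<in> carrier Deck" "e \<in> topspace E" "h e = k e"
  shows "h = k"
proof
  fix x show "h x = k x"
  proof (cases "x \<in> topspace E")
    case True
    have "h \<in> deck_transformations E p" "k \<in> deck_transformations E p" using assms by simp_all
    then show ?thesis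
      using lift_unique_connected[OF cov path_connected_imp_connected_space[OF path_connected_E] deck_facts(1)[of h E p] deck_facts(1)[of k E p] _ assms(3,4) True] deck_facts(3)
      by metis
  next
    case False
    then show ?thesis using assms by (auto simp: deck_transformations_def extensional_def)
  qed
qed

lemma deck_exists:
  assumes "e \<in> topspace E" "e' \<in> topspace E" "p e = p e'"
  shows "\<exists>h\<in>carrier Deck. h e = e'"
  using galois assms unfolding galois_covering_def by simp

lemma deck_compose:
  assumes "h \<in> carrier Deck" "k \<in> carrier Deck" shows "compose (topspace E) h k \<in> carrier Deck"
proof -
  have hk: "homeomorphic_map E E h" "homeomorphic_map E E k" using assms by (auto simp: deck_transformations_def)
  then have "homeomorphic_map E E (h \<circ> k)" using homeomorphic_map_compose by blast
  then have "homeomorphic_map E E (compose (topspace E) h k)"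
    by (rule homeomorphic_map_eq) (simp add: compose_def)
  then show ?thesis using assms deck_facts[of h E p] deck_facts[of k E p]
    by (simp add: deck_transformations_def compose_def)
qed

lemma deck_one: "restrict id (topspace E) \<in> carrier Deck"
proof -
  have "homeomorphic_map E E id" by simp
  then have "homeomorphic_map E E (restrict id (topspace E))"
    by (rule homeomorphic_map_eq) simp
  then show ?thesis by (simp add: deck_transformations_def)
qed

text \<open>
  The projections of paths from \<open>e\<close> to \<open>h e\<close> and to \<open>k e\<close> are loops whose monodromy moves \<open>e\<close> like \<open>h\<close>
  and \<open>k\<close>. Monodromy commutes with deck transformations, so the two orders of composing the loops move \<open>e\<close> to
  \<open>h (k e)\<close> and \<open>k (h e)\<close>.
\<close>
lemma deck_commute:
  assumes h: "h \<in> carrier Deck" and k: "k \<in> carrier Deck" and e: "e \<in> topspace E"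
  shows "h (k e) = k (h e)"
proof -
  have D: "h \<in> deck_transformations E p" "k \<in> deck_transformations E p" using h k by simp_all
  obtain a b where a: "pathin E a" "a 0 = e" "a 1 = h e" and b: "pathin E b" "b 0 = e" "b 1 = k e"
    using path_connected_E deck_facts(2)[OF D(1) e] deck_facts(2)[OF D(2) e] e
    unfolding path_connected_space_def by meson
  have "pathin B (p \<circ> a)" "pathin B (p \<circ> b)"
    using pathin_compose[OF a(1) covering_continuous[OF cov]] pathin_compose[OF b(1) covering_continuous[OF cov]] by simp_all
  then have l: "p \<circ> a \<in> loops B (p e)" "p \<circ> b \<in> loops B (p e)"
    using a b deck_facts(3)[OF D(1) e] deck_facts(3)[OF D(2) e] by (simp_all add: loops_def)
  have t: "transport E p (p \<circ> a) e (h e)" "transport E p (p \<circ> b) e (k e)"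
    using transport_of_path[OF a(1), of p] transport_of_path[OF b(1), of p] unfolding a(2,3) b(2,3) by simp_all
  show ?thesis
    using inductive_transport_commute[OF ind e l t(1) deck_transport[OF D(1) t(2)] t(2) deck_transport[OF D(2) t(1)]] .
qed

lemma comm_group_deck: "topspace E \<noteq> {} \<Longrightarrow> comm_group Deck"
proof (rule comm_groupI)
  assume "topspace E \<noteq> {}"
  then obtain e where e: "e \<in> topspace E" by blast
  show "h \<otimes>\<^bsub>Deck\<^esub> k \<in> carrier Deck" if "h \<in> carrier Deck" "k \<in> carrier Deck" for h k
    using deck_compose[OF that] by simp
  show "\<one>\<^bsub>Deck\<^esub> \<in> carrier Deck" using deck_one by simp
  show "h \<otimes>\<^bsub>Deck\<^esub> k \<otimes>\<^bsub>Deck\<^esub> l = h \<otimes>\<^bsub>Deck\<^esub> (k \<otimes>\<^bsub>Deck\<^esub> l)"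
    if "h \<in> carrier Deck" "k \<in> carrier Deck" "l \<in> carrier Deck" for h k l
    using that deck_facts(2)[of l E p] by (auto simp: compose_def)
  show "h \<otimes>\<^bsub>Deck\<^esub> k = k \<otimes>\<^bsub>Deck\<^esub> h" if "h \<in> carrier Deck" "k \<in> carrier Deck" for h k
    using deck_commute[OF that] by (auto simp: compose_def)
  show "\<one>\<^bsub>Deck\<^esub> \<otimes>\<^bsub>Deck\<^esub> h = h" if h: "h \<in> carrier Deck" for h
  proof (rule deck_unique[OF _ h e])
    show "\<one>\<^bsub>Deck\<^esub> \<otimes>\<^bsub>Deck\<^esub> h \<in> carrier Deck" using deck_compose[OF deck_one h] by simp
    show "(\<one>\<^bsub>Deck\<^esub> \<otimes>\<^bsub>Deck\<^esub> h) e = h e" using h e deck_facts(2)[of h E p e] by (simp add: compose_def)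
  qed
  show "\<exists>k\<in>carrier Deck. k \<otimes>\<^bsub>Deck\<^esub> h = \<one>\<^bsub>Deck\<^esub>" if h: "h \<in> carrier Deck" for h
  proof -
    have he: "h e \<in> topspace E" "p (h e) = p e" using h e deck_facts(2,3)[of h E p e] by simp_all
    obtain k where k: "k \<in> carrier Deck" "k (h e) = e" using deck_exists[OF he(1) e he(2)] by blast
    have "compose (topspace E) k h = restrict id (topspace E)"
      by (rule deck_unique[OF deck_compose[OF k(1) h] deck_one e]) (use e k in \<open>simp add: compose_def\<close>)
    then show ?thesis using k(1) by (intro bexI[of _ k]) simp_all
  qed
qed

lemma transport_total:
  assumes "singular_simplex 1 B a"
  shows "\<exists>e e'. transport E p (simplex_path a) e e'"
proof -
  have g: "pathin B (simplex_path a)" using pathin_simplex_path[OF assms] .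
  then have "simplex_path a 0 \<in> topspace B" using pathin_topspace by fastforce
  then obtain e where "e \<in> topspace E" "p e = simplex_path a 0" using surj by blast
  then show ?thesis using transport_exists[OF cov g] by metis
qed

text \<open>
  The position \<open>\<kappa> e\<close> is the deck transformation that moves a chosen point of the fibre of \<open>e\<close> to \<open>e\<close>,
  and the displacement \<open>\<tau> a\<close> of a 1-simplex is the change of position along a lift of \<open>a\<close>. It is the same for
  all lifts, because these differ by deck transformations, which act on positions from the left.
\<close>
lemma displacement_exists:
  assumes ne: "topspace E \<noteq> {}"
  obtains \<kappa> \<tau> where "\<And>e. e \<in> topspace E \<Longrightarrow> \<kappa> e \<in> carrier Deck"
    "\<And>e e'. e \<in> topspace E \<Longrightarrow> e' \<in> topspace E \<Longrightarrow> p e = p e' \<Longrightarrow> \<kappa> e = \<kappa> e' \<Longrightarrow> e = e'"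
    "\<And>a. singular_simplex 1 B a \<Longrightarrow> \<tau> a \<in> carrier Deck"
    "\<And>a e e'. singular_simplex 1 B a \<Longrightarrow> transport E p (simplex_path a) e e' \<Longrightarrow> \<kappa> e' = \<kappa> e \<otimes>\<^bsub>Deck\<^esub> \<tau> a"
proof -
  interpret D: comm_group Deck by (rule comm_group_deck[OF ne])
  have "\<exists>\<sigma>. \<forall>x\<in>topspace B. \<sigma> x \<in> topspace E \<and> p (\<sigma> x) = x" using surj by (intro bchoice) blast
  then obtain \<sigma> where \<sigma>: "\<And>x. x \<in> topspace B \<Longrightarrow> \<sigma> x \<in> topspace E \<and> p (\<sigma> x) = x" by blast
  have "\<exists>\<kappa>. \<forall>e\<in>topspace E. \<kappa> e \<in> carrier Deck \<and> \<kappa> e (\<sigma> (p e)) = e"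
    using deck_exists \<sigma> p_in by (intro bchoice) blast
  then obtain \<kappa> where \<kappa>: "\<And>e. e \<in> topspace E \<Longrightarrow> \<kappa> e \<in> carrier Deck \<and> \<kappa> e (\<sigma> (p e)) = e" by blast
  have \<kappa>_deck: "\<kappa> (h e) = h \<otimes>\<^bsub>Deck\<^esub> \<kappa> e" if h: "h \<in> carrier Deck" and e: "e \<in> topspace E" for h e
  proof (rule deck_unique)
    have he: "h e \<in> topspace E" "p (h e) = p e" using h e deck_facts(2,3)[of h E p e] by simp_all
    show "\<kappa> (h e) \<in> carrier Deck" using \<kappa>[OF he(1)] by blast
    show "h \<otimes>\<^bsub>Deck\<^esub> \<kappa> e \<in> carrier Deck" using D.m_closed[OF h] \<kappa>[OF e] by blast
    show s: "\<sigma> (p e) \<in> topspace E" using \<sigma>[OF p_in[OF e]] by blast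
    show "\<kappa> (h e) (\<sigma> (p e)) = (h \<otimes>\<^bsub>Deck\<^esub> \<kappa> e) (\<sigma> (p e))"
      using \<kappa>[OF he(1)] \<kappa>[OF e] he s by (simp add: compose_def)
  qed
  have "\<exists>d\<in>carrier Deck. \<forall>e e'. transport E p (simplex_path a) e e' \<longrightarrow> \<kappa> e' = \<kappa> e \<otimes>\<^bsub>Deck\<^esub> d"
    if a: "singular_simplex 1 B a" for a
  proof -
    obtain e e' where t: "transport E p (simplex_path a) e e'" using transport_total[OF a] by blast
    note ends = transport_ends[OF t]
    define d where "d = inv\<^bsub>Deck\<^esub> (\<kappa> e) \<otimes>\<^bsub>Deck\<^esub> \<kappa> e'"
    have K: "\<kappa> e \<in> carrier Deck" "\<kappa> e' \<in> carrier Deck" using \<kappa> ends by blast+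
    have d: "d \<in> carrier Deck" unfolding d_def by (intro D.m_closed D.inv_closed K)
    have "\<kappa> f' = \<kappa> f \<otimes>\<^bsub>Deck\<^esub> d" if f: "transport E p (simplex_path a) f f'" for f f'
    proof -
      note fends = transport_ends[OF f]
      obtain h where h: "h \<in> carrier Deck" "h e = f" using deck_exists[of e f] ends fends by metis
      have "transport E p (simplex_path a) f (h e')" using deck_transport[OF _ t, of h] h by simp
      then have "h e' = f'" using transport_unique[OF cov _ f] by blast
      then have "\<kappa> f' = h \<otimes>\<^bsub>Deck\<^esub> \<kappa> e'" "\<kappa> f = h \<otimes>\<^bsub>Deck\<^esub> \<kappa> e" using \<kappa>_deck[OF h(1)] ends h(2) by metis+
      then have f': "\<kappa> f' = h \<otimes>\<^bsub>Deck\<^esub> \<kappa> e'" and ff: "\<kappa> f = h \<otimes>\<^bsub>Deck\<^esub> \<kappa> e" by blast+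
      have "\<kappa> f \<otimes>\<^bsub>Deck\<^esub> d = h \<otimes>\<^bsub>Deck\<^esub> (\<kappa> e \<otimes>\<^bsub>Deck\<^esub> (inv\<^bsub>Deck\<^esub> (\<kappa> e) \<otimes>\<^bsub>Deck\<^esub> \<kappa> e'))"
        unfolding ff d_def using D.m_assoc[OF h(1) K(1) d] unfolding d_def .
      also have "\<kappa> e \<otimes>\<^bsub>Deck\<^esub> (inv\<^bsub>Deck\<^esub> (\<kappa> e) \<otimes>\<^bsub>Deck\<^esub> \<kappa> e') = \<kappa> e'"
        using D.inv_solve_left[OF _ K(1), of "inv\<^bsub>Deck\<^esub> (\<kappa> e) \<otimes>\<^bsub>Deck\<^esub> \<kappa> e'" "\<kappa> e'"] K D.m_assoc[OF K(1) D.inv_closed[OF K(1)] K(2)]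
          D.r_inv[OF K(1)] D.l_one[OF K(2)] by metis
      finally show ?thesis using f' by metis
    qed
    then show ?thesis using d by blast
  qed
  then have "\<exists>\<tau>. \<forall>a\<in>singular_simplex_set 1 B. \<tau> a \<in> carrier Deck \<and>
      (\<forall>e e'. transport E p (simplex_path a) e e' \<longrightarrow> \<kappa> e' = \<kappa> e \<otimes>\<^bsub>Deck\<^esub> \<tau> a)"
    by (intro bchoice) blast
  then obtain \<tau> where \<tau>: "\<And>a. singular_simplex 1 B a \<Longrightarrow> \<tau> a \<in> carrier Deck"
    "\<And>a e e'. singular_simplex 1 B a \<Longrightarrow> transport E p (simplex_path a) e e' \<Longrightarrow> \<kappa> e' = \<kappa> e \<otimes>\<^bsub>Deck\<^esub> \<tau> a" by blast
  show ?thesis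
  proof (rule that[of \<kappa> \<tau>])
    show "\<kappa> e \<in> carrier Deck" if "e \<in> topspace E" for e using \<kappa>[OF that] by blast
    show "e = e'" if "e \<in> topspace E" "e' \<in> topspace E" "p e = p e'" "\<kappa> e = \<kappa> e'" for e e'
      using \<kappa> that by metis
    show "\<tau> a \<in> carrier Deck" if "singular_simplex 1 B a" for a using \<tau>(1)[OF that] .
  qed (use \<tau>(2) in blast)
qed

end

section \<open>Monodromy factors through homology\<close>

lemma chain_hom_diff:
  assumes G: "group G" and H: "H \<in> hom (chain_group n X) G" and a: "singular_chain n X a" and b: "singular_chain n X b"
  shows "H (a - b) = H a \<otimes>\<^bsub>G\<^esub> inv\<^bsub>G\<^esub> H b"
proof -
  interpret group G by fact
  have ab: "singular_chain n X (a - b)" using singular_chain_diff[OF a b] .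
  have c: "H a \<in> carrier G" "H b \<in> carrier G" "H (a - b) \<in> carrier G"
    using hom_in_carrier[OF H] a b ab by simp_all
  have "H ((a - b) + b) = H (a - b) \<otimes>\<^bsub>G\<^esub> H b"
    using hom_mult[OF H, of "a - b" b] ab b by simp
  then have "H a = H (a - b) \<otimes>\<^bsub>G\<^esub> H b" by simp
  then show ?thesis using c by (simp add: m_assoc)
qed

lemma chain_hom_exists:
  assumes G: "comm_group G" and t: "\<And>a. singular_simplex n X a \<Longrightarrow> t a \<in> carrier G"
  obtains H where "H \<in> hom (chain_group n X) G" "\<And>a. singular_simplex n X a \<Longrightarrow> H (frag_of a) = t a"
proof -
  have "t ` singular_simplex_set n X \<subseteq> carrier G" using t by blast
  from comm_group.free_Abelian_group_universal[OF G this] show ?thesis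
    using that unfolding chain_group_def[symmetric] by (metis mem_Collect_eq)
qed

lemma transport_path_simplex:
  assumes "transport E p g e e'"
  shows "transport E p (simplex_path (path_simplex g)) e e'"
  by (rule transport_cong[OF assms]) (rule simplex_path_path_simplex[symmetric])

lemma chain_map_path_simplex:
  "chain_map 1 p (frag_of (path_simplex a)) = frag_of (path_simplex (p \<circ> a))"
  by (auto simp: simplex_map_def path_simplex_def intro!: arg_cong[of _ _ frag_of] restrict_ext)

lemma chain_map_1_frag_of:
  assumes "singular_simplex 1 X a"
  shows "chain_map 1 p (frag_of a) = frag_of (path_simplex (p \<circ> simplex_path a))"
  using chain_map_path_simplex[of p "simplex_path a"] path_simplex_simplex_path[OF assms] by simp

text \<open>
  What follows uses only that positions change by displacements with values in an abelian group.
\<close>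
context
  fixes E :: "'e topology" and B :: "'b topology" and p :: "'e \<Rightarrow> 'b"
    and G :: "('g, 'h) monoid_scheme" (structure) and \<kappa> \<tau>
  assumes cov: "covering_map E B p" and G: "comm_group G"
    and \<kappa>: "\<And>e. e \<in> topspace E \<Longrightarrow> \<kappa> e \<in> carrier G"
    and \<tau>: "\<And>a. singular_simplex 1 B a \<Longrightarrow> \<tau> a \<in> carrier G"
    and disp: "\<And>a e e'. singular_simplex 1 B a \<Longrightarrow> transport E p (simplex_path a) e e' \<Longrightarrow> \<kappa> e' = \<kappa> e \<otimes> \<tau> a"
begin

interpretation comm_group G by (rule G)

text \<open>
  A 2-simplex has displacements \<open>t\<^sub>0, t\<^sub>1, t\<^sub>2\<close> along its faces with \<open>t\<^sub>1 = t\<^sub>2t\<^sub>0\<close>, because it lifts.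
  Commutativity then cancels \<open>t\<^sub>0t\<^sub>1\<^bsup>-1\<^esup>t\<^sub>2\<close>.
\<close>
lemma displacement_of_boundary:
  assumes H: "H \<in> hom (chain_group 1 B) G" "\<And>a. singular_simplex 1 B a \<Longrightarrow> H (frag_of a) = \<tau> a"
    and d: "singular_chain 2 B d"
  shows "H (chain_boundary 2 d) = \<one>"
proof -
  have "singular_chain 2 B d \<and> H (chain_boundary 2 d) = \<one>"
    using d[unfolded singular_chain_def]
  proof (induction d rule: frag_induction)
    case zero
    show ?case using hom_one[OF H(1) group_chain_group is_group] by simp
  next
    case (one b)
    then have b: "singular_simplex 2 B b" by simp
    let ?a = "\<lambda>k. singular_face 2 k b"
    have a: "singular_simplex 1 B (?a k)" if "k \<le> 2" for k
      using singular_simplex_singular_face[OF b _ that] by simp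
    have a3: "singular_simplex 1 B (?a 0)" "singular_simplex 1 B (?a 1)" "singular_simplex 1 B (?a 2)" using a by simp_all
    have path: "pathin B (simplex_path (?a k))" if "k \<le> 2" for k using pathin_simplex_path[OF a[OF that]] .
    have start: "simplex_path (?a 2) 0 \<in> topspace B" using pathin_topspace[OF path[of 2], of 0] by simp
    have "p ` topspace E = topspace B" using cov by (simp add: covering_map_def)
    then obtain e0 where e0: "e0 \<in> topspace E" "p e0 = simplex_path (?a 2) 0"
      using start by (metis imageE)
    obtain e1 where e1: "transport E p (simplex_path (?a 2)) e0 e1"
      by (rule transport_exists[OF cov path e0]) auto
    have "simplex_path (?a 2) 1 = simplex_path (?a 0) 0"
      using simplex_path_face_2(1)[of 1 b] simplex_path_face_2(2)[of 0 b] by (simp add: linepath_def)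
    then have e1': "e1 \<in> topspace E" "p e1 = simplex_path (?a 0) 0" using transport_ends[OF e1] by simp_all
    obtain e2 where e2: "transport E p (simplex_path (?a 0)) e1 e2"
      by (rule transport_exists[OF cov path e1']) auto
    have e02: "transport E p (simplex_path (?a 1)) e0 e2" using transport_2_simplex[OF cov b e1 e2] .
    have t: "\<tau> (?a 0) \<in> carrier G" "\<tau> (?a 1) \<in> carrier G" "\<tau> (?a 2) \<in> carrier G" using \<tau> a3 by blast+
    have k: "\<kappa> e0 \<in> carrier G" using \<kappa>[OF e0(1)] .
    have "\<kappa> e0 \<otimes> \<tau> (?a 1) = \<kappa> e0 \<otimes> (\<tau> (?a 2) \<otimes> \<tau> (?a 0))"
      using disp[OF a3(3) e1] disp[OF a3(1) e2] disp[OF a3(2) e02] m_assoc[OF k t(3,1)] by simp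
    then have t1: "\<tau> (?a 1) = \<tau> (?a 2) \<otimes> \<tau> (?a 0)" using k t by simp
    have eq: "chain_boundary 2 (frag_of b) = (frag_of (?a 2) + frag_of (?a 0)) - frag_of (?a 1)"
      unfolding chain_boundary_2 by simp
    have ch: "singular_chain 1 B (frag_of (?a 0))" "singular_chain 1 B (frag_of (?a 1))" "singular_chain 1 B (frag_of (?a 2))"
      using a3 unfolding singular_chain_of by blast+
    have "H (frag_of (?a 2) + frag_of (?a 0)) = \<tau> (?a 2) \<otimes> \<tau> (?a 0)"
      using hom_mult[OF H(1), of "frag_of (?a 2)" "frag_of (?a 0)"] ch H(2)[OF a3(1)] H(2)[OF a3(3)] by simp
    then have "H (chain_boundary 2 (frag_of b)) = \<one>"
      unfolding eq chain_hom_diff[OF is_group H(1) singular_chain_add[OF ch(3,1)] ch(2)] H(2)[OF a3(2)] t1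
      using t by simp
    then show ?case using b by (simp add: singular_chain_of)
  next
    case (diff a b)
    then have "singular_chain 1 B (chain_boundary 2 a)" "singular_chain 1 B (chain_boundary 2 b)"
      using singular_chain_boundary[of 2 B a] singular_chain_boundary[of 2 B b] by (simp_all add: numeral_2_eq_2)
    then have "H (chain_boundary 2 (a - b)) = \<one>"
      unfolding chain_boundary_diff using chain_hom_diff[OF is_group H(1), of "chain_boundary 2 a" "chain_boundary 2 b"] diff by simp
    then show ?case using diff singular_chain_diff[of 2 B a b] by simp
  qed
  then show ?thesis by blast
qed

text \<open>
  The displacement of a projected simplex is the difference of the positions of its end points, so it
  factors through the boundary: the homomorphism \<open>K\<close> extends \<open>\<kappa>\<close> to 0-chains.
\<close>
lemma displacement_of_lifted_chain:
  assumes H: "H \<in> hom (chain_group 1 B) G" "\<And>a. singular_simplex 1 B a \<Longrightarrow> H (frag_of a) = \<tau> a"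
    and c: "singular_chain 1 E c" "chain_boundary 1 c = 0"
  shows "H (chain_map 1 p c) = \<one>"
proof -
  note p = covering_continuous[OF cov]
  let ?k = "\<lambda>a::(nat \<Rightarrow> real) \<Rightarrow> 'e. \<kappa> (a (\<lambda>j. if j = 0 then 1 else 0))"
  have "?k a \<in> carrier G" if a: "singular_simplex 0 E a" for a
  proof -
    obtain e where "e \<in> topspace E" "a = point_simplex e" by (rule singular_simplex_0[OF a])
    then show ?thesis using \<kappa> by (simp add: point_simplex_def standard_simplex_0)
  qed
  then obtain K where K: "K \<in> hom (chain_group 0 E) G" "\<And>a. singular_simplex 0 E a \<Longrightarrow> K (frag_of a) = ?k a"
    using chain_hom_exists[OF G, of 0 E ?k] by blast
  have point: "singular_simplex 0 E (point_simplex e)" "K (frag_of (point_simplex e)) = \<kappa> e" if "e \<in> topspace E" for e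
  proof -
    show *: "singular_simplex 0 E (point_simplex e)" using that by (simp add: singular_simplex_def point_simplex_def)
    show "K (frag_of (point_simplex e)) = \<kappa> e" using K(2)[OF *] by (simp add: point_simplex_def standard_simplex_0)
  qed
  have "singular_chain 1 E c \<and> H (chain_map 1 p c) = K (chain_boundary 1 c)"
    using c(1)[unfolded singular_chain_def]
  proof (induction c rule: frag_induction)
    case zero
    show ?case using hom_one[OF H(1) group_chain_group is_group] hom_one[OF K(1) group_chain_group is_group] by simp
  next
    case (one a)
    then have a: "singular_simplex 1 E a" by simp
    define g where "g = simplex_path a"
    have g: "pathin E g" using pathin_simplex_path[OF a] by (simp add: g_def)
    have g01: "g 0 \<in> topspace E" "g 1 \<in> topspace E" using pathin_topspace[OF g] by simp_all
    let ?b = "path_simplex (p \<circ> g)"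
    have b: "singular_simplex 1 B ?b" using singular_simplex_path_simplex pathin_compose[OF g p] by blast
    have "transport E p (simplex_path ?b) (g 0) (g 1)"
      by (rule transport_path_simplex[OF transport_of_path[OF g]])
    then have disp_b: "\<kappa> (g 1) = \<kappa> (g 0) \<otimes> \<tau> ?b" by (rule disp[OF b])
    have ch: "singular_chain 0 E (frag_of (point_simplex (g 0)))" "singular_chain 0 E (frag_of (point_simplex (g 1)))"
      using point(1) g01 unfolding singular_chain_of by blast+
    have "K (chain_boundary 1 (frag_of a)) = \<kappa> (g 1) \<otimes> inv \<kappa> (g 0)"
      unfolding chain_boundary_1_path g_def[symmetric] chain_hom_diff[OF is_group K(1) ch(2,1)]
      using point(2) g01 by simp
    also have "\<dots> = \<tau> ?b" unfolding disp_b using \<kappa>[OF g01(1)] \<tau>[OF b]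
      by (simp add: m_comm[of "\<kappa> (g 0)"] m_assoc)
    also have "\<dots> = H (chain_map 1 p (frag_of a))"
      unfolding chain_map_1_frag_of[OF a] g_def[symmetric] H(2)[OF b] ..
    finally show ?case using a by (simp add: singular_chain_of)
  next
    case (diff a b)
    then have ab: "singular_chain 1 E a" "singular_chain 1 E b" by blast+
    have "H (chain_map 1 p (a - b)) = H (chain_map 1 p a) \<otimes> inv H (chain_map 1 p b)"
      unfolding chain_map_diff
      by (rule chain_hom_diff[OF is_group H(1) singular_chain_chain_map[OF ab(1) p] singular_chain_chain_map[OF ab(2) p]])
    moreover have "K (chain_boundary 1 (a - b)) = K (chain_boundary 1 a) \<otimes> inv K (chain_boundary 1 b)"
      unfolding chain_boundary_diff
      using chain_hom_diff[OF is_group K(1), of "chain_boundary 1 a" "chain_boundary 1 b"]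
        singular_chain_boundary[of 1 E a] singular_chain_boundary[of 1 E b] ab by simp
    ultimately show ?case using diff singular_chain_diff[OF ab] by simp
  qed
  then show ?thesis using c(2) hom_one[OF K(1) group_chain_group is_group] by simp
qed

lemma displacement_of_homology_class:
  assumes \<alpha>: "\<alpha> \<in> loops B x" and \<gamma>: "\<gamma> \<in> loops B x" and C: "C \<in> carrier (H1 E)"
    and eq: "homology_class_of_loop B \<alpha> = homology_class_of_loop B \<gamma> \<otimes>\<^bsub>H1 B\<^esub> H1_map E B p C"
    and t: "transport E p \<alpha> e e'" and t': "transport E p \<gamma> e e''"
  shows "\<kappa> e' = \<kappa> e''"
proof -
  have paths: "pathin B \<alpha>" "pathin B \<gamma>" using \<alpha> \<gamma> by (simp_all add: loops_def)
  note s = singular_simplex_path_simplex[OF paths(1)] singular_simplex_path_simplex[OF paths(2)]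
  have disp_loop: "\<kappa> e1 = \<kappa> e \<otimes> \<tau> (path_simplex g)" if "pathin B g" "transport E p g e e1" for g e1
    using disp[OF singular_simplex_path_simplex[OF that(1)] transport_path_simplex[OF that(2)]] .
  obtain c where c: "singular_chain 1 E c" "chain_boundary 1 c = 0" "C = homologous_rel_set 1 E {} c"
    using C unfolding carrier_H1 singular_cycle by blast
  obtain H where H: "H \<in> hom (chain_group 1 B) G" "\<And>a. singular_simplex 1 B a \<Longrightarrow> H (frag_of a) = \<tau> a"
    using chain_hom_exists[OF G, of 1 B \<tau>] \<tau> by blast
  let ?a = "frag_of (path_simplex \<alpha>)" and ?g = "frag_of (path_simplex \<gamma>)" and ?c = "chain_map 1 p c"
  have ch: "singular_chain 1 B ?a" "singular_chain 1 B ?g" "singular_chain 1 B ?c"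
    using s singular_chain_chain_map[OF c(1) covering_continuous[OF cov]] unfolding singular_chain_of by blast+
  have "H1_map E B p C = homologous_rel_set 1 B {} ?c"
    using hom_induced_chain_map[of E B p "{}" "{}" 1 c] covering_continuous[OF cov] c by (simp add: singular_cycle)
  then have "homologous_rel 1 B {} ?a (?g + ?c)"
    using eq by (simp only: homology_class_path_simplex mult_H1 homologous_rel_set_eq)
  then obtain d where "singular_chain 2 B d" "chain_boundary 2 d = ?a - (?g + ?c)"
    unfolding homologous_rel_def singular_boundary by (auto simp: numeral_2_eq_2)
  then have "H (?a - (?g + ?c)) = \<one>" using displacement_of_boundary[OF H] by metis
  moreover have "H (?g + ?c) = \<tau> (path_simplex \<gamma>) \<otimes> \<one>"
    using hom_mult[OF H(1), of ?g ?c] ch H(2)[OF s(2)] displacement_of_lifted_chain[OF H c(1,2)] by simp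
  moreover have "H (?a - (?g + ?c)) = H ?a \<otimes> inv H (?g + ?c)"
    using chain_hom_diff[OF is_group H(1) ch(1) singular_chain_add[OF ch(2,3)]] .
  ultimately have "\<tau> (path_simplex \<alpha>) \<otimes> inv \<tau> (path_simplex \<gamma>) = \<one>"
    using H(2)[OF s(1)] \<tau>[OF s(2)] by simp
  then have "\<tau> (path_simplex \<alpha>) = \<tau> (path_simplex \<gamma>)"
    using \<tau>[OF s(1)] \<tau>[OF s(2)] by (metis inv_closed inv_equality inv_inv)
  then show ?thesis using disp_loop[OF paths(1) t] disp_loop[OF paths(2) t'] by simp
qed

end

context inductive_galois
begin

text \<open>
  The displacements of \<open>\<alpha>\<close> and \<open>\<gamma>\<close> agree, since the displacement homomorphism vanishes on boundaries
  and on projected cycles; so starting at \<open>e\<close> both lead to the same position.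
\<close>
lemma homologous_loops_same_transport:
  assumes \<alpha>: "\<alpha> \<in> loops B x" and \<gamma>: "\<gamma> \<in> loops B x" and C: "C \<in> carrier (H1 E)"
    and eq: "homology_class_of_loop B \<alpha> = homology_class_of_loop B \<gamma> \<otimes>\<^bsub>H1 B\<^esub> H1_map E B p C"
    and t: "transport E p \<alpha> e e'"
  shows "transport E p \<gamma> e e'"
proof -
  note ends = transport_ends[OF t]
  have ne: "topspace E \<noteq> {}" using ends(1) by blast
  obtain \<kappa> \<tau> where k: "\<And>e. e \<in> topspace E \<Longrightarrow> \<kappa> e \<in> carrier Deck"
    "\<And>e e'. e \<in> topspace E \<Longrightarrow> e' \<in> topspace E \<Longrightarrow> p e = p e' \<Longrightarrow> \<kappa> e = \<kappa> e' \<Longrightarrow> e = e'"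
    "\<And>a. singular_simplex 1 B a \<Longrightarrow> \<tau> a \<in> carrier Deck"
    "\<And>a e e'. singular_simplex 1 B a \<Longrightarrow> transport E p (simplex_path a) e e' \<Longrightarrow> \<kappa> e' = \<kappa> e \<otimes>\<^bsub>Deck\<^esub> \<tau> a"
    by (rule displacement_exists[OF ne], rule that) auto
  have g: "pathin B \<gamma>" "p e = \<gamma> 0" "p e' = \<gamma> 1" using \<alpha> \<gamma> ends by (simp_all add: loops_def)
  obtain e'' where e'': "transport E p \<gamma> e e''" by (rule transport_exists[OF cov g(1) ends(1) g(2)])
  have "\<kappa> e' = \<kappa> e''"
    by (rule displacement_of_homology_class[OF cov comm_group_deck[OF ne] k(1,3,4) \<alpha> \<gamma> C eq t e''])
  then have "e' = e''" using k(2)[of e' e''] ends(2) transport_ends[OF e''] g by simp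
  then show ?thesis using e'' by simp
qed

text \<open>
  The lifts of \<open>\<alpha>\<close> and \<open>\<gamma>\<close> have the same end points, so their difference is a cycle in \<open>E\<close>, and it
  projects to the difference of \<open>\<alpha>\<close> and \<open>\<gamma>\<close>.
\<close>
lemma same_transport_homologous:
  assumes \<alpha>: "\<alpha> \<in> loops B x" and \<gamma>: "\<gamma> \<in> loops B x"
    and t: "transport E p \<alpha> e e'" "transport E p \<gamma> e e'"
  shows "\<exists>C\<in>carrier (H1 E). homology_class_of_loop B \<alpha> = homology_class_of_loop B \<gamma> \<otimes>\<^bsub>H1 B\<^esub> H1_map E B p C"
proof -
  obtain a where a: "pathin E a" "\<And>u. u \<in> {0..1} \<Longrightarrow> p (a u) = \<alpha> u" "a 0 = e" "a 1 = e'"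
    using t(1) unfolding transport_def is_lift_def by blast
  obtain g where g: "pathin E g" "\<And>u. u \<in> {0..1} \<Longrightarrow> p (g u) = \<gamma> u" "g 0 = e" "g 1 = e'"
    using t(2) unfolding transport_def is_lift_def by blast
  define c where "c = frag_of (path_simplex a) - frag_of (path_simplex g)"
  have "singular_chain 1 E c"
    unfolding c_def using a(1) g(1) by (intro singular_chain_diff) (simp_all add: singular_chain_of singular_simplex_path_simplex[simplified])
  moreover have "chain_boundary 1 c = 0"
    unfolding c_def chain_boundary_diff chain_boundary_path_simplex a g by simp
  ultimately have c: "singular_relcycle 1 E {} c" unfolding singular_cycle by blast
  have "path_simplex (p \<circ> a) = path_simplex \<alpha>" "path_simplex (p \<circ> g) = path_simplex \<gamma>"
    using a(2) g(2) by (auto intro: path_simplex_cong)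
  then have pc: "chain_map 1 p c = frag_of (path_simplex \<alpha>) - frag_of (path_simplex \<gamma>)"
    unfolding c_def chain_map_diff chain_map_path_simplex by simp
  have "H1_map E B p (homologous_rel_set 1 E {} c) = homologous_rel_set 1 B {} (chain_map 1 p c)"
    using hom_induced_chain_map[of E B p "{}" "{}" 1 c] covering_continuous[OF cov] c by simp
  then have "homology_class_of_loop B \<gamma> \<otimes>\<^bsub>H1 B\<^esub> H1_map E B p (homologous_rel_set 1 E {} c) = homology_class_of_loop B \<alpha>"
    unfolding homology_class_path_simplex pc by (simp only: mult_H1) simp
  moreover have "homologous_rel_set 1 E {} c \<in> carrier (H1 E)" unfolding carrier_H1 using c by blast
  ultimately show ?thesis by metis
qed

end

section \<open>The wreath problem\<close>

lemma permutation_of_relation: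
  assumes S: "finite S"
    and total: "\<And>s. s \<in> S \<Longrightarrow> \<exists>t\<in>S. R s t"
    and inj: "\<And>s s' t. s \<in> S \<Longrightarrow> s' \<in> S \<Longrightarrow> R s t \<Longrightarrow> R s' t \<Longrightarrow> s = s'"
  obtains g where "g permutes S" "\<And>s. s \<in> S \<Longrightarrow> R s (g s)"
proof -
  have "\<exists>k. \<forall>s\<in>S. k s \<in> S \<and> R s (k s)" using total by (intro bchoice) blast
  then obtain k where k: "\<And>s. s \<in> S \<Longrightarrow> k s \<in> S" "\<And>s. s \<in> S \<Longrightarrow> R s (k s)" by blast
  define g where "g s = (if s \<in> S then k s else s)" for s
  have gS: "g ` S \<subseteq> S" using k(1) by (auto simp: g_def)
  have "inj_on g S"
  proof (rule inj_onI)
    fix s s' assume s: "s \<in> S" "s' \<in> S" "g s = g s'"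
    then have "R s (g s)" "R s' (g s)" using k(2)[of s] k(2)[of s'] by (simp_all add: g_def)
    then show "s = s'" using inj s by blast
  qed
  then have "bij_betw g S S" using endo_inj_surj[OF S gS] by (simp add: bij_betw_def)
  then have "g permutes S" by (rule bij_imp_permutes) (simp add: g_def)
  then show ?thesis using that[of g] k(2) by (simp add: g_def)
qed

text \<open>
  The topological content of an enumerative problem over an inductive Galois covering. The incidence
  set of the wreath problem is a subset of \<open>E \<times> Y\<close>, and its projection \<open>\<pi>\<close> to \<open>B \<times> Y\<close> changes only the
  first component.
\<close>
locale wreath_problem = inductive_galois E B p
  for E :: "'e topology" and B :: "'b topology" and p :: "'e \<Rightarrow> 'b" +
  fixes Y :: "'y topology" and U :: "('b \<times> 'y) set" and f :: 'y
  assumes U: "U \<subseteq> topspace B \<times> topspace Y"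
    and cover: "finite_covering (incidence_topology B Y U) Y snd"
    and f: "f \<in> topspace Y"
begin

abbreviation "I \<equiv> incidence_topology B Y U"
abbreviation "U' \<equiv> wreath_incidence E p U"
abbreviation "I' \<equiv> incidence_topology E Y U'"
abbreviation "S \<equiv> solutions B Y U f"
abbreviation "S' \<equiv> solutions E Y U' f"
abbreviation "\<pi> \<equiv> map_prod p (id :: 'y \<Rightarrow> 'y)"

lemma covU: "covering_map I Y snd" and finite_S: "finite S"
  using cover f by (auto simp: finite_covering_def solutions_def)

lemma topspace_I: "topspace I = U" and topspace_I': "topspace I' = U'"
  using U unfolding incidence_topology_def wreath_incidence_def
  by (auto simp: topspace_subtopology)

lemma mem_S: "s \<in> S \<longleftrightarrow> s \<in> U \<and> snd s = f"
  unfolding solutions_def fiber_def topspace_I by simp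

lemma mem_S': "z \<in> S' \<longleftrightarrow> fst z \<in> topspace E \<and> \<pi> z \<in> S"
  unfolding mem_S unfolding solutions_def fiber_def topspace_I'
  by (cases z) (auto simp: wreath_incidence_def)

lemma S_in: "s \<in> S \<Longrightarrow> fst s \<in> topspace B"
  using U unfolding mem_S by auto

lemma S'_snd: "z \<in> S' \<Longrightarrow> snd z = f"
  unfolding mem_S' mem_S by simp

lemma finite_S': "finite S'"
proof -
  have "finite (\<Union>s\<in>S. fiber E p (fst s))"
    using finite_S galois S_in unfolding galois_covering_def finite_covering_def by blast
  moreover have "S' \<subseteq> (\<lambda>e. (e, f)) ` (\<Union>s\<in>S. fiber E p (fst s))"
  proof
    fix z assume z: "z \<in> S'"
    then have "fst z \<in> fiber E p (fst (\<pi> z))" unfolding mem_S' fiber_def by simp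
    then have "fst z \<in> (\<Union>s\<in>S. fiber E p (fst s))" using z unfolding mem_S' by blast
    moreover have "z = (fst z, f)" using S'_snd[OF z] by (metis prod.collapse)
    ultimately show "z \<in> (\<lambda>e. (e, f)) ` (\<Union>s\<in>S. fiber E p (fst s))" by blast
  qed
  ultimately show ?thesis using finite_surj by blast
qed

lemma S'_over: "s \<in> S \<Longrightarrow> \<exists>z\<in>S'. \<pi> z = s"
proof -
  assume s: "s \<in> S"
  obtain e where "e \<in> topspace E" "p e = fst s" using surj[OF S_in[OF s]] by blast
  then have "\<pi> (e, snd s) = s" "fst (e, snd s) \<in> topspace E" by auto
  then show ?thesis using s mem_S' by metis
qed

lemma continuous_fst_I: "continuous_map I B fst" and continuous_fst_I': "continuous_map I' E fst"
  and continuous_snd_I: "continuous_map I Y snd" and continuous_snd_I': "continuous_map I' Y snd"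
  unfolding incidence_topology_def
  by (intro continuous_map_from_subtopology continuous_map_fst continuous_map_snd)+

lemma continuous_map_I:
  assumes "continuous_map Z B (fst \<circ> g)" "continuous_map Z Y (snd \<circ> g)" "g ` topspace Z \<subseteq> U"
  shows "continuous_map Z I g"
  using assms unfolding incidence_topology_def by (auto simp: continuous_map_in_subtopology continuous_map_pairwise)

lemma continuous_map_I':
  assumes "continuous_map Z E (fst \<circ> g)" "continuous_map Z Y (snd \<circ> g)" "g ` topspace Z \<subseteq> U'"
  shows "continuous_map Z I' g"
  using assms unfolding incidence_topology_def by (auto simp: continuous_map_in_subtopology continuous_map_pairwise)

lemma continuous_\<pi>: "continuous_map I' I \<pi>"
proof (rule continuous_map_I)
  have "continuous_map I' B (p \<circ> fst)"
    using continuous_map_compose[OF continuous_fst_I' covering_continuous[OF cov]] .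
  then show "continuous_map I' B (fst \<circ> \<pi>)" by (simp add: o_def)
  show "continuous_map I' Y (snd \<circ> \<pi>)" using continuous_snd_I' by (simp add: o_def)
  show "\<pi> ` topspace I' \<subseteq> U" unfolding topspace_I' by (auto simp: wreath_incidence_def)
qed

lemma continuous_deck:
  assumes h: "h \<in> carrier Deck" shows "continuous_map I' I' (map_prod h id)"
proof (rule continuous_map_I')
  have D: "h \<in> deck_transformations E p" using h by simp
  have "continuous_map I' E (h \<circ> fst)"
    using continuous_map_compose[OF continuous_fst_I' deck_facts(1)[OF D]] .
  then show "continuous_map I' E (fst \<circ> map_prod h id)" by (simp add: o_def)
  show "continuous_map I' Y (snd \<circ> map_prod h id)" using continuous_snd_I' by (simp add: o_def)
  show "map_prod h id ` topspace I' \<subseteq> U'" unfolding topspace_I'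
    using deck_facts(2,3)[OF D] by (auto simp: wreath_incidence_def)
qed

lemma transport_project:
  assumes "transport I' snd \<gamma> z z'" shows "transport I snd \<gamma> (\<pi> z) (\<pi> z')"
  using transport_compose[OF assms continuous_\<pi>, of snd id] by simp

lemma transport_deck:
  assumes "transport I' snd \<gamma> z z'" "h \<in> carrier Deck"
  shows "transport I' snd \<gamma> (map_prod h id z) (map_prod h id z')"
  using transport_compose[OF assms(1) continuous_deck[OF assms(2)], of snd id] by simp

text \<open>
  A path in the incidence set of the wreath problem is a path in \<open>U\<close> together with a lift of its first
  component to the covering. This lemma and the next translate between the two.
\<close>
lemma transport_wreath:
  assumes c: "is_lift I snd \<gamma> c" and t: "transport E p (fst \<circ> c) e e'" and z: "z = (e, \<gamma> 0)" "z' = (e', \<gamma> 1)"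
  shows "transport I' snd \<gamma> z z'"
proof -
  obtain a where a: "pathin E a" "\<And>u. u \<in> {0..1} \<Longrightarrow> p (a u) = fst (c u)" "a 0 = e" "a 1 = e'"
    using t unfolding transport_def is_lift_def by auto
  have c': "pathin I c" "\<And>u. u \<in> {0..1} \<Longrightarrow> snd (c u) = \<gamma> u" using c unfolding is_lift_def by auto
  let ?b = "\<lambda>u. (a u, snd (c u))"
  have "pathin Y (snd \<circ> c)" using pathin_compose[OF c'(1) continuous_snd_I] .
  then have "pathin I' ?b" unfolding pathin_def
  proof (intro continuous_map_I')
    show "?b ` topspace (top_of_set {0..1}) \<subseteq> U'"
    proof safe
      fix u :: real assume "u \<in> topspace (top_of_set {0..1})"
      then have u: "u \<in> {0..1}" by simp
      have "a u \<in> topspace E" using pathin_topspace[OF a(1) u] .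
      moreover have "(p (a u), snd (c u)) \<in> U" using pathin_topspace[OF c'(1) u] topspace_I a(2)[OF u] by simp
      ultimately show "(a u, snd (c u)) \<in> U'" by (simp add: wreath_incidence_def)
    qed
  qed (use a(1) in \<open>simp_all add: pathin_def o_def\<close>)
  then show ?thesis using c'(2) a(3,4) z unfolding transport_def is_lift_def
    by (intro exI[of _ ?b]) auto
qed

lemma transport_wreath_fst:
  assumes c: "is_lift I snd \<gamma> c" "c 0 = \<pi> z" and t: "transport I' snd \<gamma> z z'"
  shows "transport E p (fst \<circ> c) (fst z) (fst z')"
proof -
  obtain b where b: "pathin I' b" "\<And>u. u \<in> {0..1} \<Longrightarrow> snd (b u) = \<gamma> u" "b 0 = z" "b 1 = z'"
    using t unfolding transport_def is_lift_def by auto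
  have c': "pathin I c" "\<And>u. u \<in> {0..1} \<Longrightarrow> snd (c u) = \<gamma> u" using c unfolding is_lift_def by auto
  have b': "pathin I (\<pi> \<circ> b)" using pathin_compose[OF b(1) continuous_\<pi>] .
  have same: "(\<pi> \<circ> b) u = c u" if u: "u \<in> {0..1}" for u
  proof (rule lift_unique_connected[OF covU connected_unit_interval b'[unfolded pathin_def] c'(1)[unfolded pathin_def]])
    show "snd ((\<pi> \<circ> b) v) = snd (c v)" if "v \<in> topspace (top_of_set {0..1})" for v
      using b(2)[of v] c'(2)[of v] that by simp
    show "(\<pi> \<circ> b) 0 = c 0" unfolding c(2) comp_apply b(3) ..
  qed (use u in simp_all)
  have "p (fst (b u)) = fst (c u)" if "u \<in> {0..1}" for u using same[OF that] by (metis comp_apply fst_map_prod)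
  moreover have "pathin E (fst \<circ> b)" using pathin_compose[OF b(1) continuous_fst_I'] .
  ultimately show ?thesis unfolding transport_def is_lift_def
    by (intro exI[of _ "fst \<circ> b"]) (use b in auto)
qed

lemma transport_wreath_unique:
  assumes t: "transport I' snd \<gamma> z z1" "transport I' snd \<gamma> z z2"
  shows "z1 = z2"
proof -
  obtain c where c: "is_lift I snd \<gamma> c" "c 0 = \<pi> z"
    using transport_project[OF t(1)] unfolding transport_def by blast
  have "fst z1 = fst z2"
    using transport_unique[OF cov transport_wreath_fst[OF c t(1)] transport_wreath_fst[OF c t(2)]] .
  moreover have "snd z1 = snd z2" using transport_ends(4)[OF t(1)] transport_ends(4)[OF t(2)] by simp
  ultimately show ?thesis by (simp add: prod_eq_iff)
qed

lemma transport_wreath_exists: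
  assumes \<gamma>: "\<gamma> \<in> loops Y f" and z: "z \<in> S'"
  shows "\<exists>z'\<in>S'. transport I' snd \<gamma> z z'"
proof -
  have \<gamma>': "pathin Y \<gamma>" "\<gamma> 0 = f" "\<gamma> 1 = f" using \<gamma> by (auto simp: loops_def)
  have \<pi>z: "\<pi> z \<in> topspace I" "snd (\<pi> z) = \<gamma> 0" using z S'_snd[OF z] \<gamma>' unfolding mem_S' mem_S topspace_I by auto
  obtain s where "transport I snd \<gamma> (\<pi> z) s" by (rule transport_exists[OF covU \<gamma>'(1) \<pi>z])
  then obtain c where c: "is_lift I snd \<gamma> c" "c 0 = \<pi> z" unfolding transport_def by blast
  have "pathin B (fst \<circ> c)" using c pathin_compose[OF _ continuous_fst_I] by (auto simp: is_lift_def)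
  moreover have "fst z \<in> topspace E" "p (fst z) = (fst \<circ> c) 0" using z c unfolding mem_S' by auto
  ultimately obtain e where e: "transport E p (fst \<circ> c) (fst z) e" by (rule transport_exists[OF cov])
  have t: "transport I' snd \<gamma> z (e, f)"
    by (rule transport_wreath[OF c(1) e]) (use S'_snd[OF z] \<gamma>' in \<open>auto simp: prod_eq_iff\<close>)
  moreover have "(e, f) \<in> S'"
    using transport_ends[OF t] f unfolding solutions_def fiber_def by simp
  ultimately show ?thesis by blast
qed

lemma mem_galois_wreath:
  "w \<in> galois_group E Y U' f \<longleftrightarrow> w permutes S' \<and> (\<exists>\<gamma>\<in>loops Y f. \<forall>z\<in>S'. transport I' snd \<gamma> z (w z))"
  unfolding galois_group_def monodromy_group_def solutions_def transport_def by simp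

lemma mem_galois:
  "g \<in> galois_group B Y U f \<longleftrightarrow> g permutes S \<and> (\<exists>\<gamma>\<in>loops Y f. \<forall>s\<in>S. transport I snd \<gamma> s (g s))"
  unfolding galois_group_def monodromy_group_def solutions_def transport_def by simp

lemma monodromy_permutation:
  assumes \<gamma>: "\<gamma> \<in> loops Y f"
  obtains g where "g permutes S" "\<And>s. s \<in> S \<Longrightarrow> transport I snd \<gamma> s (g s)"
proof (rule permutation_of_relation[OF finite_S, of "transport I snd \<gamma>"])
  have \<gamma>': "pathin Y \<gamma>" "\<gamma> 0 = f" "\<gamma> 1 = f" using \<gamma> by (auto simp: loops_def)
  show "\<exists>t\<in>S. transport I snd \<gamma> s t" if s: "s \<in> S" for s
  proof -
    have "s \<in> topspace I" "snd s = \<gamma> 0" using s \<gamma>' unfolding mem_S topspace_I by auto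
    then obtain t where t: "transport I snd \<gamma> s t" by (rule transport_exists[OF covU \<gamma>'(1)])
    then have "t \<in> S" using transport_ends[OF t] \<gamma>' unfolding solutions_def fiber_def by simp
    then show ?thesis using t by blast
  qed
  show "s = s'" if "transport I snd \<gamma> s t" "transport I snd \<gamma> s' t" for s s' t
    using transport_unique_start[OF covU that] .
qed (use that in blast)

abbreviation "W \<equiv> wreath_group E B Y p U f"

lemma mem_W:
  "w \<in> W \<longleftrightarrow> w permutes S' \<and> (\<forall>h\<in>carrier Deck. \<forall>z\<in>S'. w (map_prod h id z) = map_prod h id (w z)) \<and>
     (\<exists>g\<in>galois_group B Y U f. \<forall>z\<in>S'. \<pi> (w z) = g (\<pi> z))"
  unfolding wreath_group_def wreath_permutations_def by simp

lemma deck_S':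
  assumes h: "h \<in> carrier Deck" and z: "z \<in> S'" shows "map_prod h id z \<in> S'"
proof -
  have D: "h \<in> deck_transformations E p" using h by simp
  have "fst z \<in> topspace E" using z mem_S' by blast
  then have "fst (map_prod h id z) \<in> topspace E" "\<pi> (map_prod h id z) = \<pi> z"
    using deck_facts(2,3)[OF D] by (simp_all add: prod_eq_iff)
  then show ?thesis using z mem_S' by metis
qed

lemma same_fiber_deck:
  assumes z: "z \<in> S'" "z' \<in> S'" "\<pi> z = \<pi> z'"
  obtains h where "h \<in> carrier Deck" "z' = map_prod h id z"
proof -
  have "p (fst z) = p (fst z')" using z(3) by (metis fst_map_prod)
  then obtain h where "h \<in> carrier Deck" "h (fst z) = fst z'" using deck_exists z mem_S' by blast
  then show ?thesis using that[of h] S'_snd[OF z(1)] S'_snd[OF z(2)] by (simp add: prod_eq_iff)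
qed

text \<open>
  A deck transformation maps lifts to lifts, so by uniqueness it commutes with monodromy.
\<close>
lemma galois_wreath_subset: "galois_group E Y U' f \<subseteq> W"
proof
  fix w assume "w \<in> galois_group E Y U' f"
  then obtain \<gamma> where w: "w permutes S'" and \<gamma>: "\<gamma> \<in> loops Y f" and t: "\<And>z. z \<in> S' \<Longrightarrow> transport I' snd \<gamma> z (w z)"
    unfolding mem_galois_wreath by blast
  obtain g where g: "g permutes S" "\<And>s. s \<in> S \<Longrightarrow> transport I snd \<gamma> s (g s)" by (rule monodromy_permutation[OF \<gamma>], rule that) auto
  then have "g \<in> galois_group B Y U f" unfolding mem_galois using \<gamma> by blast
  moreover have "\<pi> (w z) = g (\<pi> z)" if z: "z \<in> S'" for z
    using transport_unique[OF covU transport_project[OF t[OF z]]] g(2) z mem_S' by blast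
  moreover have "w (map_prod h id z) = map_prod h id (w z)" if h: "h \<in> carrier Deck" and z: "z \<in> S'" for h z
    using transport_wreath_unique[OF t[OF deck_S'[OF h z]] transport_deck[OF t[OF z] h]] .
  ultimately show "w \<in> W" unfolding mem_W using w by blast
qed

lemma lift_loop:
  assumes "is_lift I snd \<gamma> c" "c 0 = s" "c 1 = s" shows "fst \<circ> c \<in> loops B (fst s)"
  using assms pathin_compose[OF _ continuous_fst_I] by (auto simp: loops_def is_lift_def)

abbreviation "d \<equiv> card S"
abbreviation "lattice_sum \<delta> \<equiv> solution_lattice B Y U f \<delta> <#>\<^bsub>H1_power B d\<^esub> H1_power_image E B p d"

lemma ranking_index:
  assumes \<delta>: "ranking S \<delta>"
  shows "s \<in> S \<Longrightarrow> \<delta> s \<in> {1..d}" "s \<in> S \<Longrightarrow> inv_into S \<delta> (\<delta> s) = s" "i \<in> {1..d} \<Longrightarrow> inv_into S \<delta> i \<in> S"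
    "i \<in> {1..d} \<Longrightarrow> \<delta> (inv_into S \<delta> i) = i"
  using assms unfolding ranking_def bij_betw_def
  by (auto intro: inv_into_into f_inv_into_f)

text \<open>
  Given \<open>w\<close> in the wreath group over \<open>g \<in> G\<close>, a loop \<open>\<gamma>\<^sub>0\<close> with monodromy \<open>g\<close> on the solutions yields \<open>w\<^sub>0\<close>
  over the same \<open>g\<close>. What is missing is an element over the identity that moves \<open>w\<^sub>0 z\<close> to
  \<open>w z\<close>. At each solution \<open>s\<close> it is realised by some loop \<open>\<alpha> s\<close>, since \<open>E\<close> is path-connected;
  by assumption the classes of these loops agree, up to the image of \<open>H\<^sub>1(E)\<close>, with those of the loops that the
  solutions run through along one loop \<open>\<gamma>\<^sub>1\<close>, and then \<open>\<gamma>\<^sub>1\<close> has the same effect.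
\<close>
lemma lattice_imp_wreath:
  assumes \<delta>: "ranking S \<delta>" and eq: "carrier (H1_power B d) = lattice_sum \<delta>"
  shows "W \<subseteq> galois_group E Y U' f"
proof
  note r = ranking_index[OF \<delta>]
  fix w assume "w \<in> W"
  then obtain g where w: "w permutes S'" and comm: "\<And>h z. h \<in> carrier Deck \<Longrightarrow> z \<in> S' \<Longrightarrow> w (map_prod h id z) = map_prod h id (w z)"
    and g: "g \<in> galois_group B Y U f" and wg: "\<And>z. z \<in> S' \<Longrightarrow> \<pi> (w z) = g (\<pi> z)"
    unfolding mem_W by blast
  obtain \<gamma>0 where \<gamma>0: "\<gamma>0 \<in> loops Y f" and gp: "g permutes S" and tg: "\<And>s. s \<in> S \<Longrightarrow> transport I snd \<gamma>0 s (g s)"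
    using g unfolding mem_galois by blast
  have wS: "w z \<in> S'" if "z \<in> S'" for z using w that by (simp add: permutes_in_image)
  have "\<exists>w0. \<forall>z\<in>S'. w0 z \<in> S' \<and> transport I' snd \<gamma>0 z (w0 z)"
    using transport_wreath_exists[OF \<gamma>0] by (intro bchoice) blast
  then obtain w0 where w0: "\<And>z. z \<in> S' \<Longrightarrow> w0 z \<in> S'" "\<And>z. z \<in> S' \<Longrightarrow> transport I' snd \<gamma>0 z (w0 z)" by blast
  have w0g: "\<pi> (w0 z) = g (\<pi> z)" if z: "z \<in> S'" for z
    using transport_unique[OF covU transport_project[OF w0(2)[OF z]]] tg z mem_S' by blast
  \<comment> \<open>One point \<open>Z s\<close> for each \<open>s\<close> suffices: the other points that \<open>w\<close> sends over \<open>s\<close> are deck translates.\<close>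
  have "\<exists>z \<alpha>. z \<in> S' \<and> g (\<pi> z) = s \<and> \<alpha> \<in> loops B (fst s) \<and> transport E p \<alpha> (fst (w0 z)) (fst (w z))" if s: "s \<in> S" for s
  proof -
    obtain r where r: "r \<in> S" "g r = s" using gp s by (metis imageE permutes_image)
    then obtain z where z: "z \<in> S'" "\<pi> z = r" using S'_over by blast
    have e: "fst (w0 z) \<in> topspace E" "fst (w z) \<in> topspace E" using w0(1)[OF z(1)] wS[OF z(1)] mem_S' by blast+
    have pe: "p (fst (w0 z)) = fst s" "p (fst (w z)) = fst s"
      using w0g[OF z(1)] wg[OF z(1)] z r by (metis fst_map_prod)+
    obtain a where a: "pathin E a" "a 0 = fst (w0 z)" "a 1 = fst (w z)"
      using path_connected_E e unfolding path_connected_space_def by meson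
    have "p \<circ> a \<in> loops B (fst s)"
      using pathin_compose[OF a(1) covering_continuous[OF cov]] a pe by (simp add: loops_def)
    moreover have "transport E p (p \<circ> a) (fst (w0 z)) (fst (w z))" using transport_of_path[OF a(1), of p] unfolding a(2,3) .
    ultimately show ?thesis using z r by blast
  qed
  then obtain Z \<alpha> where Z: "\<And>s. s \<in> S \<Longrightarrow> Z s \<in> S'" "\<And>s. s \<in> S \<Longrightarrow> g (\<pi> (Z s)) = s"
    and \<alpha>: "\<And>s. s \<in> S \<Longrightarrow> \<alpha> s \<in> loops B (fst s)"
       "\<And>s. s \<in> S \<Longrightarrow> transport E p (\<alpha> s) (fst (w0 (Z s))) (fst (w (Z s)))" by metis
  \<comment> \<open>The classes of the loops \<open>\<alpha> s\<close>, ordered by the ranking.\<close>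
  define v where "v = (\<lambda>i\<in>{1..d}. homology_class_of_loop B (\<alpha> (inv_into S \<delta> i)))"
  have "v \<in> carrier (H1_power B d)"
    unfolding v_def using homology_class_of_loop_in_H1[OF \<alpha>(1)] r(3) by auto
  then obtain \<eta> u where \<eta>: "\<eta> \<in> solution_lattice B Y U f \<delta>" and u: "u \<in> H1_power_image E B p d"
    and v: "v = \<eta> \<otimes>\<^bsub>H1_power B d\<^esub> u" unfolding eq set_mult_def by blast
  obtain \<gamma>1 where \<gamma>1: "\<gamma>1 \<in> loops Y f" and lift: "\<And>s. s \<in> S \<Longrightarrow> \<exists>c. is_lift I snd \<gamma>1 c \<and> c 0 = s \<and> c 1 = s \<and>
      \<eta> (\<delta> s) = homology_class_of_loop B (fst \<circ> c)"
    using \<eta> unfolding solution_lattice_def by blast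
  obtain C where C: "C \<in> carrier (H1_power E d)" "u = (\<lambda>i\<in>{1..d}. H1_map E B p (C i))"
    using u unfolding H1_power_image_def by blast
  have key: "transport I' snd \<gamma>1 (w0 (Z s)) (w (Z s))" if s: "s \<in> S" for s
  proof -
    obtain c where c: "is_lift I snd \<gamma>1 c" "c 0 = s" "c 1 = s" "\<eta> (\<delta> s) = homology_class_of_loop B (fst \<circ> c)"
      using lift[OF s] by blast
    have "v (\<delta> s) = homology_class_of_loop B (\<alpha> s)" using r(1,2)[OF s] unfolding v_def by simp
    moreover have "v (\<delta> s) = homology_class_of_loop B (fst \<circ> c) \<otimes>\<^bsub>H1 B\<^esub> H1_map E B p (C (\<delta> s))"
      using r(1)[OF s] c(4) unfolding v C(2) by simp
    ultimately have eq: "homology_class_of_loop B (\<alpha> s) = homology_class_of_loop B (fst \<circ> c) \<otimes>\<^bsub>H1 B\<^esub> H1_map E B p (C (\<delta> s))"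
      by simp
    have "C (\<delta> s) \<in> carrier (H1 E)" using C(1) r(1)[OF s] by auto
    then have "transport E p (fst \<circ> c) (fst (w0 (Z s))) (fst (w (Z s)))"
      using homologous_loops_same_transport[OF \<alpha>(1)[OF s] lift_loop[OF c(1-3)] _ eq \<alpha>(2)[OF s]] by blast
    then show ?thesis
    proof (rule transport_wreath[OF c(1)])
      have "snd (w0 (Z s)) = f" "snd (w (Z s)) = f" using S'_snd w0(1) wS Z(1)[OF s] by blast+
      moreover have "\<gamma>1 0 = f" "\<gamma>1 1 = f" using \<gamma>1 by (auto simp: loops_def)
      ultimately show "w0 (Z s) = (fst (w0 (Z s)), \<gamma>1 0)" "w (Z s) = (fst (w (Z s)), \<gamma>1 1)" by (simp_all add: prod_eq_iff)
    qed
  qed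
  have "transport I' snd (concat_loops \<gamma>0 \<gamma>1) z (w z)" if z: "z \<in> S'" for z
  proof -
    define s where "s = g (\<pi> z)"
    have \<pi>z: "\<pi> z \<in> S" using z mem_S' by blast
    have s: "s \<in> S" using \<pi>z gp by (simp add: s_def permutes_in_image)
    have "\<pi> (Z s) = \<pi> z" using Z(2)[OF s] gp unfolding s_def by (metis permutes_inverses(2))
    then obtain h where h: "h \<in> carrier Deck" "z = map_prod h id (Z s)" by (rule same_fiber_deck[OF Z(1)[OF s] z])
    have "w0 z = map_prod h id (w0 (Z s))"
      using transport_wreath_unique[OF w0(2)[OF z]] transport_deck[OF w0(2)[OF Z(1)[OF s]] h(1)] h(2) by simp
    moreover have "w z = map_prod h id (w (Z s))" using comm[OF h(1) Z(1)[OF s]] h(2) by simp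
    ultimately have "transport I' snd \<gamma>1 (w0 z) (w z)" using transport_deck[OF key[OF s] h(1)] by simp
    then show ?thesis using transport_concat[OF w0(2)[OF z]] by blast
  qed
  then show "w \<in> galois_group E Y U' f"
    unfolding mem_galois_wreath using w concat_loops_in_loops[OF \<gamma>0 \<gamma>1] by blast
qed

lemma lattice_sum_subset:
  assumes \<delta>: "ranking S \<delta>" shows "lattice_sum \<delta> \<subseteq> carrier (H1_power B d)"
proof -
  note r = ranking_index[OF \<delta>]
  interpret G: group "H1_power B d" by (rule product_group) simp
  have "\<eta> \<in> carrier (H1_power B d)" if \<eta>: "\<eta> \<in> solution_lattice B Y U f \<delta>" for \<eta>
  proof -
    have ext: "\<eta> \<in> extensional {1..d}" using \<eta> unfolding solution_lattice_def by blast
    have "\<eta> i \<in> carrier (H1 B)" if i: "i \<in> {1..d}" for i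
    proof -
      obtain \<gamma> c where "is_lift I snd \<gamma> c" "c 0 = inv_into S \<delta> i" "c 1 = inv_into S \<delta> i"
        "\<eta> (\<delta> (inv_into S \<delta> i)) = homology_class_of_loop B (fst \<circ> c)"
        using \<eta> r(3)[OF i] unfolding solution_lattice_def by blast
      then show ?thesis using homology_class_of_loop_in_H1[OF lift_loop] r(4)[OF i] by metis
    qed
    then show ?thesis using ext by (simp add: PiE_iff)
  qed
  moreover have "u \<in> carrier (H1_power B d)" if "u \<in> H1_power_image E B p d" for u
    using that hom_induced_carrier unfolding H1_power_image_def by fastforce
  ultimately show ?thesis using G.m_closed unfolding set_mult_def by blast
qed

text \<open>
  Represent a vector \<open>v\<close> of classes by loops \<open>\<alpha> s\<close> at the solutions. Their monodromies, applied
  independently to the fibres over the solutions, form an element of the wreath group over the identity. If some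
  loop \<open>\<gamma>\<close> has this monodromy, then the loops of the solutions along \<open>\<gamma>\<close> have the same effect as the \<open>\<alpha> s\<close>,
  so that their classes differ from \<open>v\<close> by the image of \<open>H\<^sub>1(E)\<close>.
\<close>
lemma wreath_imp_lattice:
  assumes \<delta>: "ranking S \<delta>" and sub: "W \<subseteq> galois_group E Y U' f"
  shows "carrier (H1_power B d) = lattice_sum \<delta>"
proof (rule equalityI[OF subsetI lattice_sum_subset[OF \<delta>]])
  note r = ranking_index[OF \<delta>]
  fix v assume v: "v \<in> carrier (H1_power B d)"
  have "\<exists>\<alpha>. \<alpha> \<in> loops B (fst s) \<and> homology_class_of_loop B \<alpha> = v (\<delta> s)" if s: "s \<in> S" for s
  proof -
    have "v (\<delta> s) \<in> carrier (H1 B)" using v r(1)[OF s] by auto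
    from H1_class_of_loop[OF path_connected_B S_in[OF s] this] show ?thesis by blast
  qed
  then obtain \<alpha> where \<alpha>: "\<And>s. s \<in> S \<Longrightarrow> \<alpha> s \<in> loops B (fst s)" "\<And>s. s \<in> S \<Longrightarrow> homology_class_of_loop B (\<alpha> s) = v (\<delta> s)"
    by metis
  \<comment> \<open>The monodromy of \<open>\<alpha> s\<close> on the points over \<open>s\<close>, for all \<open>s\<close> at once.\<close>
  define R where "R z z' \<longleftrightarrow> \<pi> z' = \<pi> z \<and> transport E p (\<alpha> (\<pi> z)) (fst z) (fst z')" for z z'
  obtain w where w: "w permutes S'" "\<And>z. z \<in> S' \<Longrightarrow> R z (w z)"
  proof (rule permutation_of_relation[OF finite_S', of R])
    show "\<exists>z'\<in>S'. R z z'" if z: "z \<in> S'" for z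
    proof -
      have s: "\<pi> z \<in> S" "fst z \<in> topspace E" using z mem_S' by blast+
      have a: "pathin B (\<alpha> (\<pi> z))" "\<alpha> (\<pi> z) 0 = fst (\<pi> z)" "\<alpha> (\<pi> z) 1 = fst (\<pi> z)" using \<alpha>(1)[OF s(1)] by (simp_all add: loops_def)
      have "p (fst z) = \<alpha> (\<pi> z) 0" using a(2) by simp
      then obtain e where e: "transport E p (\<alpha> (\<pi> z)) (fst z) e" by (rule transport_exists[OF cov a(1) s(2)])
      have "\<pi> (e, snd z) = \<pi> z" using transport_ends(4)[OF e] a(3) by (simp add: prod_eq_iff)
      then have "R z (e, snd z)" "(e, snd z) \<in> S'"
        using e transport_ends(2)[OF e] s(1) unfolding R_def mem_S' by simp_all
      then show ?thesis by blast
    qed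
    show "z = z'" if "R z t" "R z' t" for z z' t
    proof -
      have "\<pi> z = \<pi> z'" using that R_def by metis
      then have "fst z = fst z'" using transport_unique_start[OF cov, of "\<alpha> (\<pi> z)" "fst z" "fst t" "fst z'"] that by (simp add: R_def)
      moreover have "snd z = snd z'" using \<open>\<pi> z = \<pi> z'\<close> by (metis snd_map_prod id_apply)
      ultimately show ?thesis by (simp add: prod_eq_iff)
    qed
  qed (use that in blast)
  have wS: "w z \<in> S'" if "z \<in> S'" for z using w(1) that by (simp add: permutes_in_image)
  have "w \<in> W" unfolding mem_W
  proof (intro conjI ballI w(1))
    fix h z assume h: "h \<in> carrier Deck" and z: "z \<in> S'"
    have D: "h \<in> deck_transformations E p" using h by simp
    note hz = deck_S'[OF h z]
    have e: "fst z \<in> topspace E" using z mem_S' by blast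
    have \<pi>h: "\<pi> (map_prod h id z) = \<pi> z" using deck_facts(3)[OF D e] by (simp add: prod_eq_iff)
    have "transport E p (\<alpha> (\<pi> z)) (h (fst z)) (fst (w (map_prod h id z)))"
      using w(2)[OF hz] unfolding R_def \<pi>h by simp
    moreover have "transport E p (\<alpha> (\<pi> z)) (h (fst z)) (h (fst (w z)))"
      using deck_transport[OF D] w(2)[OF z] unfolding R_def by blast
    ultimately have "fst (w (map_prod h id z)) = h (fst (w z))" using transport_unique[OF cov] by blast
    then show "w (map_prod h id z) = map_prod h id (w z)"
      using S'_snd[OF wS[OF hz]] S'_snd[OF wS[OF z]] by (simp add: prod_eq_iff)
  next
    have "transport I snd (\<lambda>_. f) s s" if s: "s \<in> S" for s
      using transport_const[of s I snd] s unfolding mem_S topspace_I by simp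
    then have "id \<in> galois_group B Y U f"
      unfolding mem_galois
      by (intro conjI permutes_id bexI[OF _ const_loop[OF f]] ballI) simp
    moreover have "\<forall>z\<in>S'. \<pi> (w z) = id (\<pi> z)" using w(2) unfolding R_def by simp
    ultimately show "\<exists>g\<in>galois_group B Y U f. \<forall>z\<in>S'. \<pi> (w z) = g (\<pi> z)" by blast
  qed
  then obtain \<gamma> where \<gamma>: "\<gamma> \<in> loops Y f" "\<And>z. z \<in> S' \<Longrightarrow> transport I' snd \<gamma> z (w z)"
    using sub unfolding mem_galois_wreath subset_iff by blast
  have "\<exists>c C. is_lift I snd \<gamma> c \<and> c 0 = s \<and> c 1 = s \<and> C \<in> carrier (H1 E) \<and>
      v (\<delta> s) = homology_class_of_loop B (fst \<circ> c) \<otimes>\<^bsub>H1 B\<^esub> H1_map E B p C" if s: "s \<in> S" for s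
  proof -
    obtain z where z: "z \<in> S'" "\<pi> z = s" using S'_over[OF s] by blast
    have \<pi>w: "\<pi> (w z) = s" and t: "transport E p (\<alpha> s) (fst z) (fst (w z))" using w(2)[OF z(1)] z(2) unfolding R_def by simp_all
    obtain c where c: "is_lift I snd \<gamma> c" "c 0 = s" "c 1 = s"
      using transport_project[OF \<gamma>(2)[OF z(1)]] unfolding z(2) \<pi>w transport_def by blast
    have "transport E p (fst \<circ> c) (fst z) (fst (w z))"
      by (rule transport_wreath_fst[OF c(1) _ \<gamma>(2)[OF z(1)]]) (simp add: c z)
    from same_transport_homologous[OF \<alpha>(1)[OF s] lift_loop[OF c] t this] show ?thesis
      using c unfolding \<alpha>(2)[OF s] by blast
  qed
  then obtain c C where c: "\<And>s. s \<in> S \<Longrightarrow> is_lift I snd \<gamma> (c s)" "\<And>s. s \<in> S \<Longrightarrow> c s 0 = s" "\<And>s. s \<in> S \<Longrightarrow> c s 1 = s"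
    and C: "\<And>s. s \<in> S \<Longrightarrow> C s \<in> carrier (H1 E)"
    and eq: "\<And>s. s \<in> S \<Longrightarrow> v (\<delta> s) = homology_class_of_loop B (fst \<circ> c s) \<otimes>\<^bsub>H1 B\<^esub> H1_map E B p (C s)"
    by metis
  let ?inv = "inv_into S \<delta>"
  define \<eta> where "\<eta> = (\<lambda>i\<in>{1..d}. homology_class_of_loop B (fst \<circ> c (?inv i)))"
  define D where "D = (\<lambda>i\<in>{1..d}. C (?inv i))"
  have "\<eta> (\<delta> s) = homology_class_of_loop B (fst \<circ> c s)" if "s \<in> S" for s
    using r(1,2)[OF that] unfolding \<eta>_def by simp
  then have "\<forall>s\<in>S. \<exists>c. is_lift I snd \<gamma> c \<and> c 0 = s \<and> c 1 = s \<and> \<eta> (\<delta> s) = homology_class_of_loop B (fst \<circ> c)"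
    using c by blast
  moreover have "\<eta> \<in> extensional {1..d}" by (simp add: \<eta>_def)
  ultimately have \<eta>: "\<eta> \<in> solution_lattice B Y U f \<delta>"
    unfolding solution_lattice_def using \<gamma>(1) by blast
  have "D \<in> carrier (H1_power E d)" unfolding D_def using C r(3) by auto
  then have u: "(\<lambda>i\<in>{1..d}. H1_map E B p (D i)) \<in> H1_power_image E B p d" unfolding H1_power_image_def by blast
  have "v = \<eta> \<otimes>\<^bsub>H1_power B d\<^esub> (\<lambda>i\<in>{1..d}. H1_map E B p (D i))"
  proof
    fix i show "v i = (\<eta> \<otimes>\<^bsub>H1_power B d\<^esub> (\<lambda>i\<in>{1..d}. H1_map E B p (D i))) i"
    proof (cases "i \<in> {1..d}")
      case True
      then show ?thesis using eq[OF r(3)[OF True]] r(4)[OF True] by (simp add: \<eta>_def D_def)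
    next
      case False
      then show ?thesis using v by (auto simp: PiE_iff extensional_def)
    qed
  qed
  then show "v \<in> lattice_sum \<delta>" using \<eta> u unfolding set_mult_def by blast
qed

lemma ranking_exists: "\<exists>\<delta>. ranking S \<delta>"
  unfolding ranking_def using ex_bij_betw_finite_nat[OF finite_S]
  by (metis finite_S bij_betw_iff_card card_atLeastAtMost diff_Suc_1 finite_atLeastAtMost)

end

section \<open>The criterion for a full wreath product\<close>

theorem theorem1p19:
  fixes T :: "'a chart set" and C :: "'b chart set" and U :: "('a \<times> 'b) set"
    and T' :: "'c topology" and \<phi> :: "'c \<Rightarrow> 'a" and f :: 'b and d :: nat
  defines "Tan \<equiv> analytic_topology T" and "Can \<equiv> analytic_topology C"
  defines "S \<equiv> solutions Tan Can U f"
    and "G' \<equiv> galois_group T' Can (wreath_incidence T' \<phi> U) f"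
    and "W \<equiv> wreath_group T' Tan Can \<phi> U f"
  assumes "enumerative_problem T C U"
    and "f \<in> variety_points C"
    and "d = card S"
    and "galois_covering T' Tan \<phi>"
    and "strongly_inductive_covering T' Tan \<phi>"
  shows "G' \<subseteq> W \<and>
    (G' = W \<longleftrightarrow> (\<exists>\<delta>. ranking S \<delta> \<and>
       carrier (H1_power Tan d) =
         solution_lattice Tan Can U f \<delta> <#>\<^bsub>H1_power Tan d\<^esub> H1_power_image T' Tan \<phi> d)) \<and>
    (G' = W \<longleftrightarrow> (\<forall>\<delta>. ranking S \<delta> \<longrightarrow>
       carrier (H1_power Tan d) =
         solution_lattice Tan Can U f \<delta> <#>\<^bsub>H1_power Tan d\<^esub> H1_power_image T' Tan \<phi> d))"
proof -
  interpret P: wreath_problem T' Tan \<phi> Can U f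
  proof
    show "galois_covering T' Tan \<phi>" by fact
    show "inductive_covering T' Tan \<phi>"
      using \<open>strongly_inductive_covering T' Tan \<phi>\<close> unfolding strongly_inductive_covering_def by (elim conjE)
    show "U \<subseteq> topspace Tan \<times> topspace Can" "finite_covering (incidence_topology Tan Can U) Can snd"
      using \<open>enumerative_problem T C U\<close>
      unfolding enumerative_problem_def algebraic_subset_of_product_def Tan_def Can_def topspace_analytic_topology by blast+
    show "f \<in> topspace Can" using \<open>f \<in> variety_points C\<close> unfolding Can_def topspace_analytic_topology .
  qed
  have sub: "G' \<subseteq> W" unfolding G'_def W_def by (rule P.galois_wreath_subset)
  have iff: "G' = W \<longleftrightarrow> carrier (H1_power Tan d) =
         solution_lattice Tan Can U f \<delta> <#>\<^bsub>H1_power Tan d\<^esub> H1_power_image T' Tan \<phi> d" if "ranking S \<delta>" for \<delta>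
    using P.lattice_imp_wreath[of \<delta>] P.wreath_imp_lattice[of \<delta>] that sub
    unfolding G'_def W_def S_def \<open>d = card S\<close> by blast
  obtain \<delta> where "ranking S \<delta>" using P.ranking_exists unfolding S_def by blast
  then show ?thesis using sub iff by blast
qed

end
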